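(* Let $\mathbb{D}$ be a locally presentable double category. Then the forgetful functor $U\colon\mathsf{Mnd}(\mathbb{D})\to\mathsf{End}(\mathbb{D})$ has a left adjoint.
   Context: A (pseudo) double category $\mathbb{D}$ consists of a category $\mathbb{D}_0$ (objects: 0-cells; morphisms: vertical 1-cells), a category $\mathbb{D}_1$ (objects: horizontal 1-cells; morphisms: 2-cells), and functors $\mathbf{1}\colon\mathbb{D}_0\to\mathbb{D}_1$, $X\mapsto 1_X$, $f\mapsto 1_f$ (units), $\mathfrak{s},\mathfrak{t}\colon\mathbb{D}_1\to\mathbb{D}_0$ (source, target), $\odot\colon\mathbb{D}_1\times_{\mathbb{D}_0}\mathbb{D}_1\to\mathbb{D}_1$ (horizontal composition; $M\odot N$ is defined when $\mathfrak{s}(M)=\mathfrak{t}(N)$), with $\mathfrak{s}(1_X)=\mathfrak{t}(1_X)=X$, $\mathfrak{s}(M\odot N)=\mathfrak{s}(N)$, $\mathfrak{t}(M\odot N)=\mathfrak{t}(M)$ (and likewise on morphisms), together with natural associativity and left/right unit isomorphisms for $\odot$ and $\mathbf{1}$ in $\mathbb{D}_1$ whose images under $\mathfrak{s}$ and $\mathfrak{t}$ are identities, satisfying the usual coherence conditions. A horizontal 1-cell $M$ with $\mathfrak{s}(M)=X$, $\mathfrak{t}(M)=Y$ is written $M\colon X\to Y$. A 2-cell $\alpha$ is globular if $\mathfrak{s}(\alpha)$ and $\mathfrak{t}(\alpha)$ are identities. $\mathbb{D}$ is fibrant if $\langle\mathfrak{s},\mathfrak{t}\rangle\colon\mathbb{D}_1\to\mathbb{D}_0\times\mathbb{D}_0$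 is a (Grothendieck) fibration, equivalently an opfibration. For a 0-cell $X$, ${}^X\mathbb{D}_1$ (resp. $\mathbb{D}_1^X$) is the subcategory of $\mathbb{D}_1$ of horizontal 1-cells with source (resp. target) $X$ and 2-cells $\alpha$ with $\mathfrak{s}(\alpha)=\mathrm{id}_X$ (resp. $\mathfrak{t}(\alpha)=\mathrm{id}_X$). A fibrant double category $\mathbb{D}$ is locally $\lambda$-presentable, for a regular cardinal $\lambda$, if $\mathbb{D}_0$ and $\mathbb{D}_1$ are locally $\lambda$-presentable categories, $\mathfrak{s},\mathfrak{t}\colon\mathbb{D}_1\to\mathbb{D}_0$ are cocontinuous right adjoints, and for every horizontal 1-cell $M\colon X\to Y$ the functors $-\odot M\colon{}^Y\mathbb{D}_1\to{}^X\mathbb{D}_1$ and $M\odot-\colon\mathbb{D}_1^X\to\mathbb{D}_1^Y$ are accessible. $\mathbb{D}$ is locally presentable if it is locally $\lambda$-presentable for some regular $\lambda$. (In the paper this accessibility requirement is understood as equivalent to $\mathbb{D}$ having stable local filtered colimits, i.e. each category $\mathbb{D}[X,Y]$ of horizontal 1-cells $X\to Y$ and globular 2-cells has filtered colimits, preserved by $M\odot-$ and $-\odot M$ for every horizontal 1-cell $M$.) $\mathsf{End}(\mathbb{D})$ is the subcategory of $\mathbb{D}_1$ given by the equalizer of $\mathfrak{s},\mathfrak{t}$: objects are horizontal endo-1-cells $M\colon X\to X$, morphisms are 2-cells $\alpha$ with $\mathfrak{s}(\alpha)=\mathfrak{t}(\alpha)$. A monad in $\mathbb{D}$ is a horizontal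 endo-1-cell $A\colon X\to X$ with globular 2-cells $\mu\colon A\odot A\Rightarrow A$, $\eta\colon 1_X\Rightarrow A$ satisfying the usual associativity and unit laws. A monad morphism from $A\colon X\to X$ to $B\colon Y\to Y$ is a 2-cell $\alpha\colon A\Rightarrow B$ with $\mathfrak{s}(\alpha)=\mathfrak{t}(\alpha)=f\colon X\to Y$ such that $\mu_B(\alpha\odot\alpha)=\alpha\mu_A$ and $\alpha\eta_A=\eta_B 1_f$. These form the category $\mathsf{Mnd}(\mathbb{D})$, and $U$ forgets $\mu,\eta$. *)

theory Defs
  imports "HOL-Library.FuncSet"
begin

unbundle cardinal_syntax

section \<open>Size\<close>

text \<open>
  Local presentability distinguishes small sets from large ones.  As usual this is done relative to a
  Grothendieck universe, given here by an inaccessible cardinal \<open>\<kappa>\<close>: a set is small if it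
  has fewer than \<open>\<kappa>\<close> elements.  Every small set is in bijection with a subset of the carrier
  type \<open>'u\<close> of \<open>\<kappa>\<close>, so small index categories may be taken to live on
  \<open>'u\<close>, and small cardinals to be relations on \<open>'u\<close>.  Presentability ranks
  are called \<open>\<theta>\<close> and accessibility ranks \<open>\<mu>\<close>.
\<close>

definition inaccessible :: "'u rel \<Rightarrow> bool" where
  "inaccessible \<kappa> \<longleftrightarrow> Card_order \<kappa> \<and> natLeq <o \<kappa> \<and> regularCard \<kappa> \<and>
     (\<forall>A :: 'u set. |A| <o \<kappa> \<longrightarrow> |Pow A| <o \<kappa>)"

definition small :: "'u rel \<Rightarrow> 'x set \<Rightarrow> bool" where
  "small \<kappa> A \<longleftrightarrow> |A| <o \<kappa>"

definition small_regular :: "'u rel \<Rightarrow> 'u rel \<Rightarrow> bool" where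
  "small_regular \<kappa> \<theta> \<longleftrightarrow> Cinfinite \<theta> \<and> regularCard \<theta> \<and> \<theta> <o \<kappa>"


section \<open>Categories, functors, adjunctions\<close>

record ('o, 'a) cat =
  Obj :: "'o set"
  Arr :: "'a set"
  Dom :: "'a \<Rightarrow> 'o"
  Cod :: "'a \<Rightarrow> 'o"
  Ident :: "'o \<Rightarrow> 'a"
  Comp :: "'a \<Rightarrow> 'a \<Rightarrow> 'a" (infixl "\<cdot>\<index>" 70)

definition Hom :: "('o, 'a) cat \<Rightarrow> 'o \<Rightarrow> 'o \<Rightarrow> 'a set" where
  "Hom C X Y = {f \<in> Arr C. Dom C f = X \<and> Cod C f = Y}"

locale category =
  fixes C :: "('o, 'a) cat" (structure)
  assumes dom_obj: "f \<in> Arr C \<Longrightarrow> Dom C f \<in> Obj C"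
    and cod_obj: "f \<in> Arr C \<Longrightarrow> Cod C f \<in> Obj C"
    and id_hom: "X \<in> Obj C \<Longrightarrow> Ident C X \<in> Hom C X X"
    and comp_hom: "f \<in> Hom C X Y \<Longrightarrow> g \<in> Hom C Y Z \<Longrightarrow> g \<cdot> f \<in> Hom C X Z"
    and id_left: "f \<in> Hom C X Y \<Longrightarrow> Ident C Y \<cdot> f = f"
    and id_right: "f \<in> Hom C X Y \<Longrightarrow> f \<cdot> Ident C X = f"
    and comp_assoc: "f \<in> Hom C W X \<Longrightarrow> g \<in> Hom C X Y \<Longrightarrow> h \<in> Hom C Y Z \<Longrightarrow>
          (h \<cdot> g) \<cdot> f = h \<cdot> (g \<cdot> f)"

definition is_iso :: "('o, 'a) cat \<Rightarrow> 'a \<Rightarrow> bool" where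
  "is_iso C f \<longleftrightarrow> f \<in> Arr C \<and> (\<exists>g \<in> Hom C (Cod C f) (Dom C f).
     g \<cdot>\<^bsub>C\<^esub> f = Ident C (Dom C f) \<and> f \<cdot>\<^bsub>C\<^esub> g = Ident C (Cod C f))"

definition subcat :: "('o, 'a) cat \<Rightarrow> ('o \<Rightarrow> bool) \<Rightarrow> ('a \<Rightarrow> bool) \<Rightarrow> ('o, 'a) cat" where
  "subcat C P Q = C\<lparr>Obj := {X \<in> Obj C. P X}, Arr := {f \<in> Arr C. Q f}\<rparr>"

definition prod_cat :: "('o, 'a) cat \<Rightarrow> ('p, 'b) cat \<Rightarrow> ('o \<times> 'p, 'a \<times> 'b) cat" where
  "prod_cat C D = \<lparr>
     Obj = Obj C \<times> Obj D,
     Arr = Arr C \<times> Arr D,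
     Dom = (\<lambda>(f, g). (Dom C f, Dom D g)),
     Cod = (\<lambda>(f, g). (Cod C f, Cod D g)),
     Ident = (\<lambda>(X, Y). (Ident C X, Ident D Y)),
     Comp = (\<lambda>(f', g') (f, g). (f' \<cdot>\<^bsub>C\<^esub> f, g' \<cdot>\<^bsub>D\<^esub> g))\<rparr>"

record ('o, 'a, 'p, 'b) ftor =
  omap :: "'o \<Rightarrow> 'p"
  amap :: "'a \<Rightarrow> 'b"

definition comp_ftor ::
    "('p, 'b, 'q, 'c) ftor \<Rightarrow> ('o, 'a, 'p, 'b) ftor \<Rightarrow> ('o, 'a, 'q, 'c) ftor" where
  "comp_ftor G F = \<lparr>omap = omap G \<circ> omap F, amap = amap G \<circ> amap F\<rparr>"

definition id_ftor :: "('o, 'a, 'o, 'a) ftor" where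
  "id_ftor = \<lparr>omap = id, amap = id\<rparr>"

definition is_functor :: "('o, 'a) cat \<Rightarrow> ('p, 'b) cat \<Rightarrow> ('o, 'a, 'p, 'b) ftor \<Rightarrow> bool" where
  "is_functor C D F \<longleftrightarrow> category C \<and> category D \<and>
     (\<forall>X \<in> Obj C. omap F X \<in> Obj D \<and> amap F (Ident C X) = Ident D (omap F X)) \<and>
     (\<forall>f \<in> Arr C. amap F f \<in> Hom D (omap F (Dom C f)) (omap F (Cod C f))) \<and>
     (\<forall>f \<in> Arr C. \<forall>g \<in> Arr C. Dom C g = Cod C f \<longrightarrow>
        amap F (g \<cdot>\<^bsub>C\<^esub> f) = amap F g \<cdot>\<^bsub>D\<^esub> amap F f)"

definition is_nat_trans ::
    "('o, 'a) cat \<Rightarrow> ('p, 'b) cat \<Rightarrow> ('o, 'a, 'p, 'b) ftor \<Rightarrow> ('o, 'a, 'p, 'b) ftor \<Rightarrow> ('o \<Rightarrow> 'b) \<Rightarrow> bool"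
  where
  "is_nat_trans C D F G \<tau> \<longleftrightarrow> is_functor C D F \<and> is_functor C D G \<and>
     (\<forall>X \<in> Obj C. \<tau> X \<in> Hom D (omap F X) (omap G X)) \<and>
     (\<forall>f \<in> Arr C. \<tau> (Cod C f) \<cdot>\<^bsub>D\<^esub> amap F f = amap G f \<cdot>\<^bsub>D\<^esub> \<tau> (Dom C f))"

definition is_adjunction ::
    "('o, 'a) cat \<Rightarrow> ('p, 'b) cat \<Rightarrow> ('o, 'a, 'p, 'b) ftor \<Rightarrow> ('p, 'b, 'o, 'a) ftor \<Rightarrow>
     ('o \<Rightarrow> 'a) \<Rightarrow> ('p \<Rightarrow> 'b) \<Rightarrow> bool" where
  "is_adjunction C D F G \<eta> \<epsilon> \<longleftrightarrow> is_functor C D F \<and> is_functor D C G \<and>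
     is_nat_trans C C id_ftor (comp_ftor G F) \<eta> \<and>
     is_nat_trans D D (comp_ftor F G) id_ftor \<epsilon> \<and>
     (\<forall>X \<in> Obj C. \<epsilon> (omap F X) \<cdot>\<^bsub>D\<^esub> amap F (\<eta> X) = Ident D (omap F X)) \<and>
     (\<forall>Y \<in> Obj D. amap G (\<epsilon> Y) \<cdot>\<^bsub>C\<^esub> \<eta> (omap G Y) = Ident C (omap G Y))"

definition has_left_adjoint :: "('p, 'b) cat \<Rightarrow> ('o, 'a) cat \<Rightarrow> ('p, 'b, 'o, 'a) ftor \<Rightarrow> bool" where
  "has_left_adjoint D C G \<longleftrightarrow> (\<exists>F \<eta> \<epsilon>. is_adjunction C D F G \<eta> \<epsilon>)"


section \<open>Grothendieck fibrations\<close>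

definition is_cartesian ::
    "('o, 'a) cat \<Rightarrow> ('p, 'b) cat \<Rightarrow> ('o, 'a, 'p, 'b) ftor \<Rightarrow> 'a \<Rightarrow> bool" where
  "is_cartesian E B P f \<longleftrightarrow> f \<in> Arr E \<and>
     (\<forall>g \<in> Arr E. \<forall>u \<in> Hom B (omap P (Dom E g)) (omap P (Dom E f)).
        Cod E g = Cod E f \<and> amap P g = amap P f \<cdot>\<^bsub>B\<^esub> u \<longrightarrow>
        (\<exists>!h. h \<in> Hom E (Dom E g) (Dom E f) \<and> amap P h = u \<and> f \<cdot>\<^bsub>E\<^esub> h = g))"

definition is_fibration :: "('o, 'a) cat \<Rightarrow> ('p, 'b) cat \<Rightarrow> ('o, 'a, 'p, 'b) ftor \<Rightarrow> bool" where
  "is_fibration E B P \<longleftrightarrow> is_functor E B P \<and>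
     (\<forall>e \<in> Obj E. \<forall>u \<in> Arr B. Cod B u = omap P e \<longrightarrow>
        (\<exists>f. is_cartesian E B P f \<and> Cod E f = e \<and> amap P f = u))"


section \<open>Colimits, locally presentable and accessible categories\<close>

definition is_cocone ::
    "('j, 'i) cat \<Rightarrow> ('o, 'a) cat \<Rightarrow> ('j, 'i, 'o, 'a) ftor \<Rightarrow> 'o \<Rightarrow> ('j \<Rightarrow> 'a) \<Rightarrow> bool" where
  "is_cocone J C F c \<tau> \<longleftrightarrow> c \<in> Obj C \<and> (\<forall>j \<in> Obj J. \<tau> j \<in> Hom C (omap F j) c) \<and>
     (\<forall>f \<in> Arr J. \<tau> (Cod J f) \<cdot>\<^bsub>C\<^esub> amap F f = \<tau> (Dom J f))"

definition is_colimit ::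
    "('j, 'i) cat \<Rightarrow> ('o, 'a) cat \<Rightarrow> ('j, 'i, 'o, 'a) ftor \<Rightarrow> 'o \<Rightarrow> ('j \<Rightarrow> 'a) \<Rightarrow> bool" where
  "is_colimit J C F c \<tau> \<longleftrightarrow> is_cocone J C F c \<tau> \<and>
     (\<forall>d \<sigma>. is_cocone J C F d \<sigma> \<longrightarrow>
        (\<exists>!h. h \<in> Hom C c d \<and> (\<forall>j \<in> Obj J. h \<cdot>\<^bsub>C\<^esub> \<tau> j = \<sigma> j)))"

definition has_colimits_of_shape :: "('j, 'i) cat \<Rightarrow> ('o, 'a) cat \<Rightarrow> bool" where
  "has_colimits_of_shape J C \<longleftrightarrow> (\<forall>F. is_functor J C F \<longrightarrow> (\<exists>c \<tau>. is_colimit J C F c \<tau>))"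

definition preserves_colimits_of_shape ::
    "('j, 'i) cat \<Rightarrow> ('o, 'a) cat \<Rightarrow> ('p, 'b) cat \<Rightarrow> ('o, 'a, 'p, 'b) ftor \<Rightarrow> bool" where
  "preserves_colimits_of_shape J C D G \<longleftrightarrow>
     (\<forall>F c \<tau>. is_functor J C F \<and> is_colimit J C F c \<tau> \<longrightarrow>
        is_colimit J D (comp_ftor G F) (omap G c) (amap G \<circ> \<tau>))"

definition small_cat :: "'u rel \<Rightarrow> ('u, 'u) cat \<Rightarrow> bool" where
  "small_cat \<kappa> J \<longleftrightarrow> category J \<and> small \<kappa> (Obj J) \<and> small \<kappa> (Arr J)"

definition locally_small :: "'u rel \<Rightarrow> ('o, 'a) cat \<Rightarrow> bool" where
  "locally_small \<kappa> C \<longleftrightarrow> (\<forall>X \<in> Obj C. \<forall>Y \<in> Obj C. small \<kappa> (Hom C X Y))"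

definition cocomplete :: "'u rel \<Rightarrow> ('o, 'a) cat \<Rightarrow> bool" where
  "cocomplete \<kappa> C \<longleftrightarrow> (\<forall>J. small_cat \<kappa> J \<longrightarrow> has_colimits_of_shape J C)"

definition cocontinuous ::
    "'u rel \<Rightarrow> ('o, 'a) cat \<Rightarrow> ('p, 'b) cat \<Rightarrow> ('o, 'a, 'p, 'b) ftor \<Rightarrow> bool" where
  "cocontinuous \<kappa> C D G \<longleftrightarrow> is_functor C D G \<and>
     (\<forall>J. small_cat \<kappa> J \<longrightarrow> preserves_colimits_of_shape J C D G)"

text \<open>
  A category is \<open>\<theta>\<close>-filtered if every subgraph with fewer than \<open>\<theta>\<close> objects
  and arrows has a cocone; the empty subgraph gives non-emptiness.
\<close>

definition filtered :: "'u rel \<Rightarrow> ('j, 'i) cat \<Rightarrow> bool" where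
  "filtered \<theta> J \<longleftrightarrow> category J \<and>
     (\<forall>S T. S \<subseteq> Obj J \<and> T \<subseteq> Arr J \<and> |S| <o \<theta> \<and> |T| <o \<theta> \<and> Dom J ` T \<subseteq> S \<and> Cod J ` T \<subseteq> S \<longrightarrow>
        (\<exists>c \<in> Obj J. \<exists>k. (\<forall>s \<in> S. k s \<in> Hom J s c) \<and>
           (\<forall>f \<in> T. k (Cod J f) \<cdot>\<^bsub>J\<^esub> f = k (Dom J f))))"

definition small_filtered_cat :: "'u rel \<Rightarrow> 'u rel \<Rightarrow> ('u, 'u) cat \<Rightarrow> bool" where
  "small_filtered_cat \<kappa> \<theta> J \<longleftrightarrow> small_cat \<kappa> J \<and> filtered \<theta> J"

text \<open>The category of small sets of elements of a type.\<close>

definition set_cat :: "'u rel \<Rightarrow> ('s set, 's set \<times> ('s \<Rightarrow> 's) \<times> 's set) cat" where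
  "set_cat \<kappa> = \<lparr>
     Obj = {A. small \<kappa> A},
     Arr = {(A, f, B). small \<kappa> A \<and> small \<kappa> B \<and> f \<in> A \<rightarrow>\<^sub>E B},
     Dom = (\<lambda>(A, f, B). A),
     Cod = (\<lambda>(A, f, B). B),
     Ident = (\<lambda>A. (A, restrict id A, A)),
     Comp = (\<lambda>(B', g, B) (A, f, A'). (A, compose A g f, B))\<rparr>"

text \<open>
  The covariant hom functor.  It takes values in sets of elements of \<open>'a + 'u\<close>, and not just
  of \<open>'a\<close>, because every small set must be available as a test object when colimits of
  hom-sets are formed: \<open>'a\<close> itself may be too small for that.
\<close>

definition hom_ftor ::
    "('o, 'a) cat \<Rightarrow> 'o \<Rightarrow>
     ('o, 'a, ('a + 'u) set, ('a + 'u) set \<times> ('a + 'u \<Rightarrow> 'a + 'u) \<times> ('a + 'u) set) ftor" where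
  "hom_ftor C A = \<lparr>
     omap = (\<lambda>X. Inl ` Hom C A X),
     amap = (\<lambda>f. (Inl ` Hom C A (Dom C f),
                  \<lambda>x \<in> Inl ` Hom C A (Dom C f). Inl (f \<cdot>\<^bsub>C\<^esub> projl x),
                  Inl ` Hom C A (Cod C f)))\<rparr>"

definition presentable_object :: "'u rel \<Rightarrow> 'u rel \<Rightarrow> ('o, 'a) cat \<Rightarrow> 'o \<Rightarrow> bool" where
  "presentable_object \<kappa> \<theta> C A \<longleftrightarrow> A \<in> Obj C \<and>
     (\<forall>J. small_filtered_cat \<kappa> \<theta> J \<longrightarrow>
        preserves_colimits_of_shape J C (set_cat \<kappa>)
          (hom_ftor C A :: ('o, 'a, ('a + 'u) set, _) ftor))"

definition presentably_generated :: "'u rel \<Rightarrow> 'u rel \<Rightarrow> ('o, 'a) cat \<Rightarrow> bool" where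
  "presentably_generated \<kappa> \<theta> C \<longleftrightarrow>
     (\<exists>S \<subseteq> Obj C. small \<kappa> S \<and> (\<forall>A \<in> S. presentable_object \<kappa> \<theta> C A) \<and>
        (\<forall>X \<in> Obj C. \<exists>J F \<tau>. small_filtered_cat \<kappa> \<theta> J \<and> is_functor J C F \<and>
           omap F ` Obj J \<subseteq> S \<and> is_colimit J C F X \<tau>))"

definition locally_presentable_cat :: "'u rel \<Rightarrow> 'u rel \<Rightarrow> ('o, 'a) cat \<Rightarrow> bool" where
  "locally_presentable_cat \<kappa> \<theta> C \<longleftrightarrow> category C \<and> small_regular \<kappa> \<theta> \<and> locally_small \<kappa> C \<and>
     cocomplete \<kappa> C \<and> presentably_generated \<kappa> \<theta> C"

definition accessible_cat :: "'u rel \<Rightarrow> 'u rel \<Rightarrow> ('o, 'a) cat \<Rightarrow> bool" where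
  "accessible_cat \<kappa> \<mu> C \<longleftrightarrow> category C \<and> small_regular \<kappa> \<mu> \<and> locally_small \<kappa> C \<and>
     (\<forall>J. small_filtered_cat \<kappa> \<mu> J \<longrightarrow> has_colimits_of_shape J C) \<and>
     presentably_generated \<kappa> \<mu> C"

definition accessible_functor ::
    "'u rel \<Rightarrow> 'u rel \<Rightarrow> ('o, 'a) cat \<Rightarrow> ('p, 'b) cat \<Rightarrow> ('o, 'a, 'p, 'b) ftor \<Rightarrow> bool" where
  "accessible_functor \<kappa> \<mu> C D G \<longleftrightarrow>
     accessible_cat \<kappa> \<mu> C \<and> accessible_cat \<kappa> \<mu> D \<and> is_functor C D G \<and>
     (\<forall>J. small_filtered_cat \<kappa> \<mu> J \<longrightarrow> preserves_colimits_of_shape J C D G)"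


section \<open>Double categories\<close>

record ('o, 'v, 'h, 'c) dblcat =
  D0 :: "('o, 'v) cat"
  D1 :: "('h, 'c) cat"
  hunit :: "('o, 'v, 'h, 'c) ftor"
  src :: "('h, 'c, 'o, 'v) ftor"
  tgt :: "('h, 'c, 'o, 'v) ftor"
  hcomp :: "('h \<times> 'h, 'c \<times> 'c, 'h, 'c) ftor"
  assoc :: "'h \<Rightarrow> 'h \<Rightarrow> 'h \<Rightarrow> 'c"
  lunit :: "'h \<Rightarrow> 'c"
  runit :: "'h \<Rightarrow> 'c"

abbreviation hcomp_obj :: "('o, 'v, 'h, 'c) dblcat \<Rightarrow> 'h \<Rightarrow> 'h \<Rightarrow> 'h" (infixl "\<odot>\<index>" 75) where
  "M \<odot>\<^bsub>D\<^esub> N \<equiv> omap (hcomp D) (M, N)"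

abbreviation hcomp_arr :: "('o, 'v, 'h, 'c) dblcat \<Rightarrow> 'c \<Rightarrow> 'c \<Rightarrow> 'c" (infixl "\<star>\<index>" 75) where
  "\<alpha> \<star>\<^bsub>D\<^esub> \<beta> \<equiv> amap (hcomp D) (\<alpha>, \<beta>)"

text \<open>The pullback of \<^term>\<open>src D\<close> and \<^term>\<open>tgt D\<close>, on which horizontal composition is defined.\<close>

definition hpairs :: "('o, 'v, 'h, 'c) dblcat \<Rightarrow> ('h \<times> 'h, 'c \<times> 'c) cat" where
  "hpairs D = subcat (prod_cat (D1 D) (D1 D))
     (\<lambda>(M, N). omap (src D) M = omap (tgt D) N)
     (\<lambda>(\<alpha>, \<beta>). amap (src D) \<alpha> = amap (tgt D) \<beta>)"

definition globular :: "('o, 'v, 'h, 'c) dblcat \<Rightarrow> 'c \<Rightarrow> bool" where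
  "globular D \<alpha> \<longleftrightarrow> \<alpha> \<in> Arr (D1 D) \<and>
     (\<exists>X \<in> Obj (D0 D). amap (src D) \<alpha> = Ident (D0 D) X) \<and>
     (\<exists>Y \<in> Obj (D0 D). amap (tgt D) \<alpha> = Ident (D0 D) Y)"

definition composable :: "('o, 'v, 'h, 'c) dblcat \<Rightarrow> 'h \<Rightarrow> 'h \<Rightarrow> bool" where
  "composable D M N \<longleftrightarrow> M \<in> Obj (D1 D) \<and> N \<in> Obj (D1 D) \<and> omap (src D) M = omap (tgt D) N"

definition composable2 :: "('o, 'v, 'h, 'c) dblcat \<Rightarrow> 'c \<Rightarrow> 'c \<Rightarrow> bool" where
  "composable2 D \<alpha> \<beta> \<longleftrightarrow> \<alpha> \<in> Arr (D1 D) \<and> \<beta> \<in> Arr (D1 D) \<and> amap (src D) \<alpha> = amap (tgt D) \<beta>"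

locale double_category =
  fixes D :: "('o, 'v, 'h, 'c) dblcat" (structure)
  assumes hunit_functor: "is_functor (D0 D) (D1 D) (hunit D)"
    and src_functor: "is_functor (D1 D) (D0 D) (src D)"
    and tgt_functor: "is_functor (D1 D) (D0 D) (tgt D)"
    and hcomp_functor: "is_functor (hpairs D) (D1 D) (hcomp D)"
    and src_unit_obj: "X \<in> Obj (D0 D) \<Longrightarrow> omap (src D) (omap (hunit D) X) = X"
    and tgt_unit_obj: "X \<in> Obj (D0 D) \<Longrightarrow> omap (tgt D) (omap (hunit D) X) = X"
    and src_unit_arr: "f \<in> Arr (D0 D) \<Longrightarrow> amap (src D) (amap (hunit D) f) = f"
    and tgt_unit_arr: "f \<in> Arr (D0 D) \<Longrightarrow> amap (tgt D) (amap (hunit D) f) = f"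
    and src_hcomp_obj: "composable D M N \<Longrightarrow> omap (src D) (M \<odot> N) = omap (src D) N"
    and tgt_hcomp_obj: "composable D M N \<Longrightarrow> omap (tgt D) (M \<odot> N) = omap (tgt D) M"
    and src_hcomp_arr: "composable2 D \<alpha> \<beta> \<Longrightarrow> amap (src D) (\<alpha> \<star> \<beta>) = amap (src D) \<beta>"
    and tgt_hcomp_arr: "composable2 D \<alpha> \<beta> \<Longrightarrow> amap (tgt D) (\<alpha> \<star> \<beta>) = amap (tgt D) \<alpha>"
    and assoc_hom: "composable D M N \<Longrightarrow> composable D N P \<Longrightarrow>
          assoc D M N P \<in> Hom (D1 D) ((M \<odot> N) \<odot> P) (M \<odot> (N \<odot> P))"
    and assoc_iso: "composable D M N \<Longrightarrow> composable D N P \<Longrightarrow> is_iso (D1 D) (assoc D M N P)"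
    and assoc_globular: "composable D M N \<Longrightarrow> composable D N P \<Longrightarrow> globular D (assoc D M N P)"
    and assoc_natural: "composable2 D \<alpha> \<beta> \<Longrightarrow> composable2 D \<beta> \<gamma> \<Longrightarrow>
          assoc D (Cod (D1 D) \<alpha>) (Cod (D1 D) \<beta>) (Cod (D1 D) \<gamma>) \<cdot>\<^bsub>D1 D\<^esub> ((\<alpha> \<star> \<beta>) \<star> \<gamma>) =
          (\<alpha> \<star> (\<beta> \<star> \<gamma>)) \<cdot>\<^bsub>D1 D\<^esub> assoc D (Dom (D1 D) \<alpha>) (Dom (D1 D) \<beta>) (Dom (D1 D) \<gamma>)"
    and lunit_hom: "M \<in> Obj (D1 D) \<Longrightarrow>
          lunit D M \<in> Hom (D1 D) (omap (hunit D) (omap (tgt D) M) \<odot> M) M"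
    and lunit_iso: "M \<in> Obj (D1 D) \<Longrightarrow> is_iso (D1 D) (lunit D M)"
    and lunit_globular: "M \<in> Obj (D1 D) \<Longrightarrow> globular D (lunit D M)"
    and lunit_natural: "\<alpha> \<in> Arr (D1 D) \<Longrightarrow>
          lunit D (Cod (D1 D) \<alpha>) \<cdot>\<^bsub>D1 D\<^esub> (amap (hunit D) (amap (tgt D) \<alpha>) \<star> \<alpha>) =
          \<alpha> \<cdot>\<^bsub>D1 D\<^esub> lunit D (Dom (D1 D) \<alpha>)"
    and runit_hom: "M \<in> Obj (D1 D) \<Longrightarrow>
          runit D M \<in> Hom (D1 D) (M \<odot> omap (hunit D) (omap (src D) M)) M"
    and runit_iso: "M \<in> Obj (D1 D) \<Longrightarrow> is_iso (D1 D) (runit D M)"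
    and runit_globular: "M \<in> Obj (D1 D) \<Longrightarrow> globular D (runit D M)"
    and runit_natural: "\<alpha> \<in> Arr (D1 D) \<Longrightarrow>
          runit D (Cod (D1 D) \<alpha>) \<cdot>\<^bsub>D1 D\<^esub> (\<alpha> \<star> amap (hunit D) (amap (src D) \<alpha>)) =
          \<alpha> \<cdot>\<^bsub>D1 D\<^esub> runit D (Dom (D1 D) \<alpha>)"
    and pentagon: "composable D M N \<Longrightarrow> composable D N P \<Longrightarrow> composable D P Q \<Longrightarrow>
          assoc D M N (P \<odot> Q) \<cdot>\<^bsub>D1 D\<^esub> assoc D (M \<odot> N) P Q =
          (Ident (D1 D) M \<star> assoc D N P Q) \<cdot>\<^bsub>D1 D\<^esub> assoc D M (N \<odot> P) Q
            \<cdot>\<^bsub>D1 D\<^esub> (assoc D M N P \<star> Ident (D1 D) Q)"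
    and triangle: "composable D M N \<Longrightarrow>
          (Ident (D1 D) M \<star> lunit D N) \<cdot>\<^bsub>D1 D\<^esub> assoc D M (omap (hunit D) (omap (src D) M)) N =
          runit D M \<star> Ident (D1 D) N"

definition src_tgt :: "('o, 'v, 'h, 'c) dblcat \<Rightarrow> ('h, 'c, 'o \<times> 'o, 'v \<times> 'v) ftor" where
  "src_tgt D = \<lparr>omap = (\<lambda>M. (omap (src D) M, omap (tgt D) M)),
                amap = (\<lambda>\<alpha>. (amap (src D) \<alpha>, amap (tgt D) \<alpha>))\<rparr>"

definition fibrant :: "('o, 'v, 'h, 'c) dblcat \<Rightarrow> bool" where
  "fibrant D \<longleftrightarrow> is_fibration (D1 D) (prod_cat (D0 D) (D0 D)) (src_tgt D)"

definition src_fibre :: "('o, 'v, 'h, 'c) dblcat \<Rightarrow> 'o \<Rightarrow> ('h, 'c) cat" where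
  "src_fibre D X = subcat (D1 D)
     (\<lambda>M. omap (src D) M = X) (\<lambda>\<alpha>. amap (src D) \<alpha> = Ident (D0 D) X)"

definition tgt_fibre :: "('o, 'v, 'h, 'c) dblcat \<Rightarrow> 'o \<Rightarrow> ('h, 'c) cat" where
  "tgt_fibre D X = subcat (D1 D)
     (\<lambda>M. omap (tgt D) M = X) (\<lambda>\<alpha>. amap (tgt D) \<alpha> = Ident (D0 D) X)"

text \<open>The functors \<open>- \<odot> M\<close> and \<open>M \<odot> -\<close>.\<close>

definition right_tensor :: "('o, 'v, 'h, 'c) dblcat \<Rightarrow> 'h \<Rightarrow> ('h, 'c, 'h, 'c) ftor" where
  "right_tensor D M = \<lparr>omap = (\<lambda>N. N \<odot>\<^bsub>D\<^esub> M), amap = (\<lambda>\<alpha>. \<alpha> \<star>\<^bsub>D\<^esub> Ident (D1 D) M)\<rparr>"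

definition left_tensor :: "('o, 'v, 'h, 'c) dblcat \<Rightarrow> 'h \<Rightarrow> ('h, 'c, 'h, 'c) ftor" where
  "left_tensor D M = \<lparr>omap = (\<lambda>N. M \<odot>\<^bsub>D\<^esub> N), amap = (\<lambda>\<alpha>. Ident (D1 D) M \<star>\<^bsub>D\<^esub> \<alpha>)\<rparr>"

text \<open>
  The index of accessibility \<open>\<mu>\<close> of the functors \<open>- \<odot> M\<close> and
  \<open>M \<odot> -\<close> is the same for all \<open>M\<close>.  This is what makes the condition amount
  to stability of local filtered colimits, which speaks of one class of filtered colimits for all
  \<open>M\<close>.
\<close>

definition locally_presentable_dbl_at ::
    "'u rel \<Rightarrow> 'u rel \<Rightarrow> ('o, 'v, 'h, 'c) dblcat \<Rightarrow> bool" where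
  "locally_presentable_dbl_at \<kappa> \<theta> D \<longleftrightarrow> double_category D \<and> fibrant D \<and>
     locally_presentable_cat \<kappa> \<theta> (D0 D) \<and> locally_presentable_cat \<kappa> \<theta> (D1 D) \<and>
     cocontinuous \<kappa> (D1 D) (D0 D) (src D) \<and> has_left_adjoint (D1 D) (D0 D) (src D) \<and>
     cocontinuous \<kappa> (D1 D) (D0 D) (tgt D) \<and> has_left_adjoint (D1 D) (D0 D) (tgt D) \<and>
     (\<exists>\<mu>. small_regular \<kappa> \<mu> \<and> (\<forall>M \<in> Obj (D1 D).
        accessible_functor \<kappa> \<mu> (src_fibre D (omap (tgt D) M)) (src_fibre D (omap (src D) M))
          (right_tensor D M) \<and>
        accessible_functor \<kappa> \<mu> (tgt_fibre D (omap (src D) M)) (tgt_fibre D (omap (tgt D) M))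
          (left_tensor D M)))"

definition locally_presentable_dbl :: "'u rel \<Rightarrow> ('o, 'v, 'h, 'c) dblcat \<Rightarrow> bool" where
  "locally_presentable_dbl \<kappa> D \<longleftrightarrow> (\<exists>\<theta>. small_regular \<kappa> \<theta> \<and> locally_presentable_dbl_at \<kappa> \<theta> D)"


section \<open>Endo-1-cells and monads\<close>

definition End_cat :: "('o, 'v, 'h, 'c) dblcat \<Rightarrow> ('h, 'c) cat" where
  "End_cat D = subcat (D1 D)
     (\<lambda>M. omap (src D) M = omap (tgt D) M) (\<lambda>\<alpha>. amap (src D) \<alpha> = amap (tgt D) \<alpha>)"

record ('h, 'c) mnd =
  carr :: 'h
  mult :: 'c
  unit :: 'c

definition is_monad :: "('o, 'v, 'h, 'c) dblcat \<Rightarrow> ('h, 'c) mnd \<Rightarrow> bool" where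
  "is_monad D T \<longleftrightarrow>
     (let A = carr T; \<mu> = mult T; \<eta> = unit T; I = Ident (D1 D) A in
      A \<in> Obj (End_cat D) \<and>
      globular D \<mu> \<and> \<mu> \<in> Hom (D1 D) (A \<odot>\<^bsub>D\<^esub> A) A \<and>
      globular D \<eta> \<and> \<eta> \<in> Hom (D1 D) (omap (hunit D) (omap (src D) A)) A \<and>
      \<mu> \<cdot>\<^bsub>D1 D\<^esub> (\<mu> \<star>\<^bsub>D\<^esub> I) = \<mu> \<cdot>\<^bsub>D1 D\<^esub> (I \<star>\<^bsub>D\<^esub> \<mu>) \<cdot>\<^bsub>D1 D\<^esub> assoc D A A A \<and>
      \<mu> \<cdot>\<^bsub>D1 D\<^esub> (\<eta> \<star>\<^bsub>D\<^esub> I) = lunit D A \<and>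
      \<mu> \<cdot>\<^bsub>D1 D\<^esub> (I \<star>\<^bsub>D\<^esub> \<eta>) = runit D A)"

definition is_monad_morphism ::
    "('o, 'v, 'h, 'c) dblcat \<Rightarrow> ('h, 'c) mnd \<Rightarrow> 'c \<Rightarrow> ('h, 'c) mnd \<Rightarrow> bool" where
  "is_monad_morphism D S \<alpha> T \<longleftrightarrow> is_monad D S \<and> is_monad D T \<and>
     \<alpha> \<in> Hom (End_cat D) (carr S) (carr T) \<and>
     mult T \<cdot>\<^bsub>D1 D\<^esub> (\<alpha> \<star>\<^bsub>D\<^esub> \<alpha>) = \<alpha> \<cdot>\<^bsub>D1 D\<^esub> mult S \<and>
     \<alpha> \<cdot>\<^bsub>D1 D\<^esub> unit S = unit T \<cdot>\<^bsub>D1 D\<^esub> amap (hunit D) (amap (src D) \<alpha>)"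

definition Mnd_cat ::
    "('o, 'v, 'h, 'c) dblcat \<Rightarrow> (('h, 'c) mnd, ('h, 'c) mnd \<times> 'c \<times> ('h, 'c) mnd) cat" where
  "Mnd_cat D = \<lparr>
     Obj = {T. is_monad D T},
     Arr = {(S, \<alpha>, T). is_monad_morphism D S \<alpha> T},
     Dom = (\<lambda>(S, \<alpha>, T). S),
     Cod = (\<lambda>(S, \<alpha>, T). T),
     Ident = (\<lambda>T. (T, Ident (D1 D) (carr T), T)),
     Comp = (\<lambda>(T', \<beta>, T) (S, \<alpha>, S'). (S, \<beta> \<cdot>\<^bsub>D1 D\<^esub> \<alpha>, T))\<rparr>"

definition forget :: "(('h, 'c) mnd, ('h, 'c) mnd \<times> 'c \<times> ('h, 'c) mnd, 'h, 'c) ftor" where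
  "forget = \<lparr>omap = carr, amap = (\<lambda>(S, \<alpha>, T). \<alpha>)\<rparr>"

end

theory Submission
  imports Defs
begin

text \<open>
  A left adjoint of the forgetful functor amounts to a free monad on every horizontal endo-1-cell
  \<open>M : X \<rightarrow> X\<close>, that is, to a universal 2-cell from \<open>M\<close> to the carrier of a monad.  The free monad is
  built here as a transfinite colimit.  Let \<open>\<mu>\<close> be a regular cardinal such that composition
  with a fixed horizontal 1-cell, on either side, preserves \<open>\<mu>\<close>-filtered colimits in the fibres
  of source and target.  By recursion on \<open>c\<close> in \<open>\<mu>\<close>, stage \<open>T c\<close> is the universal endo-1-cell on \<open>X\<close>
  that receives the unit \<open>1\<^sub>X\<close>, the given \<open>M\<close>, all earlier stages \<open>T b\<close> and all products \<open>T b \<odot> T b\<close>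
  of earlier stages, subject to the equations that make these 2-cells compatible with each other and
  that express as much of the unit and associativity laws as makes sense at this stage.

  Let \<open>T\<close> be the colimit of the stages.  The stages form a chain indexed by a regular cardinal, and
  \<open>\<odot>\<close> preserves the colimits of such chains in each variable, so \<open>T \<odot> T\<close> is the colimit of the products
  \<open>T b \<odot> T b\<close> (\<open>diagonal_chain_colimit\<close>).  The 2-cells \<open>T b \<odot> T b \<Rightarrow> T c\<close> for \<open>b < c\<close> therefore assemble to
  a multiplication, and the monad laws, which can be tested on the stages, hold because they were
  imposed there (\<open>free_monad\<close>).  A 2-cell from \<open>M\<close> to the carrier of a monad extends along the stages
  in exactly one way: its values on the products are forced by multiplicativity, and the laws of the
  target monad say that the equations defining the next stage are respected (\<open>extension_exists\<close>,
  \<open>extension_unique\<close>).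

  What remains is to construct the stages.  Objects given by generators and equations are colimits,
  so they exist in \<open>D\<^sub>1\<close>; but a colimit in \<open>D\<^sub>1\<close> of endo-1-cells on \<open>X\<close> need not be an endo-1-cell on
  \<open>X\<close>, since source and target send a disconnected diagram over \<open>X\<close> to several copies of \<open>X\<close>.  The
  left adjoints of source and target help: with them one finds a free horizontal 1-cell \<open>Z\<close> on
  \<open>(X, X)\<close>, which has exactly one 2-cell to any \<open>C\<close> over any given vertical boundary
  (\<open>free_cell_object_exists\<close>).  Adding \<open>Z\<close> connects the diagram while imposing on cocones only that
  all their legs have the same boundary.  As source and target are cocontinuous, the colimit now has
  boundary \<open>(X, X)\<close> up to isomorphism, and since \<open>D\<close> is fibrant it can be moved to lie over
  \<open>(X, X)\<close> on the nose (\<open>presented_cell_exists\<close>).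

  All colimits here are universal for 2-cells over arbitrary vertical 1-cells \<open>f : X \<rightarrow> Y\<close>, not just
  for globular ones.  This is why a monad morphism over \<open>f\<close> can be treated directly.  The
  accessibility hypothesis speaks of colimits in the fibres of source and target instead.  For chains
  of globular 2-cells over \<open>X\<close> the two notions agree: such a chain has a colimit in \<open>D\<^sub>1\<close> that lies
  over \<open>X\<close>, which is then also the colimit in the fibres (\<open>chain_colimit_in_fibre\<close>,
  \<open>chain_colimit_of_fibre\<close>).
\<close>

section \<open>Categories and relabelling of small index categories\<close>

lemma Hom_iff: "f \<in> Hom C X Y \<longleftrightarrow> f \<in> Arr C \<and> Dom C f = X \<and> Cod C f = Y"
  by (auto simp: Hom_def)

context category
begin

lemma comp_arr [simp]: "f \<in> Arr C \<Longrightarrow> g \<in> Arr C \<Longrightarrow> Dom C g = Cod C f \<Longrightarrow> g \<cdot> f \<in> Arr C"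
  and comp_dom [simp]: "f \<in> Arr C \<Longrightarrow> g \<in> Arr C \<Longrightarrow> Dom C g = Cod C f \<Longrightarrow> Dom C (g \<cdot> f) = Dom C f"
  and comp_cod [simp]: "f \<in> Arr C \<Longrightarrow> g \<in> Arr C \<Longrightarrow> Dom C g = Cod C f \<Longrightarrow> Cod C (g \<cdot> f) = Cod C g"
  using comp_hom[of f "Dom C f" "Cod C f" g "Cod C g"] by (auto simp: Hom_iff)

lemma ident_arr [simp]: "X \<in> Obj C \<Longrightarrow> Ident C X \<in> Arr C"
  and ident_dom [simp]: "X \<in> Obj C \<Longrightarrow> Dom C (Ident C X) = X"
  and ident_cod [simp]: "X \<in> Obj C \<Longrightarrow> Cod C (Ident C X) = X"
  using id_hom[of X] by (auto simp: Hom_iff)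

lemma ident_comp [simp]: "f \<in> Arr C \<Longrightarrow> Cod C f = Y \<Longrightarrow> Ident C Y \<cdot> f = f"
  and comp_ident [simp]: "f \<in> Arr C \<Longrightarrow> Dom C f = X \<Longrightarrow> f \<cdot> Ident C X = f"
  using id_left[of f "Dom C f" "Cod C f"] id_right[of f "Dom C f" "Cod C f"] by (auto simp: Hom_iff)

lemma assoc_comp: "f \<in> Arr C \<Longrightarrow> g \<in> Arr C \<Longrightarrow> h \<in> Arr C \<Longrightarrow> Dom C g = Cod C f \<Longrightarrow>
    Dom C h = Cod C g \<Longrightarrow> (h \<cdot> g) \<cdot> f = h \<cdot> (g \<cdot> f)"
  using comp_assoc[of f "Dom C f" "Cod C f" g "Cod C g" h "Cod C h"] by (auto simp: Hom_iff)

lemma dom_Obj [simp]: "f \<in> Arr C \<Longrightarrow> Dom C f \<in> Obj C"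
  and cod_Obj [simp]: "f \<in> Arr C \<Longrightarrow> Cod C f \<in> Obj C"
  by (auto intro: dom_obj cod_obj)

end

lemma is_functorD:
  assumes "is_functor C D F"
  shows "category C" and "category D"
    and "X \<in> Obj C \<Longrightarrow> omap F X \<in> Obj D"
    and "X \<in> Obj C \<Longrightarrow> amap F (Ident C X) = Ident D (omap F X)"
    and "f \<in> Arr C \<Longrightarrow> amap F f \<in> Arr D"
    and "f \<in> Arr C \<Longrightarrow> Dom D (amap F f) = omap F (Dom C f)"
    and "f \<in> Arr C \<Longrightarrow> Cod D (amap F f) = omap F (Cod C f)"
    and "f \<in> Arr C \<Longrightarrow> g \<in> Arr C \<Longrightarrow> Dom C g = Cod C f \<Longrightarrow>
      amap F (g \<cdot>\<^bsub>C\<^esub> f) = amap F g \<cdot>\<^bsub>D\<^esub> amap F f"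
  using assms by (auto simp: is_functor_def Hom_iff)

text \<open>
  Index categories are required to live on the carrier type of \<open>\<kappa>\<close>, whereas the ones that occur below
  are built from sums and products of types.  They are copied along injections.
\<close>
definition relabel :: "('j \<Rightarrow> 'k) \<Rightarrow> ('i \<Rightarrow> 'l) \<Rightarrow> ('j, 'i) cat \<Rightarrow> ('k, 'l) cat" where
  "relabel p q J = \<lparr>Obj = p ` Obj J, Arr = q ` Arr J,
     Dom = p \<circ> Dom J \<circ> inv_into (Arr J) q, Cod = p \<circ> Cod J \<circ> inv_into (Arr J) q,
     Ident = q \<circ> Ident J \<circ> inv_into (Obj J) p,
     Comp = (\<lambda>g f. q (inv_into (Arr J) q g \<cdot>\<^bsub>J\<^esub> inv_into (Arr J) q f))\<rparr>"

definition relabel_ftor ::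
    "('j \<Rightarrow> 'k) \<Rightarrow> ('i \<Rightarrow> 'l) \<Rightarrow> ('j, 'i) cat \<Rightarrow> ('j, 'i, 'o, 'a) ftor \<Rightarrow> ('k, 'l, 'o, 'a) ftor" where
  "relabel_ftor p q J F =
     \<lparr>omap = omap F \<circ> inv_into (Obj J) p, amap = amap F \<circ> inv_into (Arr J) q\<rparr>"

locale relabelling = category J for J :: "('j, 'i) cat" (structure) +
  fixes p :: "'j \<Rightarrow> 'k" and q :: "'i \<Rightarrow> 'l"
  assumes inj_p: "inj_on p (Obj J)" and inj_q: "inj_on q (Arr J)"
begin

lemma relabel_simps [simp]:
  "Obj (relabel p q J) = p ` Obj J" "Arr (relabel p q J) = q ` Arr J"
  "f \<in> Arr J \<Longrightarrow> Dom (relabel p q J) (q f) = p (Dom J f)"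
  "f \<in> Arr J \<Longrightarrow> Cod (relabel p q J) (q f) = p (Cod J f)"
  "X \<in> Obj J \<Longrightarrow> Ident (relabel p q J) (p X) = q (Ident J X)"
  "f \<in> Arr J \<Longrightarrow> g \<in> Arr J \<Longrightarrow> q g \<cdot>\<^bsub>relabel p q J\<^esub> q f = q (g \<cdot> f)"
  "X \<in> Obj J \<Longrightarrow> omap (relabel_ftor p q J F) (p X) = omap F X"
  "f \<in> Arr J \<Longrightarrow> amap (relabel_ftor p q J F) (q f) = amap F f"
  using inj_p inj_q by (simp_all add: relabel_def relabel_ftor_def)

lemma p_eq [simp]: "X \<in> Obj J \<Longrightarrow> Y \<in> Obj J \<Longrightarrow> p X = p Y \<longleftrightarrow> X = Y"
  using inj_p by (auto simp: inj_on_def)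

lemma category_relabel: "category (relabel p q J)"
  by unfold_locales (auto simp: Hom_iff assoc_comp)

lemma functor_relabel: "is_functor J C F \<Longrightarrow> is_functor (relabel p q J) C (relabel_ftor p q J F)"
  by (auto simp: is_functor_def category_relabel Hom_iff)

lemma cocone_relabel:
  "is_cocone (relabel p q J) C (relabel_ftor p q J F) c \<tau> \<longleftrightarrow> is_cocone J C F c (\<tau> \<circ> p)"
  by (auto simp: is_cocone_def)

lemma colimit_relabel:
  "is_colimit (relabel p q J) C (relabel_ftor p q J F) c \<tau> \<longleftrightarrow> is_colimit J C F c (\<tau> \<circ> p)"
proof -
  have "(\<forall>d \<sigma>. is_cocone J C F d (\<sigma> \<circ> p) \<longrightarrow>
        (\<exists>!h. h \<in> Hom C c d \<and> (\<forall>j \<in> Obj J. h \<cdot>\<^bsub>C\<^esub> \<tau> (p j) = (\<sigma> \<circ> p) j))) \<longleftrightarrow>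
      (\<forall>d \<sigma>. is_cocone J C F d \<sigma> \<longrightarrow> (\<exists>!h. h \<in> Hom C c d \<and> (\<forall>j \<in> Obj J. h \<cdot>\<^bsub>C\<^esub> \<tau> (p j) = \<sigma> j)))"
    (is "?L \<longleftrightarrow> ?R")
  proof (intro iffI allI impI)
    fix d \<sigma> assume L: ?L and s: "is_cocone J C F d \<sigma>"
    have "is_cocone J C F d ((\<sigma> \<circ> inv_into (Obj J) p) \<circ> p)"
      using s by (auto simp: is_cocone_def inj_p)
    then have "\<exists>!h. h \<in> Hom C c d \<and> (\<forall>j \<in> Obj J. h \<cdot>\<^bsub>C\<^esub> \<tau> (p j) = ((\<sigma> \<circ> inv_into (Obj J) p) \<circ> p) j)"
      by (rule L[rule_format])
    then show "\<exists>!h. h \<in> Hom C c d \<and> (\<forall>j \<in> Obj J. h \<cdot>\<^bsub>C\<^esub> \<tau> (p j) = \<sigma> j)"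
      by (simp add: inj_p)
  next
    fix d \<sigma> assume R: ?R and s: "is_cocone J C F d (\<sigma> \<circ> p)"
    show "\<exists>!h. h \<in> Hom C c d \<and> (\<forall>j \<in> Obj J. h \<cdot>\<^bsub>C\<^esub> \<tau> (p j) = (\<sigma> \<circ> p) j)"
      by (rule R[rule_format, OF s])
  qed
  then show ?thesis by (simp add: is_colimit_def cocone_relabel)
qed

end

lemma relabel_ftor_comp:
  "comp_ftor G (relabel_ftor p q J F) = relabel_ftor p q J (comp_ftor G F)"
  by (simp add: comp_ftor_def relabel_ftor_def comp_assoc)

lemma small_inj_into_carrier:
  fixes \<kappa> :: "'u rel"
  assumes "Card_order \<kappa>" "small \<kappa> A"
  obtains p :: "'a \<Rightarrow> 'u" where "inj_on p A"
proof -
  have "|A| \<le>o |Field \<kappa>|"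
    using ordLess_imp_ordLeq[OF ordLess_ordIso_trans[OF _ ordIso_symmetric[OF card_of_Field_ordIso]]]
      assms unfolding small_def by blast
  then show thesis using that unfolding card_of_ordLeq[symmetric] by blast
qed

lemma small_image: "small \<kappa> A \<Longrightarrow> small \<kappa> (f ` A)"
  unfolding small_def using ordLeq_ordLess_trans[OF card_of_image] by blast

lemma small_subset: "small \<kappa> B \<Longrightarrow> A \<subseteq> B \<Longrightarrow> small \<kappa> A"
  unfolding small_def using ordLeq_ordLess_trans[OF card_of_mono1] by blast

lemma obtain_relabelling:
  fixes \<kappa> :: "'u rel"
  assumes "Card_order \<kappa>" "category J" "small \<kappa> (Obj J)" "small \<kappa> (Arr J)"
  obtains p q where "relabelling J (p :: _ \<Rightarrow> 'u) (q :: _ \<Rightarrow> 'u)" "small_cat \<kappa> (relabel p q J)"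
proof -
  obtain p :: "_ \<Rightarrow> 'u" where p: "inj_on p (Obj J)"
    using small_inj_into_carrier assms by blast
  obtain q :: "_ \<Rightarrow> 'u" where q: "inj_on q (Arr J)"
    using small_inj_into_carrier assms by blast
  have R: "relabelling J p q"
    using assms p q by (simp add: relabelling_def relabelling_axioms_def)
  then interpret relabelling J p q .
  have "small_cat \<kappa> (relabel p q J)"
    using assms by (simp add: small_cat_def category_relabel small_image)
  with R show thesis by (rule that)
qed

text \<open>
  One and the same colimit is preserved by every cocontinuous functor.  Having both facts together
  lets source and target be computed on a colimit that has already been chosen.
\<close>
lemma small_colimit:
  assumes "Card_order \<kappa>" "cocomplete \<kappa> C" "small \<kappa> (Obj J)" "small \<kappa> (Arr J)" "is_functor J C F"
  obtains c \<tau> where "is_colimit J C F c \<tau>"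
    and "\<And>G. cocontinuous \<kappa> C (B :: ('p, 'b) cat) G \<Longrightarrow> is_colimit J B (comp_ftor G F) (omap G c) (amap G \<circ> \<tau>)"
proof -
  obtain p q where pq: "relabelling J p q" "small_cat \<kappa> (relabel p q J)"
    using obtain_relabelling assms is_functorD(1) by metis
  interpret relabelling J p q by fact
  have F: "is_functor (relabel p q J) C (relabel_ftor p q J F)"
    by (rule functor_relabel) fact
  then obtain c \<tau> where L: "is_colimit (relabel p q J) C (relabel_ftor p q J F) c \<tau>"
    using assms(2) pq(2) unfolding cocomplete_def has_colimits_of_shape_def by blast
  show thesis
  proof (rule that)
    show "is_colimit J C F c (\<tau> \<circ> p)" using L by (simp only: colimit_relabel)
  next
    fix G assume "cocontinuous \<kappa> C B G"
    then have "is_colimit (relabel p q J) B (comp_ftor G (relabel_ftor p q J F)) (omap G c) (amap G \<circ> \<tau>)"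
      using pq(2) F L unfolding cocontinuous_def preserves_colimits_of_shape_def by blast
    then show "is_colimit J B (comp_ftor G F) (omap G c) (amap G \<circ> (\<tau> \<circ> p))"
      by (simp add: relabel_ftor_comp colimit_relabel Fun.comp_assoc)
  qed
qed

section \<open>Objects given by generators and equations\<close>

text \<open>
  The pair \<open>((i, \<phi>), (j, \<psi>))\<close> stands for the equation \<open>l i \<cdot> \<phi> = l j \<cdot> \<psi>\<close> on families \<open>l\<close> of arrows out of
  the generators \<open>X i\<close>.  A universal solution is a colimit over a category with one object for each
  generator and one for each equation, in which no two non-identity arrows can be composed.  So
  diagrams of this kind need no verification of functoriality on composites.
\<close>
type_synonym ('i, 'a) eqn = "('i \<times> 'a) \<times> ('i \<times> 'a)"

definition presentation :: "('o, 'a) cat \<Rightarrow> 'i set \<Rightarrow> ('i \<Rightarrow> 'o) \<Rightarrow> ('i, 'a) eqn set \<Rightarrow> bool" where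
  "presentation C I X E \<longleftrightarrow> (\<forall>i \<in> I. X i \<in> Obj C) \<and>
     (\<forall>i \<phi> j \<psi>. ((i, \<phi>), (j, \<psi>)) \<in> E \<longrightarrow> i \<in> I \<and> j \<in> I \<and> \<phi> \<in> Arr C \<and> \<psi> \<in> Arr C \<and>
        Dom C \<phi> = Dom C \<psi> \<and> Cod C \<phi> = X i \<and> Cod C \<psi> = X j)"

definition solution ::
    "('o, 'a) cat \<Rightarrow> 'i set \<Rightarrow> ('i \<Rightarrow> 'o) \<Rightarrow> ('i, 'a) eqn set \<Rightarrow> 'o \<Rightarrow> ('i \<Rightarrow> 'a) \<Rightarrow> bool" where
  "solution C I X E c l \<longleftrightarrow> c \<in> Obj C \<and> (\<forall>i \<in> I. l i \<in> Hom C (X i) c) \<and>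
     (\<forall>i \<phi> j \<psi>. ((i, \<phi>), (j, \<psi>)) \<in> E \<longrightarrow> l i \<cdot>\<^bsub>C\<^esub> \<phi> = l j \<cdot>\<^bsub>C\<^esub> \<psi>)"

definition universal_solution ::
    "('o, 'a) cat \<Rightarrow> 'i set \<Rightarrow> ('i \<Rightarrow> 'o) \<Rightarrow> ('i, 'a) eqn set \<Rightarrow> 'o \<Rightarrow> ('i \<Rightarrow> 'a) \<Rightarrow> bool" where
  "universal_solution C I X E c l \<longleftrightarrow> solution C I X E c l \<and>
     (\<forall>d m. solution C I X E d m \<longrightarrow> (\<exists>!h. h \<in> Hom C c d \<and> (\<forall>i \<in> I. h \<cdot>\<^bsub>C\<^esub> l i = m i)))"

definition map_eqns :: "('a \<Rightarrow> 'b) \<Rightarrow> ('i, 'a) eqn set \<Rightarrow> ('i, 'b) eqn set" where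
  "map_eqns g E = {((i, g \<phi>), (j, g \<psi>)) |i \<phi> j \<psi>. ((i, \<phi>), (j, \<psi>)) \<in> E}"

text \<open>
  The arrow \<open>Inr (e, b)\<close> leads from the equation \<open>e\<close> to the generator on its left-hand side if \<open>b\<close> is
  false and on its right-hand side if \<open>b\<close> is true.  In a composable pair at least one factor is an
  identity, so composition returns the other one.
\<close>
definition eqn_cat :: "'i set \<Rightarrow> ('i, 'a) eqn set \<Rightarrow>
    ('i + ('i, 'a) eqn, ('i + ('i, 'a) eqn) + ('i, 'a) eqn \<times> bool) cat" where
  "eqn_cat I E = \<lparr>Obj = I <+> E, Arr = (I <+> E) <+> (E \<times> UNIV),
     Dom = (\<lambda>f. case f of Inl x \<Rightarrow> x | Inr (e, b) \<Rightarrow> Inr e),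
     Cod = (\<lambda>f. case f of Inl x \<Rightarrow> x | Inr (e, b) \<Rightarrow> Inl (if b then fst (snd e) else fst (fst e))),
     Ident = Inl,
     Comp = (\<lambda>g f. case f of Inl x \<Rightarrow> g | Inr y \<Rightarrow> f)\<rparr>"

definition eqn_ftor :: "('o, 'a) cat \<Rightarrow> ('i \<Rightarrow> 'o) \<Rightarrow>
    ('i + ('i, 'a) eqn, ('i + ('i, 'a) eqn) + ('i, 'a) eqn \<times> bool, 'o, 'a) ftor" where
  "eqn_ftor C X = (let ob = (\<lambda>x. case x of Inl i \<Rightarrow> X i | Inr e \<Rightarrow> Dom C (snd (fst e))) in
     \<lparr>omap = ob, amap = (\<lambda>f. case f of Inl x \<Rightarrow> Ident C (ob x)
        | Inr (e, b) \<Rightarrow> if b then snd (snd e) else snd (fst e))\<rparr>)"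

definition eqns_of :: "('i, 'a) eqn set \<Rightarrow>
    ('i + ('i, 'a) eqn, ('i + ('i, 'a) eqn) + ('i, 'a) eqn \<times> bool, 'p, 'b) ftor \<Rightarrow> ('i, 'b) eqn set"
  where
  "eqns_of E F = {((fst (fst e), amap F (Inr (e, False))), (fst (snd e), amap F (Inr (e, True)))) |e. e \<in> E}"

lemma eqn_cat_simps [simp]:
  "Obj (eqn_cat I E) = I <+> E" "Arr (eqn_cat I E) = (I <+> E) <+> (E \<times> UNIV)"
  "Dom (eqn_cat I E) (Inl x) = x" "Cod (eqn_cat I E) (Inl x) = x"
  "Dom (eqn_cat I E) (Inr (e, b)) = Inr e"
  "Cod (eqn_cat I E) (Inr (e, b)) = Inl (if b then fst (snd e) else fst (fst e))"
  "Ident (eqn_cat I E) x = Inl x"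
  "g \<cdot>\<^bsub>eqn_cat I E\<^esub> Inl x = g" "g \<cdot>\<^bsub>eqn_cat I E\<^esub> Inr y = Inr y"
  by (simp_all add: eqn_cat_def)

lemma eqn_ftor_simps [simp]:
  "omap (eqn_ftor C X) (Inl i) = X i" "omap (eqn_ftor C X) (Inr e) = Dom C (snd (fst e))"
  "amap (eqn_ftor C X) (Inl x) = Ident C (omap (eqn_ftor C X) x)"
  "amap (eqn_ftor C X) (Inr (e, b)) = (if b then snd (snd e) else snd (fst e))"
  by (simp_all add: eqn_ftor_def Let_def)

lemma category_eqn_cat:
  assumes "presentation C I X E"
  shows "category (eqn_cat I E)"
proof -
  have ends: "e \<in> E \<Longrightarrow> fst (fst e) \<in> I \<and> fst (snd e) \<in> I" for e
    using assms by (cases e) (auto simp: presentation_def)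
  show ?thesis
  proof
    fix f assume "f \<in> Arr (eqn_cat I E)"
    then show "Dom (eqn_cat I E) f \<in> Obj (eqn_cat I E)" "Cod (eqn_cat I E) f \<in> Obj (eqn_cat I E)"
      using ends by (auto split: if_splits)
  next
    fix W X Y Z f g h
    show "X \<in> Obj (eqn_cat I E) \<Longrightarrow> Ident (eqn_cat I E) X \<in> Hom (eqn_cat I E) X X"
      by (auto simp: Hom_iff)
    show "f \<in> Hom (eqn_cat I E) X Y \<Longrightarrow> g \<in> Hom (eqn_cat I E) Y Z \<Longrightarrow>
        g \<cdot>\<^bsub>eqn_cat I E\<^esub> f \<in> Hom (eqn_cat I E) X Z"
      by (auto simp: Hom_iff split: if_splits)
    show "f \<in> Hom (eqn_cat I E) X Y \<Longrightarrow> Ident (eqn_cat I E) Y \<cdot>\<^bsub>eqn_cat I E\<^esub> f = f"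
      by (auto simp: Hom_iff)
    show "f \<in> Hom (eqn_cat I E) X Y \<Longrightarrow> f \<cdot>\<^bsub>eqn_cat I E\<^esub> Ident (eqn_cat I E) X = f"
      by (auto simp: Hom_iff)
    show "f \<in> Hom (eqn_cat I E) W X \<Longrightarrow> g \<in> Hom (eqn_cat I E) X Y \<Longrightarrow> h \<in> Hom (eqn_cat I E) Y Z \<Longrightarrow>
        h \<cdot>\<^bsub>eqn_cat I E\<^esub> g \<cdot>\<^bsub>eqn_cat I E\<^esub> f = h \<cdot>\<^bsub>eqn_cat I E\<^esub> (g \<cdot>\<^bsub>eqn_cat I E\<^esub> f)"
      by (cases f) auto
  qed
qed

lemma eqn_ftor_functor:
  fixes C :: "('o, 'a) cat" (structure)
  assumes "category C" "presentation C I X E"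
  shows "is_functor (eqn_cat I E) C (eqn_ftor C X)"
proof -
  interpret category C by fact
  have E: "fst (fst e) \<in> I \<and> fst (snd e) \<in> I \<and> snd (fst e) \<in> Arr C \<and> snd (snd e) \<in> Arr C \<and>
      Dom C (snd (snd e)) = Dom C (snd (fst e)) \<and> Cod C (snd (fst e)) = X (fst (fst e)) \<and>
      Cod C (snd (snd e)) = X (fst (snd e))" if "e \<in> E" for e
    using assms that by (cases e) (auto simp: presentation_def)
  have XO: "i \<in> I \<Longrightarrow> X i \<in> Obj C" for i
    using assms(2) by (simp add: presentation_def)
  have ob: "omap (eqn_ftor C X) x \<in> Obj C" if "x \<in> I <+> E" for x
    using that assms(2) E by (auto simp: presentation_def)
  show ?thesis
    unfolding is_functor_def
  proof (intro conjI ballI impI category_eqn_cat[OF assms(2)] assms(1))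
    fix x assume "x \<in> Obj (eqn_cat I E)"
    then show "omap (eqn_ftor C X) x \<in> Obj C" "amap (eqn_ftor C X) (Ident (eqn_cat I E) x) =
       Ident C (omap (eqn_ftor C X) x)" using ob by auto
  next
    fix f assume "f \<in> Arr (eqn_cat I E)"
    then show "amap (eqn_ftor C X) f \<in> Hom C (omap (eqn_ftor C X) (Dom (eqn_cat I E) f))
        (omap (eqn_ftor C X) (Cod (eqn_cat I E) f))"
      using XO E by (cases f) (auto simp: Hom_iff)
  next
    fix f g assume fg: "f \<in> Arr (eqn_cat I E)" "g \<in> Arr (eqn_cat I E)"
      "Dom (eqn_cat I E) g = Cod (eqn_cat I E) f"
    have amap: "amap (eqn_ftor C X) h \<in> Arr C \<and> Dom C (amap (eqn_ftor C X) h) = omap (eqn_ftor C X) (Dom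
        (eqn_cat I E) h)
        \<and> Cod C (amap (eqn_ftor C X) h) = omap (eqn_ftor C X) (Cod (eqn_cat I E) h)"
      if "h \<in> Arr (eqn_cat I E)" for h
      using that XO E by (cases h) (auto simp: Hom_iff)
    show "amap (eqn_ftor C X) (g \<cdot>\<^bsub>eqn_cat I E\<^esub> f) = amap (eqn_ftor C X) g \<cdot> amap (eqn_ftor C X) f"
    proof (cases f)
      case (Inl x)
      then show ?thesis using fg amap[OF fg(2)] by simp
    next
      case (Inr y)
      with fg obtain x where "g = Inl x" by (cases g) (auto split: prod.splits if_splits)
      then show ?thesis using fg Inr amap[OF fg(1)] by simp
    qed
  qed
qed

lemma ball_Plus: "(\<forall>x \<in> A <+> B. P x) \<longleftrightarrow> (\<forall>a \<in> A. P (Inl a)) \<and> (\<forall>b \<in> B. P (Inr b))"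
  by auto

text \<open>
  The functor \<open>F\<close> is arbitrary, so that this also applies to the composite of a diagram with a
  cocontinuous functor.
\<close>
lemma eqn_colimit:
  fixes C :: "('o, 'a) cat" (structure)
  assumes F: "is_functor (eqn_cat I E) C F"
    and L: "is_colimit (eqn_cat I E) C F c \<tau>"
    and ends: "\<And>e. e \<in> E \<Longrightarrow> fst (fst e) \<in> I \<and> fst (snd e) \<in> I"
  shows "universal_solution C I (omap F \<circ> Inl) (eqns_of E F) c (\<tau> \<circ> Inl)"
proof -
  interpret category C using F by (rule is_functorD)
  let ?J = "eqn_cat I E"
  have FI: "amap F (Inl x) = Ident C (omap F x)" if "x \<in> I <+> E" for x
    using is_functorD(4)[OF F, of x] that by simp
  have Fe: "amap F (Inr (e, b)) \<in> Arr C \<and> Dom C (amap F (Inr (e, b))) = omap F (Inr e) \<and>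
      Cod C (amap F (Inr (e, b))) = omap F (Inl (if b then fst (snd e) else fst (fst e)))" if "e \<in> E" for e b
    using is_functorD(5-7)[OF F, of "Inr (e, b)"] that by (cases b) auto
  have sol: "solution C I (omap F \<circ> Inl) (eqns_of E F) d (\<sigma> \<circ> Inl)" if s: "is_cocone ?J C F d \<sigma>" for d \<sigma>
  proof -
    have "\<sigma> (Inl (fst (fst e))) \<cdot> amap F (Inr (e, False)) = \<sigma> (Inl (fst (snd e))) \<cdot> amap F (Inr (e, True))"
      if "e \<in> E" for e
    proof -
      have "Inr (e, b) \<in> Arr ?J" for b using that by auto
      then have "\<sigma> (Cod ?J (Inr (e, b))) \<cdot> amap F (Inr (e, b)) = \<sigma> (Inr e)" for b
        using s unfolding is_cocone_def by fastforce
      from this[of True] this[of False] show ?thesis by simp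
    qed
    then show ?thesis using s by (auto simp: solution_def is_cocone_def eqns_of_def)
  qed
  have coc: "is_cocone ?J C F d (case_sum m (\<lambda>e. m (fst (fst e)) \<cdot> amap F (Inr (e, False))))"
    (is "is_cocone _ _ _ _ ?s")
    if m: "solution C I (omap F \<circ> Inl) (eqns_of E F) d m" for d m
  proof -
    have mH: "i \<in> I \<Longrightarrow> m i \<in> Arr C \<and> Dom C (m i) = omap F (Inl i) \<and> Cod C (m i) = d" for i
      using m by (auto simp: solution_def Hom_iff)
    have eq: "m (fst (fst e)) \<cdot> amap F (Inr (e, False)) = m (fst (snd e)) \<cdot> amap F (Inr (e, True))"
      if "e \<in> E" for e
      using m that unfolding solution_def eqns_of_def by blast
    have "?s (Cod ?J f) \<cdot> amap F f = ?s (Dom ?J f)" if "f \<in> Arr ?J" for f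
    proof (cases f)
      case (Inl x)
      with that have "x \<in> I <+> E" by auto
      then show ?thesis using Inl mH Fe ends by (cases x) (auto simp: FI)
    next
      case (Inr y)
      obtain e b where y: "y = (e, b)" by (cases y)
      then have "e \<in> E" using that Inr by auto
      then show ?thesis using Inr y eq by simp
    qed
    moreover have "?s j \<in> Hom C (omap F j) d" if "j \<in> I <+> E" for j
      using that mH Fe ends by (cases j) (auto simp: Hom_iff)
    ultimately show ?thesis using m by (auto simp: is_cocone_def solution_def)
  qed
  show ?thesis
    unfolding universal_solution_def
  proof (intro conjI allI impI)
    show c: "solution C I (omap F \<circ> Inl) (eqns_of E F) c (\<tau> \<circ> Inl)"
      using L by (auto simp: is_colimit_def intro: sol)
    fix d m assume m: "solution C I (omap F \<circ> Inl) (eqns_of E F) d m"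
    let ?s = "case_sum m (\<lambda>e. m (fst (fst e)) \<cdot> amap F (Inr (e, False)))"
    have "\<exists>!h. h \<in> Hom C c d \<and> (\<forall>j \<in> Obj ?J. h \<cdot> \<tau> j = ?s j)"
      using L coc[OF m] unfolding is_colimit_def by blast
    moreover have "(\<forall>j \<in> Obj ?J. h \<cdot> \<tau> j = ?s j) \<longleftrightarrow> (\<forall>i \<in> I. h \<cdot> (\<tau> \<circ> Inl) i = m i)" if "h \<in> Hom C c d" for h
    proof -
      have "h \<cdot> \<tau> (Inr e) = m (fst (fst e)) \<cdot> amap F (Inr (e, False))"
        if *: "\<forall>i \<in> I. h \<cdot> (\<tau> \<circ> Inl) i = m i" and e: "e \<in> E" for e
      proof -
        have "Inr (e, False) \<in> Arr ?J" using e by auto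
        then have "\<tau> (Cod ?J (Inr (e, False))) \<cdot> amap F (Inr (e, False)) = \<tau> (Inr e)"
          using L unfolding is_colimit_def is_cocone_def by fastforce
        then have "h \<cdot> \<tau> (Inr e) = h \<cdot> (\<tau> (Inl (fst (fst e))) \<cdot> amap F (Inr (e, False)))" by simp
        also have "\<dots> = (h \<cdot> \<tau> (Inl (fst (fst e)))) \<cdot> amap F (Inr (e, False))"
          using c ends[OF e] Fe[OF e] \<open>h \<in> Hom C c d\<close>
          by (subst assoc_comp) (auto simp: solution_def Hom_iff)
        finally show ?thesis using * ends[OF e] by simp
      qed
      then show ?thesis by (simp add: ball_Plus) blast
    qed
    ultimately show "\<exists>!h. h \<in> Hom C c d \<and> (\<forall>i \<in> I. h \<cdot> (\<tau> \<circ> Inl) i = m i)"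
      by (simp cong: conj_cong)
  qed
qed

context
  fixes \<kappa> :: "'u rel"
  assumes \<kappa>: "inaccessible \<kappa>"
begin

lemma Card_order_inaccessible: "Card_order \<kappa>" and infinite_inaccessible: "infinite (Field \<kappa>)"
proof -
  show C: "Card_order \<kappa>" using \<kappa> by (simp add: inaccessible_def)
  have "natLeq <o \<kappa>" using \<kappa> by (simp add: inaccessible_def)
  then have "natLeq \<le>o |Field \<kappa>|"
    by (rule ordLess_imp_ordLeq[OF ordLess_ordIso_trans[OF _ ordIso_symmetric[OF card_of_Field_ordIso[OF C]]]])
  then show "infinite (Field \<kappa>)" using infinite_iff_natLeq_ordLeq by blast
qed

lemma small_Un: "small \<kappa> A \<Longrightarrow> small \<kappa> B \<Longrightarrow> small \<kappa> (A \<union> B)"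
  unfolding small_def
  by (rule card_of_Un_ordLess_infinite_Field[OF infinite_inaccessible Card_order_inaccessible])

lemma small_Plus: "small \<kappa> A \<Longrightarrow> small \<kappa> B \<Longrightarrow> small \<kappa> (A <+> B)"
  unfolding small_def
  by (rule card_of_Plus_ordLess_infinite_Field[OF infinite_inaccessible Card_order_inaccessible])

lemma small_finite: "finite A \<Longrightarrow> small \<kappa> A"
  unfolding small_def using infinite_inaccessible Card_order_inaccessible
  by (intro finite_ordLess_infinite card_of_Well_order)
    (auto simp: Field_card_of card_order_on_def)

lemma small_Times:
  assumes "small \<kappa> A" "small \<kappa> B"
  shows "small \<kappa> (A \<times> B)"
proof (cases "finite (A <+> B)")
  case True
  then show ?thesis by (intro small_finite) auto
next
  case False
  let ?K = "A <+> B"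
  have "\<exists>f. inj_on f (A \<times> B) \<and> f ` (A \<times> B) \<subseteq> ?K \<times> ?K"
    by (rule exI[of _ "\<lambda>(a, b). (Inl a, Inr b)"]) (auto simp: inj_on_def)
  then have "|A \<times> B| \<le>o |?K \<times> ?K|" by (simp add: card_of_ordLeq)
  also have "|?K \<times> ?K| =o |?K|" by (rule card_of_Times_same_infinite[OF False])
  finally show ?thesis
    using small_Plus[OF assms] unfolding small_def by (rule ordLeq_ordLess_trans)
qed

end

text \<open>
  With the source and target functors for \<open>G\<close>, the second conclusion determines the boundary of a
  horizontal 1-cell given by generators and equations.
\<close>
lemma presented_object_exists:
  assumes \<kappa>: "inaccessible \<kappa>" and C: "category C" "cocomplete \<kappa> C"
    and E: "presentation C I X E" and sm: "small \<kappa> I" "small \<kappa> E"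
  obtains c l where "universal_solution C I X E c l"
    and "\<And>G. cocontinuous \<kappa> C (B :: ('p, 'b) cat) G \<Longrightarrow>
      universal_solution B I (omap G \<circ> X) (map_eqns (amap G) E) (omap G c) (amap G \<circ> l)"
proof -
  have ends: "e \<in> E \<Longrightarrow> fst (fst e) \<in> I \<and> fst (snd e) \<in> I" for e
    using E by (cases e) (auto simp: presentation_def)
  have F: "is_functor (eqn_cat I E) C (eqn_ftor C X)"
    using C(1) E by (rule eqn_ftor_functor)
  have "small \<kappa> (Obj (eqn_cat I E))" "small \<kappa> (Arr (eqn_cat I E))"
    using \<kappa> sm by (simp_all add: small_Plus small_Times small_finite)
  then obtain c \<tau> where L: "is_colimit (eqn_cat I E) C (eqn_ftor C X) c \<tau>"
    and G: "\<And>G. cocontinuous \<kappa> C B G \<Longrightarrow>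
      is_colimit (eqn_cat I E) B (comp_ftor G (eqn_ftor C X)) (omap G c) (amap G \<circ> \<tau>)"
    using small_colimit[OF _ C(2) _ _ F] \<kappa> unfolding inaccessible_def by metis
  have X: "omap (eqn_ftor C X) \<circ> Inl = X" by auto
  show thesis
  proof (rule that)
    have "eqns_of E (eqn_ftor C X) = E" by (auto simp: eqns_of_def)
    with eqn_colimit[OF F L ends] show "universal_solution C I X E c (\<tau> \<circ> Inl)"
      by (simp add: X)
  next
    fix G assume c: "cocontinuous \<kappa> C B G"
    have GF: "is_functor (eqn_cat I E) B (comp_ftor G (eqn_ftor C X))"
      using F c by (auto simp: is_functor_def cocontinuous_def comp_ftor_def Hom_iff)
    have "eqns_of E (comp_ftor G (eqn_ftor C X)) = map_eqns (amap G) E"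
      by (force simp: eqns_of_def map_eqns_def comp_ftor_def)
    with eqn_colimit[OF GF G[OF c] ends]
    show "universal_solution B I (omap G \<circ> X) (map_eqns (amap G) E) (omap G c) (amap G \<circ> (\<tau> \<circ> Inl))"
      by (simp add: comp_ftor_def Fun.comp_assoc X)
  qed
qed

section \<open>Left adjoints and universal arrows\<close>

definition universal_arrow ::
    "('p, 'b) cat \<Rightarrow> ('o, 'a) cat \<Rightarrow> ('p, 'b, 'o, 'a) ftor \<Rightarrow> 'o \<Rightarrow> 'p \<Rightarrow> 'a \<Rightarrow> bool" where
  "universal_arrow D C G X Y \<eta> \<longleftrightarrow> Y \<in> Obj D \<and> \<eta> \<in> Hom C X (omap G Y) \<and>
     (\<forall>Z \<in> Obj D. \<forall>f \<in> Hom C X (omap G Z). \<exists>!h. h \<in> Hom D Y Z \<and> amap G h \<cdot>\<^bsub>C\<^esub> \<eta> = f)"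

lemma universal_arrow_of_left_adjoint:
  assumes "has_left_adjoint D C G" "X \<in> Obj C"
  obtains Y \<eta> where "universal_arrow D C G X Y \<eta>"
proof -
  obtain F \<eta> \<epsilon> where adj: "is_adjunction C D F G \<eta> \<epsilon>"
    using assms(1) by (auto simp: has_left_adjoint_def)
  then have F: "is_functor C D F" and G: "is_functor D C G"
    and \<eta>: "\<And>X. X \<in> Obj C \<Longrightarrow> \<eta> X \<in> Hom C X (omap G (omap F X))"
    and \<eta>_nat: "\<And>f. f \<in> Arr C \<Longrightarrow> \<eta> (Cod C f) \<cdot>\<^bsub>C\<^esub> f = amap G (amap F f) \<cdot>\<^bsub>C\<^esub> \<eta> (Dom C f)"
    and \<epsilon>: "\<And>Y. Y \<in> Obj D \<Longrightarrow> \<epsilon> Y \<in> Hom D (omap F (omap G Y)) Y"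
    and \<epsilon>_nat: "\<And>f. f \<in> Arr D \<Longrightarrow> \<epsilon> (Cod D f) \<cdot>\<^bsub>D\<^esub> amap F (amap G f) = f \<cdot>\<^bsub>D\<^esub> \<epsilon> (Dom D f)"
    and tri1: "\<And>X. X \<in> Obj C \<Longrightarrow> \<epsilon> (omap F X) \<cdot>\<^bsub>D\<^esub> amap F (\<eta> X) = Ident D (omap F X)"
    and tri2: "\<And>Y. Y \<in> Obj D \<Longrightarrow> amap G (\<epsilon> Y) \<cdot>\<^bsub>C\<^esub> \<eta> (omap G Y) = Ident C (omap G Y)"
    by (auto simp: is_adjunction_def is_nat_trans_def comp_ftor_def id_ftor_def)
  interpret C: category C using F by (rule is_functorD)
  interpret D: category D using F by (rule is_functorD)
  note [simp] = is_functorD(3-8)[OF F] is_functorD(3-8)[OF G] \<open>X \<in> Obj C\<close>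
  have "\<exists>!h. h \<in> Hom D (omap F X) Z \<and> amap G h \<cdot>\<^bsub>C\<^esub> \<eta> X = f"
    if Z: "Z \<in> Obj D" and f: "f \<in> Hom C X (omap G Z)" for Z f
  proof (rule ex1I[of _ "\<epsilon> Z \<cdot>\<^bsub>D\<^esub> amap F f"], intro conjI)
    have [simp]: "f \<in> Arr C" "Dom C f = X" "Cod C f = omap G Z" "Z \<in> Obj D"
      using Z f by (auto simp: Hom_iff)
    note [simp] = \<epsilon>[OF Z, unfolded Hom_iff] \<eta>[of X, unfolded Hom_iff, simplified]
      \<eta>[of "omap G Z", unfolded Hom_iff, simplified]
    show "\<epsilon> Z \<cdot>\<^bsub>D\<^esub> amap F f \<in> Hom D (omap F X) Z" by (simp add: Hom_iff)
    have "amap G (\<epsilon> Z \<cdot>\<^bsub>D\<^esub> amap F f) \<cdot>\<^bsub>C\<^esub> \<eta> X = amap G (\<epsilon> Z) \<cdot>\<^bsub>C\<^esub> (amap G (amap F f) \<cdot>\<^bsub>C\<^esub> \<eta> X)"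
      by (simp add: C.assoc_comp)
    also have "\<dots> = (amap G (\<epsilon> Z) \<cdot>\<^bsub>C\<^esub> \<eta> (omap G Z)) \<cdot>\<^bsub>C\<^esub> f"
      using \<eta>_nat[of f] by (simp add: C.assoc_comp)
    finally show "amap G (\<epsilon> Z \<cdot>\<^bsub>D\<^esub> amap F f) \<cdot>\<^bsub>C\<^esub> \<eta> X = f"
      by (simp add: tri2)
  next
    fix h assume h: "h \<in> Hom D (omap F X) Z \<and> amap G h \<cdot>\<^bsub>C\<^esub> \<eta> X = f"
    then have [simp]: "h \<in> Arr D" "Dom D h = omap F X" "Cod D h = Z" by (auto simp: Hom_iff)
    note [simp] = \<epsilon>[OF Z, unfolded Hom_iff] \<eta>[of X, unfolded Hom_iff, simplified] \<epsilon>[of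
        "omap F X", unfolded Hom_iff, simplified]
    have "\<epsilon> Z \<cdot>\<^bsub>D\<^esub> amap F f = \<epsilon> Z \<cdot>\<^bsub>D\<^esub> (amap F (amap G h) \<cdot>\<^bsub>D\<^esub> amap F (\<eta> X))"
      using h by (metis (full_types) \<eta>[OF \<open>X \<in> Obj C\<close>, unfolded Hom_iff] is_functorD(5-8)[OF F]
          is_functorD(5-8)[OF G] \<open>h \<in> Arr D\<close> \<open>Dom D h = omap F X\<close>)
    also have "\<dots> = (h \<cdot>\<^bsub>D\<^esub> \<epsilon> (omap F X)) \<cdot>\<^bsub>D\<^esub> amap F (\<eta> X)"
      using \<epsilon>_nat[of h] by (subst D.assoc_comp[symmetric]) (simp_all add: Z)
    also have "\<dots> = h" by (simp add: D.assoc_comp tri1)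
    finally show "h = \<epsilon> Z \<cdot>\<^bsub>D\<^esub> amap F f" by simp
  qed
  then have "universal_arrow D C G X (omap F X) (\<eta> X)"
    using \<eta>[of X] by (auto simp: universal_arrow_def)
  then show thesis by (rule that)
qed

text \<open>
  The functor, its unit and its counit are all obtained from universal arrows, and every equation
  between them holds because two arrows out of a universal object agree if they agree on the
  universal arrow.
\<close>
lemma left_adjoint_of_universal_arrows:
  assumes G: "is_functor D C G"
    and ua: "\<And>X. X \<in> Obj C \<Longrightarrow> \<exists>Y \<eta>. universal_arrow D C G X Y \<eta>"
  shows "has_left_adjoint D C G"
proof -
  interpret C: category C using G by (rule is_functorD)
  interpret D: category D using G by (rule is_functorD)
  obtain Y \<eta> where Y: "\<And>X. X \<in> Obj C \<Longrightarrow> universal_arrow D C G X (Y X) (\<eta> X)"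
    using ua by metis
  note [simp] = is_functorD(3-8)[OF G]
  have YO [simp]: "Y X \<in> Obj D" if "X \<in> Obj C" for X
    using Y[OF that] by (simp add: universal_arrow_def)
  have \<eta> [simp]: "\<eta> X \<in> Arr C" "Dom C (\<eta> X) = X" "Cod C (\<eta> X) = omap G (Y X)" if "X \<in> Obj C" for X
    using Y[OF that] by (simp_all add: universal_arrow_def Hom_iff)
  define ext where "ext X Z f = (THE h. h \<in> Hom D (Y X) Z \<and> amap G h \<cdot>\<^bsub>C\<^esub> \<eta> X = f)" for X Z f
  have ext: "ext X Z f \<in> Hom D (Y X) Z \<and> amap G (ext X Z f) \<cdot>\<^bsub>C\<^esub> \<eta> X = f"
    if "X \<in> Obj C" "Z \<in> Obj D" "f \<in> Arr C" "Dom C f = X" "Cod C f = omap G Z" for X Z f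
    unfolding ext_def
    by (rule theI') (use Y[OF that(1)] that in \<open>auto simp: universal_arrow_def Hom_iff\<close>)
  have eqI: "h = h'" if "X \<in> Obj C" "h \<in> Arr D" "h' \<in> Arr D" "Dom D h = Y X" "Dom D h' = Y X"
      "Cod D h = Cod D h'" "amap G h \<cdot>\<^bsub>C\<^esub> \<eta> X = amap G h' \<cdot>\<^bsub>C\<^esub> \<eta> X" for X h h'
  proof -
    have "Cod D h \<in> Obj D" "amap G h \<cdot>\<^bsub>C\<^esub> \<eta> X \<in> Hom C X (omap G (Cod D h))"
      using that by (auto simp: Hom_iff)
    then have "\<exists>!k. k \<in> Hom D (Y X) (Cod D h) \<and> amap G k \<cdot>\<^bsub>C\<^esub> \<eta> X = amap G h \<cdot>\<^bsub>C\<^esub> \<eta> X"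
      using Y[OF that(1)] unfolding universal_arrow_def by blast
    moreover have "h \<in> Hom D (Y X) (Cod D h)" "h' \<in> Hom D (Y X) (Cod D h)"
      using that by (auto simp: Hom_iff)
    ultimately show ?thesis using that(7) by metis
  qed
  define F where "F = \<lparr>omap = Y, amap = (\<lambda>f. ext (Dom C f) (Y (Cod C f)) (\<eta> (Cod C f) \<cdot>\<^bsub>C\<^esub> f))\<rparr>"
  define \<epsilon> where "\<epsilon> Z = ext (omap G Z) Z (Ident C (omap G Z))" for Z
  have FO [simp]: "omap F X = Y X" for X by (simp add: F_def)
  have FA [simp]: "amap F f \<in> Arr D" "Dom D (amap F f) = Y (Dom C f)" "Cod D (amap F f) = Y (Cod C f)"
    and FA_nat: "amap G (amap F f) \<cdot>\<^bsub>C\<^esub> \<eta> (Dom C f) = \<eta> (Cod C f) \<cdot>\<^bsub>C\<^esub> f"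
    if "f \<in> Arr C" for f
    using ext[of "Dom C f" "Y (Cod C f)" "\<eta> (Cod C f) \<cdot>\<^bsub>C\<^esub> f"] that by (auto simp: F_def Hom_iff)
  have FA_nat': "amap G (amap F f) \<cdot>\<^bsub>C\<^esub> (\<eta> (Dom C f) \<cdot>\<^bsub>C\<^esub> k) = \<eta> (Cod C f) \<cdot>\<^bsub>C\<^esub> (f \<cdot>\<^bsub>C\<^esub> k)"
    if "f \<in> Arr C" "k \<in> Arr C" "Cod C k = Dom C f" for f k
    using that FA_nat[of f] by (simp add: C.assoc_comp[symmetric])
  have \<epsilon>A [simp]: "\<epsilon> Z \<in> Arr D" "Dom D (\<epsilon> Z) = Y (omap G Z)" "Cod D (\<epsilon> Z) = Z"
    and \<epsilon>G: "amap G (\<epsilon> Z) \<cdot>\<^bsub>C\<^esub> \<eta> (omap G Z) = Ident C (omap G Z)"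
    if "Z \<in> Obj D" for Z
    using ext[of "omap G Z" Z "Ident C (omap G Z)"] that by (auto simp: \<epsilon>_def Hom_iff)
  have \<epsilon>G': "amap G (\<epsilon> Z) \<cdot>\<^bsub>C\<^esub> (\<eta> (omap G Z) \<cdot>\<^bsub>C\<^esub> k) = k"
    if "Z \<in> Obj D" "k \<in> Arr C" "Cod C k = omap G Z" for Z k
    using that \<epsilon>G[of Z] by (simp add: C.assoc_comp[symmetric])
  have F: "is_functor C D F"
    unfolding is_functor_def
  proof (intro conjI ballI impI C.category_axioms D.category_axioms)
    fix X assume X: "X \<in> Obj C"
    then show "omap F X \<in> Obj D" by simp
    show "amap F (Ident C X) = Ident D (omap F X)"
      by (rule eqI[of X]) (use X FA_nat[of "Ident C X"] in auto)
  next
    fix f assume f: "f \<in> Arr C"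
    then show "amap F f \<in> Hom D (omap F (Dom C f)) (omap F (Cod C f))" by (simp add: Hom_iff)
    fix g assume g: "g \<in> Arr C" "Dom C g = Cod C f"
    have "amap G (amap F (g \<cdot>\<^bsub>C\<^esub> f)) \<cdot>\<^bsub>C\<^esub> \<eta> (Dom C f) = \<eta> (Cod C g) \<cdot>\<^bsub>C\<^esub> (g \<cdot>\<^bsub>C\<^esub> f)"
      using FA_nat[of "g \<cdot>\<^bsub>C\<^esub> f"] f g by simp
    moreover have "amap G (amap F g \<cdot>\<^bsub>D\<^esub> amap F f) \<cdot>\<^bsub>C\<^esub> \<eta> (Dom C f) = \<eta> (Cod C g) \<cdot>\<^bsub>C\<^esub> (g \<cdot>\<^bsub>C\<^esub> f)"
      using f g FA_nat[of f] FA_nat'[of g f] by (simp add: C.assoc_comp)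
    ultimately show "amap F (g \<cdot>\<^bsub>C\<^esub> f) = amap F g \<cdot>\<^bsub>D\<^esub> amap F f"
      by (intro eqI[of "Dom C f"]) (use f g in auto)
  qed
  have "is_nat_trans C C id_ftor (comp_ftor G F) \<eta>"
    using F G FA_nat by (auto simp: is_nat_trans_def id_ftor_def comp_ftor_def is_functor_def Hom_iff)
  moreover have "\<epsilon> (Cod D f) \<cdot>\<^bsub>D\<^esub> amap F (amap G f) = f \<cdot>\<^bsub>D\<^esub> \<epsilon> (Dom D f)" if f: "f \<in> Arr D" for f
    by (rule eqI[of "omap G (Dom D f)"])
      (use f FA_nat[of "amap G f"] in \<open>auto simp: C.assoc_comp \<epsilon>G' \<epsilon>G\<close>)
  then have "is_nat_trans D D (comp_ftor F G) id_ftor \<epsilon>"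
    using F G by (auto simp: is_nat_trans_def id_ftor_def comp_ftor_def is_functor_def Hom_iff)
  moreover have "\<epsilon> (omap F X) \<cdot>\<^bsub>D\<^esub> amap F (\<eta> X) = Ident D (omap F X)" if X: "X \<in> Obj C" for X
    by (rule eqI[of X]) (use X FA_nat[of "\<eta> X"] in \<open>auto simp: C.assoc_comp \<epsilon>G'\<close>)
  ultimately have "is_adjunction C D F G \<eta> \<epsilon>"
    using F G \<epsilon>G by (auto simp: is_adjunction_def)
  then show ?thesis by (auto simp: has_left_adjoint_def)
qed

section \<open>Calculating in a double category\<close>

context double_category
begin

abbreviation comp1 (infixl "\<bullet>" 70) where "\<beta> \<bullet> \<alpha> \<equiv> \<beta> \<cdot>\<^bsub>D1 D\<^esub> \<alpha>"
abbreviation comp0 (infixl "\<circ>\<^sub>0" 70) where "g \<circ>\<^sub>0 f \<equiv> g \<cdot>\<^bsub>D0 D\<^esub> f"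
abbreviation "Obj1 \<equiv> Obj (D1 D)"
abbreviation "Arr1 \<equiv> Arr (D1 D)"
abbreviation "Dom1 \<equiv> Dom (D1 D)"
abbreviation "Cod1 \<equiv> Cod (D1 D)"
abbreviation "Hom1 \<equiv> Hom (D1 D)"
abbreviation "id1 \<equiv> Ident (D1 D)"
abbreviation "id0 \<equiv> Ident (D0 D)"
abbreviation "sO \<equiv> omap (src D)"
abbreviation "sA \<equiv> amap (src D)"
abbreviation "tO \<equiv> omap (tgt D)"
abbreviation "tA \<equiv> amap (tgt D)"
abbreviation "uO \<equiv> omap (hunit D)"
abbreviation "uA \<equiv> amap (hunit D)"

sublocale D0: category "D0 D" using src_functor by (rule is_functorD)
sublocale D1: category "D1 D" using src_functor by (rule is_functorD)

lemmas boundary_simps [simp] =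
  is_functorD(3-8)[OF src_functor] is_functorD(3-8)[OF tgt_functor] is_functorD(3-8)[OF hunit_functor]
  src_unit_obj tgt_unit_obj src_unit_arr tgt_unit_arr

lemma hpairs_simps:
  "(M, N) \<in> Obj (hpairs D) \<longleftrightarrow> M \<in> Obj1 \<and> N \<in> Obj1 \<and> sO M = tO N"
  "(\<alpha>, \<beta>) \<in> Arr (hpairs D) \<longleftrightarrow> \<alpha> \<in> Arr1 \<and> \<beta> \<in> Arr1 \<and> sA \<alpha> = tA \<beta>"
  "Dom (hpairs D) (\<alpha>, \<beta>) = (Dom1 \<alpha>, Dom1 \<beta>)"
  "Cod (hpairs D) (\<alpha>, \<beta>) = (Cod1 \<alpha>, Cod1 \<beta>)"
  "Ident (hpairs D) (M, N) = (id1 M, id1 N)"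
  "(\<alpha>', \<beta>') \<cdot>\<^bsub>hpairs D\<^esub> (\<alpha>, \<beta>) = (\<alpha>' \<bullet> \<alpha>, \<beta>' \<bullet> \<beta>)"
  by (auto simp: hpairs_def subcat_def prod_cat_def)

lemma hcomp_Obj [simp]:
  "M \<in> Obj1 \<Longrightarrow> N \<in> Obj1 \<Longrightarrow> sO M = tO N \<Longrightarrow> M \<odot> N \<in> Obj1"
  "M \<in> Obj1 \<Longrightarrow> N \<in> Obj1 \<Longrightarrow> sO M = tO N \<Longrightarrow> sO (M \<odot> N) = sO N"
  "M \<in> Obj1 \<Longrightarrow> N \<in> Obj1 \<Longrightarrow> sO M = tO N \<Longrightarrow> tO (M \<odot> N) = tO M"
  using is_functorD(3)[OF hcomp_functor, of "(M, N)"] src_hcomp_obj[of M N] tgt_hcomp_obj[of M N]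
  by (auto simp: hpairs_simps composable_def)

lemma hcomp_Arr [simp]:
  assumes "\<alpha> \<in> Arr1" "\<beta> \<in> Arr1" "sA \<alpha> = tA \<beta>"
  shows "\<alpha> \<star> \<beta> \<in> Arr1"
    and "Dom1 (\<alpha> \<star> \<beta>) = Dom1 \<alpha> \<odot> Dom1 \<beta>"
    and "Cod1 (\<alpha> \<star> \<beta>) = Cod1 \<alpha> \<odot> Cod1 \<beta>"
    and "sA (\<alpha> \<star> \<beta>) = sA \<beta>" and "tA (\<alpha> \<star> \<beta>) = tA \<alpha>"
  using is_functorD(5-7)[OF hcomp_functor, of "(\<alpha>, \<beta>)"] assms src_hcomp_arr[of \<alpha> \<beta>] tgt_hcomp_arr[of \<alpha> \<beta>]
  by (auto simp: hpairs_simps composable2_def)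

lemma hcomp_id1 [simp]:
  "M \<in> Obj1 \<Longrightarrow> N \<in> Obj1 \<Longrightarrow> sO M = tO N \<Longrightarrow> id1 M \<star> id1 N = id1 (M \<odot> N)"
  using is_functorD(4)[OF hcomp_functor, of "(M, N)"] by (auto simp: hpairs_simps)

lemma interchange:
  assumes "\<alpha> \<in> Arr1" "\<beta> \<in> Arr1" "sA \<alpha> = tA \<beta>"
    and "\<alpha>' \<in> Arr1" "\<beta>' \<in> Arr1" "sA \<alpha>' = tA \<beta>'"
    and "Dom1 \<alpha>' = Cod1 \<alpha>" "Dom1 \<beta>' = Cod1 \<beta>"
  shows "(\<alpha>' \<star> \<beta>') \<bullet> (\<alpha> \<star> \<beta>) = (\<alpha>' \<bullet> \<alpha>) \<star> (\<beta>' \<bullet> \<beta>)"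
  using is_functorD(8)[OF hcomp_functor, of "(\<alpha>, \<beta>)" "(\<alpha>', \<beta>')"] assms by (auto simp: hpairs_simps)

text \<open>
  The simplifier expresses the boundary objects of the ends of a 2-cell through the ends of its
  vertical boundary, which is what is known about a 2-cell over given vertical 1-cells.  The converse
  rules, inherited from functoriality, would loop with these.
\<close>
lemma arr_ends [simp]:
  "\<alpha> \<in> Arr1 \<Longrightarrow> sO (Dom1 \<alpha>) = Dom (D0 D) (sA \<alpha>)"
  "\<alpha> \<in> Arr1 \<Longrightarrow> sO (Cod1 \<alpha>) = Cod (D0 D) (sA \<alpha>)"
  "\<alpha> \<in> Arr1 \<Longrightarrow> tO (Dom1 \<alpha>) = Dom (D0 D) (tA \<alpha>)"
  "\<alpha> \<in> Arr1 \<Longrightarrow> tO (Cod1 \<alpha>) = Cod (D0 D) (tA \<alpha>)"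
  by simp_all

declare is_functorD(6,7)[OF src_functor, simp del] is_functorD(6,7)[OF tgt_functor, simp del]

definition cell :: "'v \<Rightarrow> 'v \<Rightarrow> 'h \<Rightarrow> 'h \<Rightarrow> 'c set" where
  "cell f g M N = {\<alpha> \<in> Hom1 M N. sA \<alpha> = f \<and> tA \<alpha> = g}"

abbreviation "glob X \<equiv> cell (id0 X) (id0 X)"

lemma cell_iff: "\<alpha> \<in> cell f g M N \<longleftrightarrow>
    \<alpha> \<in> Arr1 \<and> Dom1 \<alpha> = M \<and> Cod1 \<alpha> = N \<and> sA \<alpha> = f \<and> tA \<alpha> = g"
  by (auto simp: cell_def Hom_iff)

lemma globular_ends:
  assumes "globular D \<alpha>" "sO (Dom1 \<alpha>) = X" "tO (Dom1 \<alpha>) = Y"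
  shows "sA \<alpha> = id0 X" "tA \<alpha> = id0 Y"
  using assms unfolding globular_def by auto

lemma unitors_simps [simp]:
  assumes "M \<in> Obj1" "sO M = X" "tO M = Y"
  shows "lunit D M \<in> Arr1" "Dom1 (lunit D M) = uO Y \<odot> M" "Cod1 (lunit D M) = M"
    "sA (lunit D M) = id0 X" "tA (lunit D M) = id0 Y"
    "runit D M \<in> Arr1" "Dom1 (runit D M) = M \<odot> uO X" "Cod1 (runit D M) = M"
    "sA (runit D M) = id0 X" "tA (runit D M) = id0 Y"
proof -
  have XY: "X \<in> Obj (D0 D)" "Y \<in> Obj (D0 D)" using assms by auto
  show l: "lunit D M \<in> Arr1" "Dom1 (lunit D M) = uO Y \<odot> M" "Cod1 (lunit D M) = M"
    and r: "runit D M \<in> Arr1" "Dom1 (runit D M) = M \<odot> uO X" "Cod1 (runit D M) = M"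
    using lunit_hom[of M] runit_hom[of M] assms by (auto simp: Hom_iff)
  show "sA (lunit D M) = id0 X" "tA (lunit D M) = id0 Y"
    by (rule globular_ends[OF lunit_globular[OF assms(1)]]; use l assms XY in simp)+
  show "sA (runit D M) = id0 X" "tA (runit D M) = id0 Y"
    by (rule globular_ends[OF runit_globular[OF assms(1)]]; use r assms XY in simp)+
qed

lemma assoc_simps [simp]:
  assumes "M \<in> Obj1" "N \<in> Obj1" "P \<in> Obj1" "sO M = tO N" "sO N = tO P"
  shows "assoc D M N P \<in> Arr1" "Dom1 (assoc D M N P) = M \<odot> N \<odot> P"
    "Cod1 (assoc D M N P) = M \<odot> (N \<odot> P)"
    "sA (assoc D M N P) = id0 (sO P)" "tA (assoc D M N P) = id0 (tO M)"
proof -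
  have c: "composable D M N" "composable D N P" using assms by (auto simp: composable_def)
  show a: "assoc D M N P \<in> Arr1" "Dom1 (assoc D M N P) = M \<odot> N \<odot> P"
    "Cod1 (assoc D M N P) = M \<odot> (N \<odot> P)"
    using assoc_hom[OF c] by (auto simp: Hom_iff)
  show "sA (assoc D M N P) = id0 (sO P)" "tA (assoc D M N P) = id0 (tO M)"
    by (rule globular_ends[OF assoc_globular[OF c]]; use a assms in simp)+
qed

definition restriction :: "'v \<Rightarrow> 'v \<Rightarrow> 'h \<Rightarrow> 'h \<Rightarrow> 'c \<Rightarrow> bool" where
  "restriction f g C C' k \<longleftrightarrow> C' \<in> Obj1 \<and> k \<in> cell f g C' C \<and>
     (\<forall>N u v w. u \<in> Hom (D0 D) (sO N) (Dom (D0 D) f) \<and> v \<in> Hom (D0 D) (tO N) (Dom (D0 D) g) \<and>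
        w \<in> cell (f \<circ>\<^sub>0 u) (g \<circ>\<^sub>0 v) N C \<longrightarrow> (\<exists>!h. h \<in> cell u v N C' \<and> k \<bullet> h = w))"

lemma restrictionD:
  assumes "restriction f g C C' k"
  shows "C' \<in> Obj1" "k \<in> cell f g C' C" "sO C' = Dom (D0 D) f" "tO C' = Dom (D0 D) g"
    and "u \<in> Hom (D0 D) (sO N) (Dom (D0 D) f) \<Longrightarrow> v \<in> Hom (D0 D) (tO N) (Dom (D0 D) g) \<Longrightarrow>
      w \<in> cell (f \<circ>\<^sub>0 u) (g \<circ>\<^sub>0 v) N C \<Longrightarrow> \<exists>!h. h \<in> cell u v N C' \<and> k \<bullet> h = w"
proof -
  show "C' \<in> Obj1" and k: "k \<in> cell f g C' C"
    using assms unfolding restriction_def by blast+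
  then show "sO C' = Dom (D0 D) f" "tO C' = Dom (D0 D) g" by (auto simp: cell_iff)
  show "u \<in> Hom (D0 D) (sO N) (Dom (D0 D) f) \<Longrightarrow> v \<in> Hom (D0 D) (tO N) (Dom (D0 D) g) \<Longrightarrow>
      w \<in> cell (f \<circ>\<^sub>0 u) (g \<circ>\<^sub>0 v) N C \<Longrightarrow> \<exists>!h. h \<in> cell u v N C' \<and> k \<bullet> h = w"
    using assms unfolding restriction_def by blast
qed

lemma restriction_exists:
  assumes fib: "fibrant D" and C: "C \<in> Obj1"
    and f: "f \<in> Hom (D0 D) X (sO C)" and g: "g \<in> Hom (D0 D) Y (tO C)"
  obtains C' k where "restriction f g C C' k"
proof -
  have "(f, g) \<in> Arr (prod_cat (D0 D) (D0 D))"
    "Cod (prod_cat (D0 D) (D0 D)) (f, g) = omap (src_tgt D) C"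
    using f g by (auto simp: prod_cat_def src_tgt_def Hom_iff)
  then obtain k where k: "is_cartesian (D1 D) (prod_cat (D0 D) (D0 D)) (src_tgt D) k"
      "Cod1 k = C" "amap (src_tgt D) k = (f, g)"
    using fib C unfolding fibrant_def is_fibration_def by blast
  then have kc: "k \<in> cell f g (Dom1 k) C"
    by (auto simp: cell_iff is_cartesian_def src_tgt_def)
  have ends: "sO (Dom1 k) = X" "tO (Dom1 k) = Y" "Dom (D0 D) f = X" "Dom (D0 D) g = Y"
    using kc f g by (auto simp: cell_iff Hom_iff)
  have "\<exists>!h. h \<in> cell u v N (Dom1 k) \<and> k \<bullet> h = w"
    if u: "u \<in> Hom (D0 D) (sO N) X" and v: "v \<in> Hom (D0 D) (tO N) Y"
      and w: "w \<in> cell (f \<circ>\<^sub>0 u) (g \<circ>\<^sub>0 v) N C" for N u v w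
  proof -
    have "(u, v) \<in> Hom (prod_cat (D0 D) (D0 D)) (omap (src_tgt D) (Dom1 w))
        (omap (src_tgt D) (Dom1 k))"
      using u v w ends by (auto simp: prod_cat_def src_tgt_def Hom_iff cell_iff)
    moreover have "w \<in> Arr1" "Cod1 w = Cod1 k"
      "amap (src_tgt D) w = amap (src_tgt D) k \<cdot>\<^bsub>prod_cat (D0 D) (D0 D)\<^esub> (u, v)"
      using w k by (auto simp: cell_iff src_tgt_def prod_cat_def)
    ultimately have "\<exists>!h. h \<in> Hom1 (Dom1 w) (Dom1 k) \<and>
        amap (src_tgt D) h = (u, v) \<and> k \<bullet> h = w"
      using k(1) unfolding is_cartesian_def by blast
    then show "\<exists>!h. h \<in> cell u v N (Dom1 k) \<and> k \<bullet> h = w"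
      using w by (simp add: cell_def src_tgt_def Hom_iff cong: conj_cong)
  qed
  then have "restriction f g C (Dom1 k) k"
    unfolding restriction_def ends(3,4) using kc D1.dom_Obj unfolding cell_iff by blast
  then show thesis by (rule that)
qed

text \<open>
  A cartesian lift of isomorphisms is invertible: lift the identity along the inverses, and compare
  the other composite with the identity by uniqueness of lifts.
\<close>
lemma transport_along_isos:
  assumes fib: "fibrant D" and C: "C \<in> Obj1"
    and f: "f \<in> Hom (D0 D) X (sO C)" and g: "g \<in> Hom (D0 D) Y (tO C)"
    and f': "f' \<in> Hom (D0 D) (sO C) X" "f' \<circ>\<^sub>0 f = id0 X" "f \<circ>\<^sub>0 f' = id0 (sO C)"
    and g': "g' \<in> Hom (D0 D) (tO C) Y" "g' \<circ>\<^sub>0 g = id0 Y" "g \<circ>\<^sub>0 g' = id0 (tO C)"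
  obtains C' k k' where "C' \<in> Obj1" "sO C' = X" "tO C' = Y"
    "k \<in> cell f g C' C" "k' \<in> cell f' g' C C'" "k \<bullet> k' = id1 C" "k' \<bullet> k = id1 C'"
proof -
  obtain C' k where R: "restriction f g C C' k"
    using restriction_exists[OF fib C f g] by blast
  have fg: "Dom (D0 D) f = X" "Dom (D0 D) g = Y" using f g by (auto simp: Hom_iff)
  note C' = restrictionD(1,3,4)[OF R, unfolded fg] and k = restrictionD(2)[OF R]
    and univ = restrictionD(5)[OF R, unfolded fg]
  have XY: "X \<in> Obj (D0 D)" "Y \<in> Obj (D0 D)" using C' by auto
  have "id1 C \<in> cell (f \<circ>\<^sub>0 f') (g \<circ>\<^sub>0 g') C C" using C f' g' by (auto simp: cell_iff)
  from univ[OF f'(1) g'(1) this] obtain k' where k': "k' \<in> cell f' g' C C'" "k \<bullet> k' = id1 C" by auto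
  have "k \<in> cell (f \<circ>\<^sub>0 id0 X) (g \<circ>\<^sub>0 id0 Y) C' C" using k f g XY by (auto simp: cell_iff Hom_iff)
  then have "\<exists>!h. h \<in> cell (id0 X) (id0 Y) C' C' \<and> k \<bullet> h = k"
    by (intro univ) (use C' XY in \<open>auto simp: Hom_iff\<close>)
  moreover have "id1 C' \<in> cell (id0 X) (id0 Y) C' C' \<and> k \<bullet> id1 C' = k"
    using C' k by (auto simp: cell_iff)
  moreover have "k' \<bullet> k \<in> cell (id0 X) (id0 Y) C' C'"
    using k k' f' g' f g by (auto simp: cell_iff Hom_iff)
  moreover have "k \<bullet> (k' \<bullet> k) = (k \<bullet> k') \<bullet> k"
    using k k' f g f' g' by (subst D1.assoc_comp) (auto simp: cell_iff)
  then have "k \<bullet> (k' \<bullet> k) = k" using k k' by (auto simp: cell_iff)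
  ultimately have "k' \<bullet> k = id1 C'" by blast
  with C' k k' show thesis using that by blast
qed

end

text \<open>
  What the construction of free monads takes from local presentability; \<open>\<mu>\<close> is the common index of
  accessibility of all functors \<open>- \<odot> M\<close> and \<open>M \<odot> -\<close>.
\<close>
locale presentable_dbl = double_category D
  for D :: "('o, 'v, 'h, 'c) dblcat" (structure) +
  fixes \<kappa> :: "'u rel" and \<mu> :: "'u rel"
  assumes inacc: "inaccessible \<kappa>" and fibrant: "fibrant D"
    and cocomplete: "cocomplete \<kappa> (D1 D)"
    and src_cocontinuous: "cocontinuous \<kappa> (D1 D) (D0 D) (src D)"
    and tgt_cocontinuous: "cocontinuous \<kappa> (D1 D) (D0 D) (tgt D)"
    and src_left_adjoint: "has_left_adjoint (D1 D) (D0 D) (src D)"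
    and tgt_left_adjoint: "has_left_adjoint (D1 D) (D0 D) (tgt D)"
    and \<mu>: "small_regular \<kappa> \<mu>"
    and right_accessible: "M \<in> Obj1 \<Longrightarrow> accessible_functor \<kappa> \<mu>
        (src_fibre D (omap (tgt D) M)) (src_fibre D (omap (src D) M)) (right_tensor D M)"
    and left_accessible: "M \<in> Obj1 \<Longrightarrow> accessible_functor \<kappa> \<mu>
        (tgt_fibre D (omap (src D) M)) (tgt_fibre D (omap (tgt D) M)) (left_tensor D M)"
begin

section \<open>Endo-1-cells given by generators and equations\<close>
lemma coproduct_exists:
  assumes "M \<in> Obj1" "N \<in> Obj1"
  obtains P i j where "P \<in> Obj1" "i \<in> Hom1 M P" "j \<in> Hom1 N P"
    and "\<And>C a b. a \<in> Hom1 M C \<Longrightarrow> b \<in> Hom1 N C \<Longrightarrow> \<exists>!h. h \<in> Hom1 P C \<and> h \<bullet> i = a \<and> h \<bullet> j = b"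
proof -
  let ?X = "\<lambda>b. if b then M else N"
  have "presentation (D1 D) (UNIV :: bool set) ?X {}" using assms by (auto simp: presentation_def)
  note ex = presented_object_exists[OF inacc D1.category_axioms cocomplete this small_finite[OF inacc finite]
      small_finite[OF inacc finite.emptyI], where B = "D0 D"]
  obtain P l where U: "universal_solution (D1 D) UNIV ?X {} P l"
    by (rule ex)
  have sol: "solution (D1 D) UNIV ?X {} C m \<longleftrightarrow> C \<in> Obj1 \<and> m True \<in> Hom1 M C \<and> m False \<in> Hom1 N C"
    for C m by (auto simp: solution_def all_bool_eq)
  have "\<exists>!h. h \<in> Hom1 P C \<and> h \<bullet> l True = a \<and> h \<bullet> l False = b"
    if a: "a \<in> Hom1 M C" and b: "b \<in> Hom1 N C" for C a b
  proof -
    have "C \<in> Obj1" using a by (auto simp: Hom_iff)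
    then have "solution (D1 D) UNIV ?X {} C (\<lambda>x. if x then a else b)" using a b sol by simp
    then have "\<exists>!h. h \<in> Hom1 P C \<and> (\<forall>i \<in> UNIV. h \<bullet> l i = (if i then a else b))"
      using U unfolding universal_solution_def by blast
    then show ?thesis by (simp add: all_bool_eq conj_commute)
  qed
  moreover have "P \<in> Obj1" "l True \<in> Hom1 M P" "l False \<in> Hom1 N P"
    using U sol unfolding universal_solution_def by blast+
  ultimately show thesis using that by blast
qed

text \<open>
  Let \<open>S\<close> be free on \<open>X\<close> with respect to the source and \<open>T\<close> free on \<open>X\<close> with respect to the target.
  Their coproduct \<open>P\<close> has the universal property of \<open>Z\<close>, except that it comes with a comparison
  \<open>(p, q)\<close> from \<open>(X, X)\<close> to its boundary.  Restrict \<open>P\<close> along this comparison to get \<open>Z\<close>.  The universal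
  property of \<open>P\<close> gives \<open>h : P \<Rightarrow> Z\<close>, which turns out to be inverse to the cartesian 2-cell
  \<open>k : Z \<Rightarrow> P\<close>.
\<close>
lemma free_cell_object_exists:
  assumes X: "X \<in> Obj (D0 D)"
  obtains Z where "Z \<in> Obj1" "sO Z = X" "tO Z = X"
    and "\<And>C f g. C \<in> Obj1 \<Longrightarrow> f \<in> Hom (D0 D) X (sO C) \<Longrightarrow> g \<in> Hom (D0 D) X (tO C) \<Longrightarrow>
      \<exists>!h. h \<in> cell f g Z C"
proof -
  obtain S \<eta>s where S: "universal_arrow (D1 D) (D0 D) (src D) X S \<eta>s"
    using universal_arrow_of_left_adjoint[OF src_left_adjoint X] by blast
  obtain T \<eta>t where T: "universal_arrow (D1 D) (D0 D) (tgt D) X T \<eta>t"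
    using universal_arrow_of_left_adjoint[OF tgt_left_adjoint X] by blast
  have SO: "S \<in> Obj1" "\<eta>s \<in> Hom (D0 D) X (sO S)" and TO: "T \<in> Obj1" "\<eta>t \<in> Hom (D0 D) X (tO T)"
    using S T unfolding universal_arrow_def by blast+
  obtain P i j where P: "P \<in> Obj1" and i: "i \<in> Hom1 S P" and j: "j \<in> Hom1 T P"
    and cop: "\<And>C a b. a \<in> Hom1 S C \<Longrightarrow> b \<in> Hom1 T C \<Longrightarrow> \<exists>!h. h \<in> Hom1 P C \<and> h \<bullet> i = a \<and> h \<bullet> j = b"
    using coproduct_exists[OF SO(1) TO(1)] by blast
  define p where "p = sA i \<circ>\<^sub>0 \<eta>s"
  define q where "q = tA j \<circ>\<^sub>0 \<eta>t"
  have iA [simp]: "i \<in> Arr1" "Dom1 i = S" "Cod1 i = P"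
    and jA [simp]: "j \<in> Arr1" "Dom1 j = T" "Cod1 j = P"
    using i j by (auto simp: Hom_iff)
  have \<eta> [simp]: "\<eta>s \<in> Arr (D0 D)" "Dom (D0 D) \<eta>s = X" "Cod (D0 D) \<eta>s = sO S"
     "\<eta>t \<in> Arr (D0 D)" "Dom (D0 D) \<eta>t = X" "Cod (D0 D) \<eta>t = tO T"
    using SO TO by (auto simp: Hom_iff)
  have ij [simp]: "sA i \<in> Arr (D0 D)" "Dom (D0 D) (sA i) = sO S" "Cod (D0 D) (sA i) = sO P"
     "tA j \<in> Arr (D0 D)" "Dom (D0 D) (tA j) = tO T" "Cod (D0 D) (tA j) = tO P"
    using arr_ends[OF iA(1)] arr_ends[OF jA(1)] by simp_all
  have p: "p \<in> Hom (D0 D) X (sO P)" and q: "q \<in> Hom (D0 D) X (tO P)"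
    by (simp_all add: p_def q_def Hom_iff)
  have univ: "\<exists>!h. h \<in> Hom1 P C \<and> sA h \<circ>\<^sub>0 p = f \<and> tA h \<circ>\<^sub>0 q = g"
    if C: "C \<in> Obj1" and f: "f \<in> Hom (D0 D) X (sO C)" and g: "g \<in> Hom (D0 D) X (tO C)" for C f g
  proof -
    have s: "\<exists>!a. a \<in> Hom1 S C \<and> sA a \<circ>\<^sub>0 \<eta>s = f" and t: "\<exists>!b. b \<in> Hom1 T C \<and> tA b \<circ>\<^sub>0 \<eta>t = g"
      using S T C f g unfolding universal_arrow_def by blast+
    then obtain a b where a: "a \<in> Hom1 S C" "sA a \<circ>\<^sub>0 \<eta>s = f" and b: "b \<in> Hom1 T C" "tA b \<circ>\<^sub>0 \<eta>t = g"
      by blast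
    have eq: "sA h \<circ>\<^sub>0 p = sA (h \<bullet> i) \<circ>\<^sub>0 \<eta>s" "tA h \<circ>\<^sub>0 q = tA (h \<bullet> j) \<circ>\<^sub>0 \<eta>t"
      "h \<bullet> i \<in> Hom1 S C" "h \<bullet> j \<in> Hom1 T C" if "h \<in> Hom1 P C" for h
    proof -
      have h: "h \<in> Arr1" "Dom1 h = P" "Cod1 h = C" using that by (auto simp: Hom_iff)
      then have h': "Dom (D0 D) (sA h) = sO P" "Dom (D0 D) (tA h) = tO P"
        using arr_ends[OF h(1)] by simp_all
      show "sA h \<circ>\<^sub>0 p = sA (h \<bullet> i) \<circ>\<^sub>0 \<eta>s" "tA h \<circ>\<^sub>0 q = tA (h \<bullet> j) \<circ>\<^sub>0 \<eta>t"
        using h h' by (simp_all add: p_def q_def D0.assoc_comp)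
      show "h \<bullet> i \<in> Hom1 S C" "h \<bullet> j \<in> Hom1 T C" using h by (simp_all add: Hom_iff)
    qed
    have "sA h \<circ>\<^sub>0 p = f \<and> tA h \<circ>\<^sub>0 q = g \<longleftrightarrow> h \<bullet> i = a \<and> h \<bullet> j = b" if "h \<in> Hom1 P C" for h
      using eq[OF that] s t a b by metis
    with cop[OF a(1) b(1)] show ?thesis by (simp cong: conj_cong)
  qed
  obtain Z k where R: "restriction p q P Z k"
    using restriction_exists[OF fibrant P p q] by blast
  have pq: "Dom (D0 D) p = X" "Dom (D0 D) q = X" using p q by (auto simp: Hom_iff)
  note Z = restrictionD(1,3,4)[OF R, unfolded pq] and k = restrictionD(2)[OF R]
    and cart = restrictionD(5)[OF R, unfolded pq]
  have kA [simp]: "k \<in> Arr1" "Dom1 k = Z" "Cod1 k = P" "sA k = p" "tA k = q"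
    using k by (auto simp: cell_iff)
  have pA [simp]: "p \<in> Arr (D0 D)" "q \<in> Arr (D0 D)" "Cod (D0 D) p = sO P" "Cod (D0 D) q = tO P"
    using p q by (auto simp: Hom_iff)
  note [simp] = Z pq P X
  have idX: "id0 X \<in> Hom (D0 D) X (sO Z)" "id0 X \<in> Hom (D0 D) X (tO Z)" by (simp_all add: Hom_iff)
  obtain h where h: "h \<in> Hom1 P Z" "sA h \<circ>\<^sub>0 p = id0 X" "tA h \<circ>\<^sub>0 q = id0 X"
    using univ[OF Z(1) idX] by blast
  have hA [simp]: "h \<in> Arr1" "Dom1 h = P" "Cod1 h = Z"
    using h by (auto simp: Hom_iff)
  have hE [simp]: "Dom (D0 D) (sA h) = sO P" "Dom (D0 D) (tA h) = tO P" "Cod (D0 D) (sA h) = X" "Cod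
      (D0 D) (tA h) = X"
    using arr_ends[OF hA(1)] by simp_all
  have "h \<bullet> k \<in> glob X Z Z" using h by (simp add: cell_iff)
  moreover have "k \<bullet> h = id1 P"
  proof -
    have "k \<bullet> h \<in> Hom1 P P \<and> sA (k \<bullet> h) \<circ>\<^sub>0 p = p \<and> tA (k \<bullet> h) \<circ>\<^sub>0 q = q"
      using h by (simp add: Hom_iff D0.assoc_comp)
    moreover have "id1 P \<in> Hom1 P P \<and> sA (id1 P) \<circ>\<^sub>0 p = p \<and> tA (id1 P) \<circ>\<^sub>0 q = q"
      by (simp add: Hom_iff)
    ultimately show ?thesis using univ[OF P p q] by blast
  qed
  then have "k \<bullet> (h \<bullet> k) = k" by (simp add: D1.assoc_comp[symmetric])
  moreover have "\<exists>!h. h \<in> glob X Z Z \<and> k \<bullet> h = k"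
    by (rule cart) (simp_all add: Hom_iff cell_iff)
  moreover have "id1 Z \<in> glob X Z Z \<and> k \<bullet> id1 Z = k" by (simp add: cell_iff)
  ultimately have hk: "h \<bullet> k = id1 Z" by blast
  have "\<exists>!w. w \<in> cell f g Z C"
    if C: "C \<in> Obj1" and f: "f \<in> Hom (D0 D) X (sO C)" and g: "g \<in> Hom (D0 D) X (tO C)" for C f g
  proof -
    obtain m where m: "m \<in> Hom1 P C" "sA m \<circ>\<^sub>0 p = f" "tA m \<circ>\<^sub>0 q = g"
      using univ[OF C f g] by blast
    then have "m \<bullet> k \<in> cell f g Z C" by (simp add: cell_iff Hom_iff)
    moreover have "w = m \<bullet> k" if w: "w \<in> cell f g Z C" for w
    proof -
      have wA: "w \<in> Arr1" "Dom1 w = Z" "Cod1 w = C" "sA w = f" "tA w = g"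
        using w by (auto simp: cell_iff)
      moreover have "f \<in> Arr (D0 D)" "g \<in> Arr (D0 D)" "Dom (D0 D) f = X" "Dom (D0 D) g = X"
        using f g by (auto simp: Hom_iff)
      ultimately have "w \<bullet> h \<in> Hom1 P C \<and> sA (w \<bullet> h) \<circ>\<^sub>0 p = f \<and> tA (w \<bullet> h) \<circ>\<^sub>0 q = g"
        using h by (simp add: Hom_iff D0.assoc_comp)
      then have "w \<bullet> h = m" using univ[OF C f g] m by blast
      then have "m \<bullet> k = w \<bullet> (h \<bullet> k)" using wA by (auto simp: D1.assoc_comp)
      then show ?thesis using wA hk by simp
    qed
    ultimately show ?thesis by blast
  qed
  with Z show thesis using that by blast
qed

text \<open>
  The universal property is demanded for families into every \<open>C\<close>, over every vertical boundary \<open>(f, g)\<close>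
  that is common to the members of the family.
\<close>
definition presents ::
    "'o \<Rightarrow> 'i set \<Rightarrow> ('i \<Rightarrow> 'h) \<Rightarrow> ('i, 'c) eqn set \<Rightarrow> 'h \<Rightarrow> ('i \<Rightarrow> 'c) \<Rightarrow> bool" where
  "presents X I A E L l \<longleftrightarrow> L \<in> Obj1 \<and> solution (D1 D) I A E L l \<and>
     (\<forall>i \<in> I. l i \<in> glob X (A i) L) \<and>
     (\<forall>C f g m. solution (D1 D) I A E C m \<and> (\<forall>i \<in> I. m i \<in> cell f g (A i) C) \<longrightarrow>
        (\<exists>!h. h \<in> Hom1 L C \<and> (\<forall>i \<in> I. h \<bullet> l i = m i)))"

text \<open>
  The generators are tied together through a free horizontal 1-cell \<open>Z\<close> on \<open>(X, X)\<close>: each receives a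
  unique globular 2-cell from \<open>Z\<close>, and composing its leg with this 2-cell must give the same result as
  for a fixed generator \<open>i0\<close>.
\<close>
lemma presented_cell_exists:
  assumes X: "X \<in> Obj (D0 D)" and E: "presentation (D1 D) I A E"
    and sm: "small \<kappa> I" "small \<kappa> E" and ne: "i0 \<in> I"
    and A: "\<And>i. i \<in> I \<Longrightarrow> sO (A i) = X \<and> tO (A i) = X"
    and glob: "\<And>i \<phi> j \<psi>. ((i, \<phi>), (j, \<psi>)) \<in> E \<Longrightarrow>
      sA \<phi> = id0 X \<and> tA \<phi> = id0 X \<and> sA \<psi> = id0 X \<and> tA \<psi> = id0 X"
  obtains L l where "presents X I A E L l"
proof -
  obtain Z where Z: "Z \<in> Obj1" "sO Z = X" "tO Z = X"
    and Zu: "\<And>C f g. C \<in> Obj1 \<Longrightarrow> f \<in> Hom (D0 D) X (sO C) \<Longrightarrow> g \<in> Hom (D0 D) X (tO C) \<Longrightarrow>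
      \<exists>!h. h \<in> cell f g Z C"
    using free_cell_object_exists[OF X] by blast
  have AO [simp]: "A i \<in> Obj1" "sO (A i) = X" "tO (A i) = X" if "i \<in> I" for i
    using E A[OF that] that by (auto simp: presentation_def)
  have idX [simp]: "id0 X \<in> Arr (D0 D)" "Dom (D0 D) (id0 X) = X" "Cod (D0 D) (id0 X) = X"
    using X by auto
  have "\<exists>w. w \<in> glob X Z (A i)" if "i \<in> I" for i
    using Zu[of "A i" "id0 X" "id0 X"] that by (auto simp: Hom_iff)
  then obtain z where z: "\<And>i. i \<in> I \<Longrightarrow> z i \<in> glob X Z (A i)" by metis
  \<comment> \<open>As \<open>Z\<close> has only one 2-cell over each boundary, the extra equations hold for every family
     with a common boundary; on the colimit they force the legs to have a common boundary.\<close>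
  define E' where "E' = E \<union> (\<lambda>i. ((i0, z i0), (i, z i))) ` I"
  have E': "presentation (D1 D) I A E'"
    using E z ne by (auto simp: presentation_def E'_def cell_iff)
  have smE': "small \<kappa> E'" unfolding E'_def by (intro small_Un inacc sm small_image)
  have sol_iff: "solution (D1 D) I A E' C m" if m: "solution (D1 D) I A E C m" "\<And>i. i \<in> I
      \<Longrightarrow> m i \<in> cell f g (A i) C" for C f g m
  proof -
    have C: "C \<in> Obj1" using m by (simp add: solution_def)
    have mi: "m i \<in> Arr1" "Dom1 (m i) = A i" "Cod1 (m i) = C" "sA (m i) = f" "tA (m i) = g" if "i \<in> I" for i
      using m(2)[OF that] by (auto simp: cell_iff)
    have fg: "f \<in> Hom (D0 D) X (sO C)" "g \<in> Hom (D0 D) X (tO C)"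
      using arr_ends[OF mi(1)[OF ne]] mi[OF ne] ne is_functorD(5)[OF src_functor mi(1)[OF ne]]
        is_functorD(5)[OF tgt_functor mi(1)[OF ne]] by (auto simp: Hom_iff)
    have "m i \<bullet> z i \<in> cell f g Z C" if "i \<in> I" for i
      using mi[OF that] z[OF that] fg by (auto simp: cell_iff Hom_iff)
    then have "m i0 \<bullet> z i0 = m i \<bullet> z i" if "i \<in> I" for i
      using Zu[OF C fg] ne that by blast
    then show ?thesis using m(1) by (auto simp: solution_def E'_def)
  qed
  have sub: "solution (D1 D) I A E C m" if "solution (D1 D) I A E' C m" for C m
    using that by (auto simp: solution_def E'_def)
  obtain L0 l0 where U: "universal_solution (D1 D) I A E' L0 l0"
    and G: "\<forall>G. cocontinuous \<kappa> (D1 D) (D0 D) G \<longrightarrow>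
      universal_solution (D0 D) I (omap G \<circ> A) (map_eqns (amap G) E') (omap G L0) (amap G \<circ> l0)"
  proof (rule presented_object_exists[OF inacc D1.category_axioms cocomplete E' sm(1) smE', where B = "D0 D"])
  qed blast
  have L0: "L0 \<in> Obj1" and l0: "\<And>i. i \<in> I \<Longrightarrow> l0 i \<in> Hom1 (A i) L0"
    and l0z: "\<And>i. i \<in> I \<Longrightarrow> l0 i0 \<bullet> z i0 = l0 i \<bullet> z i"
    using U unfolding universal_solution_def solution_def E'_def by blast+
  have l0A [simp]: "l0 i \<in> Arr1" "Dom1 (l0 i) = A i" "Cod1 (l0 i) = L0" if "i \<in> I" for i
    using l0[OF that] by (auto simp: Hom_iff)
  have zA [simp]: "z i \<in> Arr1" "Dom1 (z i) = Z" "Cod1 (z i) = A i" "sA (z i) = id0 X" "tA (z i) = id0 X"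
    if "i \<in> I" for i using z[OF that] by (auto simp: cell_iff)
  \<comment> \<open>A cocontinuous \<open>G\<close> sends the diagram to a connected constant one at \<open>X\<close>, whose colimit is \<open>X\<close>.\<close>
  have boundary: "\<exists>k. k \<in> Hom (D0 D) (omap G L0) X \<and> amap G (l0 i0) \<in> Hom (D0 D) X (omap G L0) \<and>
      k \<circ>\<^sub>0 amap G (l0 i0) = id0 X \<and> amap G (l0 i0) \<circ>\<^sub>0 k = id0 (omap G L0) \<and> (\<forall>i \<in> I. amap G (l0 i)
          = amap G (l0 i0))"
    if c: "cocontinuous \<kappa> (D1 D) (D0 D) G" and GA: "\<And>i. i \<in> I \<Longrightarrow> omap G (A i) = X" and Gz: "\<And>i. i \<in> I
        \<Longrightarrow> amap G (z i) = id0 X"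
      and GE: "\<And>i \<phi> j \<psi>. ((i, \<phi>), (j, \<psi>)) \<in> E \<Longrightarrow> amap G \<phi> = id0 X \<and> amap G \<psi> = id0 X" for G
  proof -
    have F: "is_functor (D1 D) (D0 D) G" using c by (simp add: cocontinuous_def)
    note [simp] = is_functorD(3-8)[OF F] GA L0
    have const: "amap G (l0 i) = amap G (l0 i0)" if "i \<in> I" for i
    proof -
      have "amap G (l0 i0 \<bullet> z i0) = amap G (l0 i \<bullet> z i)" using l0z[OF that] by simp
      then show ?thesis using that ne by (simp add: Gz)
    qed
    have US: "universal_solution (D0 D) I (omap G \<circ> A) (map_eqns (amap G) E') (omap G L0) (amap G \<circ> l0)"
      using G c by blast
    have eqns: "\<phi> = id0 X \<and> \<psi> = id0 X \<and> i \<in> I \<and> j \<in> I"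
      if "((i, \<phi>), (j, \<psi>)) \<in> map_eqns (amap G) E'" for i \<phi> j \<psi>
    proof -
      obtain \<phi>' \<psi>' where e: "((i, \<phi>'), (j, \<psi>')) \<in> E'" "\<phi> = amap G \<phi>'" "\<psi> = amap G \<psi>'"
        using \<open>((i, \<phi>), (j, \<psi>)) \<in> map_eqns (amap G) E'\<close> unfolding map_eqns_def by blast
      then have "i \<in> I \<and> j \<in> I" using E' unfolding presentation_def by blast
      moreover have "amap G \<phi>' = id0 X \<and> amap G \<psi>' = id0 X"
        using e(1) GE Gz ne unfolding E'_def by blast
      ultimately show ?thesis using e by simp
    qed
    have "solution (D0 D) I (omap G \<circ> A) (map_eqns (amap G) E') X (\<lambda>i. id0 X)"
      unfolding solution_def
    proof (intro conjI ballI allI impI)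
      show "X \<in> Obj (D0 D)" by fact
      show "id0 X \<in> Hom (D0 D) ((omap G \<circ> A) i) X" if "i \<in> I" for i
        using that X by (simp add: Hom_iff)
      show "id0 X \<circ>\<^sub>0 \<phi> = id0 X \<circ>\<^sub>0 \<psi>" if "((i, \<phi>), (j, \<psi>)) \<in> map_eqns (amap G) E'" for i \<phi> j \<psi>
        using eqns[OF that] by simp
    qed
    then obtain k where k: "k \<in> Hom (D0 D) (omap G L0) X" "\<And>i. i \<in> I \<Longrightarrow> k \<circ>\<^sub>0 amap G (l0 i) = id0 X"
      using US unfolding universal_solution_def o_def by blast
    have kA: "k \<in> Arr (D0 D)" "Dom (D0 D) k = omap G L0" "Cod (D0 D) k = X" using k by (auto simp: Hom_iff)
    have "\<exists>!h. h \<in> Hom (D0 D) (omap G L0) (omap G L0) \<and> (\<forall>i \<in> I. h \<circ>\<^sub>0 amap G (l0 i) = amap G (l0 i))"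
      using US unfolding universal_solution_def o_def by blast
    moreover have "id0 (omap G L0) \<in> Hom (D0 D) (omap G L0) (omap G L0) \<and> (\<forall>i \<in> I. id0
        (omap G L0) \<circ>\<^sub>0 amap G (l0 i) = amap G (l0 i))"
      by (simp add: Hom_iff)
    moreover have "amap G (l0 i0) \<circ>\<^sub>0 k \<in> Hom (D0 D) (omap G L0) (omap G L0) \<and>
        (\<forall>i \<in> I. (amap G (l0 i0) \<circ>\<^sub>0 k) \<circ>\<^sub>0 amap G (l0 i) = amap G (l0 i))"
    proof (intro conjI ballI)
      show "amap G (l0 i0) \<circ>\<^sub>0 k \<in> Hom (D0 D) (omap G L0) (omap G L0)" using kA ne by (simp add: Hom_iff)
      fix i assume i: "i \<in> I"
      have "(amap G (l0 i0) \<circ>\<^sub>0 k) \<circ>\<^sub>0 amap G (l0 i) = amap G (l0 i0) \<circ>\<^sub>0 (k \<circ>\<^sub>0 amap G (l0 i))"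
        using kA ne i by (simp add: D0.assoc_comp)
      then show "(amap G (l0 i0) \<circ>\<^sub>0 k) \<circ>\<^sub>0 amap G (l0 i) = amap G (l0 i)"
        using k(2)[OF i] const[OF i] ne by simp
    qed
    ultimately have "amap G (l0 i0) \<circ>\<^sub>0 k = id0 (omap G L0)" by blast
    moreover have "amap G (l0 i0) \<in> Hom (D0 D) X (omap G L0)" using ne by (simp add: Hom_iff)
    ultimately show ?thesis using k(1) k(2)[OF ne] const by blast
  qed
  obtain ks where ks: "ks \<in> Hom (D0 D) (sO L0) X" "sA (l0 i0) \<in> Hom (D0 D) X (sO L0)"
      "ks \<circ>\<^sub>0 sA (l0 i0) = id0 X" "sA (l0 i0) \<circ>\<^sub>0 ks = id0 (sO L0)" "\<And>i. i \<in> I \<Longrightarrow> sA (l0 i) = sA (l0 i0)"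
    using boundary[OF src_cocontinuous] glob by auto
  obtain kt where kt: "kt \<in> Hom (D0 D) (tO L0) X" "tA (l0 i0) \<in> Hom (D0 D) X (tO L0)"
      "kt \<circ>\<^sub>0 tA (l0 i0) = id0 X" "tA (l0 i0) \<circ>\<^sub>0 kt = id0 (tO L0)" "\<And>i. i \<in> I \<Longrightarrow> tA (l0 i) = tA (l0 i0)"
    using boundary[OF tgt_cocontinuous] glob by auto
  obtain L k d where L: "L \<in> Obj1" "sO L = X" "tO L = X"
    and k: "k \<in> cell (sA (l0 i0)) (tA (l0 i0)) L L0" and d: "d \<in> cell ks kt L0 L"
    and kd: "k \<bullet> d = id1 L0" "d \<bullet> k = id1 L"
    by (rule transport_along_isos[OF fibrant L0 ks(2) kt(2) ks(1,3,4) kt(1,3,4)])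
  have kA [simp]: "k \<in> Arr1" "Dom1 k = L" "Cod1 k = L0"
    and dA [simp]: "d \<in> Arr1" "Dom1 d = L0" "Cod1 d = L" "sA d = ks" "tA d = kt"
    using k d by (auto simp: cell_iff)
  define l where "l i = d \<bullet> l0 i" for i
  have lA [simp]: "l i \<in> Arr1" "Dom1 (l i) = A i" "Cod1 (l i) = L" "sA (l i) = id0 X" "tA (l i) = id0 X"
    if "i \<in> I" for i
    using that ks(3) kt(3) ks(5)[OF that] kt(5)[OF that] by (auto simp: l_def)
  have "solution (D1 D) I A E L l"
  proof -
    have "l i \<bullet> \<phi> = l j \<bullet> \<psi>" if e: "((i, \<phi>), (j, \<psi>)) \<in> E" for i \<phi> j \<psi>
    proof -
      have "l0 i \<bullet> \<phi> = l0 j \<bullet> \<psi>" using U e by (simp add: universal_solution_def solution_def E'_def)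
      then show ?thesis using E e by (auto simp: l_def D1.assoc_comp presentation_def)
    qed
    then show ?thesis using L by (simp add: solution_def Hom_iff)
  qed
  moreover have "\<exists>!h. h \<in> Hom1 L C \<and> (\<forall>i \<in> I. h \<bullet> l i = m i)"
    if m: "solution (D1 D) I A E C m" "\<And>i. i \<in> I \<Longrightarrow> m i \<in> cell f g (A i) C" for C f g m
  proof -
    have "solution (D1 D) I A E' C m" using m by (rule sol_iff)
    then have ex1: "\<exists>!h. h \<in> Hom1 L0 C \<and> (\<forall>i \<in> I. h \<bullet> l0 i = m i)"
      using U unfolding universal_solution_def by blast
    then obtain h0 where h0: "h0 \<in> Hom1 L0 C" "\<And>i. i \<in> I \<Longrightarrow> h0 \<bullet> l0 i = m i" by blast
    then have h0A [simp]: "h0 \<in> Arr1" "Dom1 h0 = L0" "Cod1 h0 = C" by (auto simp: Hom_iff)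
    have "h0 \<bullet> k \<in> Hom1 L C" by (simp add: Hom_iff)
    moreover have "(h0 \<bullet> k) \<bullet> l i = m i" if "i \<in> I" for i
    proof -
      have "(h0 \<bullet> k) \<bullet> l i = h0 \<bullet> ((k \<bullet> d) \<bullet> l0 i)"
        using that by (simp add: l_def D1.assoc_comp)
      then show ?thesis using that h0 kd by simp
    qed
    moreover have "h = h0 \<bullet> k" if h: "h \<in> Hom1 L C" "\<And>i. i \<in> I \<Longrightarrow> h \<bullet> l i = m i" for h
    proof -
      have hA [simp]: "h \<in> Arr1" "Dom1 h = L" "Cod1 h = C" using h by (auto simp: Hom_iff)
      have "(h \<bullet> d) \<bullet> l0 i = m i" if "i \<in> I" for i
        using that h(2)[OF that] by (simp add: l_def D1.assoc_comp)
      moreover have "h \<bullet> d \<in> Hom1 L0 C" by (simp add: Hom_iff)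
      ultimately have "h \<bullet> d = h0" using ex1 h0 by blast
      then have "h0 \<bullet> k = h \<bullet> (d \<bullet> k)" by (auto simp: D1.assoc_comp)
      then show ?thesis using kd by simp
    qed
    ultimately show ?thesis by blast
  qed
  ultimately have "presents X I A E L l"
    using L unfolding presents_def by (auto simp: cell_iff)
  then show thesis by (rule that)
qed

end

section \<open>Colimits of chains\<close>
definition order_cat :: "'x rel \<Rightarrow> ('x, 'x \<times> 'x) cat" where
  "order_cat r = \<lparr>Obj = Field r, Arr = r, Dom = fst, Cod = snd, Ident = (\<lambda>x. (x, x)),
     Comp = (\<lambda>(y', z) (x, y). (x, z))\<rparr>"

lemma order_cat_simps [simp]:
  "Obj (order_cat r) = Field r" "Arr (order_cat r) = r" "Dom (order_cat r) p = fst p"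
  "Cod (order_cat r) p = snd p" "Ident (order_cat r) x = (x, x)"
  "(y', z) \<cdot>\<^bsub>order_cat r\<^esub> (x, y) = (x, z)"
  by (simp_all add: order_cat_def)

definition chain_ftor :: "('x \<Rightarrow> 'o) \<Rightarrow> ('x \<Rightarrow> 'x \<Rightarrow> 'a) \<Rightarrow> ('x, 'x \<times> 'x, 'o, 'a) ftor" where
  "chain_ftor A t = \<lparr>omap = A, amap = (\<lambda>(x, y). t x y)\<rparr>"

lemma chain_ftor_simps [simp]: "omap (chain_ftor A t) = A" "amap (chain_ftor A t) (x, y) = t x y"
  by (simp_all add: chain_ftor_def)

context presentable_dbl
begin

abbreviation "W \<equiv> Field \<mu>"
abbreviation "Wcat \<equiv> order_cat \<mu>"

lemma \<mu>_Card_order: "Card_order \<mu>" and \<mu>_infinite: "infinite W" and \<mu>_regular: "regularCard \<mu>"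
  and \<mu>_small: "small \<kappa> W"
proof -
  show C: "Card_order \<mu>" and "infinite W" and "regularCard \<mu>"
    using \<mu> by (auto simp: small_regular_def cinfinite_def)
  have "\<mu> <o \<kappa>" using \<mu> by (simp add: small_regular_def)
  then show "small \<kappa> W"
    unfolding small_def by (rule ordIso_ordLess_trans[OF card_of_Field_ordIso[OF C]])
qed

lemma \<mu>_Well_order: "Well_order \<mu>"
  using \<mu>_Card_order by (simp add: card_order_on_def)

lemma \<mu>_refl: "a \<in> W \<Longrightarrow> (a, a) \<in> \<mu>"
  and \<mu>_trans: "(a, b) \<in> \<mu> \<Longrightarrow> (b, c) \<in> \<mu> \<Longrightarrow> (a, c) \<in> \<mu>"
  and \<mu>_antisym: "(a, b) \<in> \<mu> \<Longrightarrow> (b, a) \<in> \<mu> \<Longrightarrow> a = b"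
  and \<mu>_total: "a \<in> W \<Longrightarrow> b \<in> W \<Longrightarrow> (a, b) \<in> \<mu> \<or> (b, a) \<in> \<mu>"
  and \<mu>_Field: "(a, b) \<in> \<mu> \<Longrightarrow> a \<in> W \<and> b \<in> W"
  and \<mu>_wf: "wf (\<mu> - Id)"
proof -
  interpret wo_rel \<mu> using \<mu>_Well_order by (simp add: wo_rel_def)
  show "a \<in> W \<Longrightarrow> (a, a) \<in> \<mu>" using REFL by (simp add: refl_on_def)
  show "(a, b) \<in> \<mu> \<Longrightarrow> (b, c) \<in> \<mu> \<Longrightarrow> (a, c) \<in> \<mu>" using TRANS by (rule transD)
  show "(a, b) \<in> \<mu> \<Longrightarrow> (b, a) \<in> \<mu> \<Longrightarrow> a = b" using ANTISYM by (rule antisymD)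
  show "a \<in> W \<Longrightarrow> b \<in> W \<Longrightarrow> (a, b) \<in> \<mu> \<or> (b, a) \<in> \<mu>" using TOTALS by blast
  show "(a, b) \<in> \<mu> \<Longrightarrow> a \<in> W \<and> b \<in> W" by (simp add: FieldI1 FieldI2)
  show "wf (\<mu> - Id)" by (rule WF)
qed

lemma \<mu>_succ: "a \<in> W \<Longrightarrow> \<exists>b. (a, b) \<in> \<mu> - Id"
  using infinite_Card_order_limit[OF \<mu>_Card_order \<mu>_infinite] by blast

lemma \<mu>_nonempty: "\<exists>a. a \<in> W"
  using \<mu>_infinite by (cases "W = {}") auto

lemma \<mu>_ub: "a \<in> W \<Longrightarrow> b \<in> W \<Longrightarrow> \<exists>n. (a, n) \<in> \<mu> \<and> (b, n) \<in> \<mu>"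
  using \<mu>_total[of a b] \<mu>_refl[of a] \<mu>_refl[of b] by auto

text \<open>
  A set without upper bound is cofinal, since the order is total; by regularity it then has full
  cardinality.
\<close>
lemma \<mu>_bounded:
  assumes "S \<subseteq> W" "|S| <o \<mu>"
  shows "\<exists>b \<in> W. \<forall>a \<in> S. (a, b) \<in> \<mu>"
proof -
  have "\<not> |S| =o \<mu>" using assms(2) by (rule not_ordLess_ordIso)
  then have "\<not> cofinal S \<mu>" using \<mu>_regular assms(1) by (auto simp: regularCard_def)
  then obtain b where "b \<in> W" "\<forall>a \<in> S. b = a \<or> (b, a) \<notin> \<mu>" by (auto simp: cofinal_def)
  moreover from this have "(a, b) \<in> \<mu>" if "a \<in> S" for a
    using that subsetD[OF assms(1) that] \<mu>_total[of a b] \<mu>_refl[of b] by auto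
  ultimately show ?thesis by blast
qed

lemma category_order_cat: "category Wcat"
  by unfold_locales (auto simp: Hom_iff intro: \<mu>_refl \<mu>_trans dest: \<mu>_Field)

lemma order_cat_relabelling:
  obtains q where "relabelling Wcat id (q :: 'u \<times> 'u \<Rightarrow> 'u)"
    "small_filtered_cat \<kappa> \<mu> (relabel id q Wcat)"
proof -
  have "\<mu> \<subseteq> W \<times> W" using \<mu>_Field by auto
  then have sm: "small \<kappa> \<mu>" using small_subset small_Times[OF inacc \<mu>_small \<mu>_small] by blast
  then obtain q where q: "inj_on (q :: 'u \<times> 'u \<Rightarrow> 'u) \<mu>"
    using small_inj_into_carrier[OF Card_order_inaccessible[OF inacc]] by blast
  have R: "relabelling Wcat id q"
    using q category_order_cat by (simp add: relabelling_def relabelling_axioms_def)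
  then interpret relabelling Wcat id q .
  let ?J = "relabel id q Wcat"
  have "filtered \<mu> ?J"
    unfolding filtered_def
  proof (intro conjI category_relabel allI impI)
    fix U V
    assume a: "U \<subseteq> Obj ?J \<and> V \<subseteq> Arr ?J \<and> |U| <o \<mu> \<and> |V| <o \<mu> \<and> Dom ?J ` V \<subseteq> U \<and> Cod ?J ` V \<subseteq> U"
    then obtain b where b: "b \<in> W" "\<forall>a \<in> U. (a, b) \<in> \<mu>" using \<mu>_bounded[of U] by auto
    have U: "(a, b) \<in> \<mu>" "a \<in> W" if "a \<in> U" for a using that b a by auto
    have "q (Cod ?J f, b) \<cdot>\<^bsub>?J\<^esub> f = q (Dom ?J f, b)" if f: "f \<in> V" for f
    proof -
      obtain c d where cd: "f = q (c, d)" "(c, d) \<in> \<mu>" using a f by auto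
      then have "d \<in> U" using a f by auto
      then show ?thesis using cd U by simp
    qed
    then show "\<exists>c \<in> Obj ?J. \<exists>k. (\<forall>s \<in> U. k s \<in> Hom ?J s c) \<and> (\<forall>f \<in> V. k (Cod ?J f) \<cdot>\<^bsub>?J\<^esub> f = k (Dom ?J f))"
      by (intro bexI[of _ b] exI[of _ "\<lambda>s. q (s, b)"]) (use b U in \<open>auto simp: Hom_iff\<close>)
  qed
  then have "small_filtered_cat \<kappa> \<mu> ?J"
    by (simp add: small_filtered_cat_def small_cat_def category_relabel small_image sm \<mu>_small)
  with R show thesis by (rule that)
qed

definition chain :: "'o \<Rightarrow> ('u \<Rightarrow> 'h) \<Rightarrow> ('u \<Rightarrow> 'u \<Rightarrow> 'c) \<Rightarrow> bool" where
  "chain X A t \<longleftrightarrow> X \<in> Obj (D0 D) \<and> (\<forall>a \<in> W. A a \<in> Obj1 \<and> sO (A a) = X \<and> tO (A a) = X \<and> t a a = id1 (A a)) \<and>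
     (\<forall>a b. (a, b) \<in> \<mu> \<longrightarrow> t a b \<in> glob X (A a) (A b)) \<and>
     (\<forall>a b c. (a, b) \<in> \<mu> \<and> (b, c) \<in> \<mu> \<longrightarrow> t b c \<bullet> t a b = t a c)"

definition chain_cocone :: "('u \<Rightarrow> 'h) \<Rightarrow> ('u \<Rightarrow> 'u \<Rightarrow> 'c) \<Rightarrow> 'h \<Rightarrow> ('u \<Rightarrow> 'c) \<Rightarrow> bool" where
  "chain_cocone A t C c \<longleftrightarrow> C \<in> Obj1 \<and> (\<forall>a \<in> W. c a \<in> Hom1 (A a) C) \<and>
     (\<forall>a b. (a, b) \<in> \<mu> \<longrightarrow> c b \<bullet> t a b = c a)"

text \<open>
  As with \<open>presents\<close>, the colimit lies over \<open>X\<close> but is universal among all cocones in \<open>D\<^sub>1\<close>.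
\<close>
definition chain_colimit :: "'o \<Rightarrow> ('u \<Rightarrow> 'h) \<Rightarrow> ('u \<Rightarrow> 'u \<Rightarrow> 'c) \<Rightarrow> 'h \<Rightarrow> ('u \<Rightarrow> 'c) \<Rightarrow> bool" where
  "chain_colimit X A t L l \<longleftrightarrow> chain X A t \<and> chain_cocone A t L l \<and> (\<forall>a \<in> W. l a \<in> glob X (A a) L) \<and>
     (\<forall>C c. chain_cocone A t C c \<longrightarrow> (\<exists>!h. h \<in> Hom1 L C \<and> (\<forall>a \<in> W. h \<bullet> l a = c a)))"

lemma chainD:
  assumes "chain X A t"
  shows "X \<in> Obj (D0 D)"
    and "a \<in> W \<Longrightarrow> A a \<in> Obj1" and "a \<in> W \<Longrightarrow> sO (A a) = X" and "a \<in> W \<Longrightarrow> tO (A a) = X"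
    and "a \<in> W \<Longrightarrow> t a a = id1 (A a)"
    and "(a, b) \<in> \<mu> \<Longrightarrow> t a b \<in> Arr1" and "(a, b) \<in> \<mu> \<Longrightarrow> Dom1 (t a b) = A a"
    and "(a, b) \<in> \<mu> \<Longrightarrow> Cod1 (t a b) = A b"
    and "(a, b) \<in> \<mu> \<Longrightarrow> sA (t a b) = id0 X" and "(a, b) \<in> \<mu> \<Longrightarrow> tA (t a b) = id0 X"
    and "(a, b) \<in> \<mu> \<Longrightarrow> (b, c) \<in> \<mu> \<Longrightarrow> t b c \<bullet> t a b = t a c"
  using assms unfolding chain_def cell_iff by blast+

lemma chain_coconeD:
  assumes "chain_cocone A t C c"
  shows "C \<in> Obj1"
    and "a \<in> W \<Longrightarrow> c a \<in> Arr1" and "a \<in> W \<Longrightarrow> Dom1 (c a) = A a"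
    and "a \<in> W \<Longrightarrow> Cod1 (c a) = C"
    and "(a, b) \<in> \<mu> \<Longrightarrow> c b \<bullet> t a b = c a"
  using assms unfolding chain_cocone_def Hom_iff by blast+

lemma chain_colimitD:
  assumes "chain_colimit X A t L l"
  shows "chain X A t" "chain_cocone A t L l"
    and "a \<in> W \<Longrightarrow> sA (l a) = id0 X" and "a \<in> W \<Longrightarrow> tA (l a) = id0 X"
    and "sO L = X" and "tO L = X"
    and "chain_cocone A t C c \<Longrightarrow> \<exists>!h. h \<in> Hom1 L C \<and> (\<forall>a \<in> W. h \<bullet> l a = c a)"
proof -
  show ch: "chain X A t" and co: "chain_cocone A t L l"
    using assms unfolding chain_colimit_def by blast+
  show "a \<in> W \<Longrightarrow> sA (l a) = id0 X" "a \<in> W \<Longrightarrow> tA (l a) = id0 X" for a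
    using assms unfolding chain_colimit_def cell_iff by blast+
  then obtain a where "a \<in> W" "sA (l a) = id0 X" "tA (l a) = id0 X" using \<mu>_nonempty by blast
  then show "sO L = X" "tO L = X"
    using arr_ends[of "l a"] chain_coconeD[OF co] chainD(1)[OF ch] by auto
  show "chain_cocone A t C c \<Longrightarrow> \<exists>!h. h \<in> Hom1 L C \<and> (\<forall>a \<in> W. h \<bullet> l a = c a)"
    using assms unfolding chain_colimit_def by blast
qed

lemma chain_colimit_eqI:
  assumes "chain_colimit X A t L l" "h \<in> Arr1" "h' \<in> Arr1" "Dom1 h = L"
    "Dom1 h' = L" "Cod1 h = Cod1 h'" "\<And>a. a \<in> W \<Longrightarrow> h \<bullet> l a = h' \<bullet> l a"
  shows "h = h'"
proof -
  note l = chain_coconeD[OF chain_colimitD(2)[OF assms(1)]] and t = chainD[OF chain_colimitD(1)[OF assms(1)]]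
  have "chain_cocone A t (Cod1 h) (\<lambda>a. h \<bullet> l a)"
    unfolding chain_cocone_def
  proof (intro conjI ballI allI impI)
    fix a b assume ab: "(a, b) \<in> \<mu>"
    then have "(h \<bullet> l b) \<bullet> t a b = h \<bullet> (l b \<bullet> t a b)"
      using \<mu>_Field[OF ab] assms(2-4) l t by (simp add: D1.assoc_comp)
    then show "(h \<bullet> l b) \<bullet> t a b = h \<bullet> l a" using l(5)[OF ab] by simp
  qed (use assms(2-4) l t in \<open>auto simp: Hom_iff\<close>)
  then have "\<exists>!k. k \<in> Hom1 L (Cod1 h) \<and> (\<forall>a \<in> W. k \<bullet> l a = h \<bullet> l a)"
    by (rule chain_colimitD(7)[OF assms(1)])
  moreover have "h \<in> Hom1 L (Cod1 h)" "h' \<in> Hom1 L (Cod1 h)"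
    using assms by (auto simp: Hom_iff)
  ultimately show ?thesis using assms(7) by metis
qed

text \<open>
  Chains are connected, so the legs of any cocone on a chain over \<open>X\<close> have the same vertical boundary.
\<close>
lemma chain_cocone_boundary:
  assumes ch: "chain X A t" and c: "chain_cocone A t C c" and W: "a \<in> W" "b \<in> W"
  shows "sA (c a) = sA (c b)" "tA (c a) = tA (c b)"
proof -
  have *: "sA (c a) = sA (c b) \<and> tA (c a) = tA (c b)" if ab: "(a, b) \<in> \<mu>" for a b
  proof -
    have W: "a \<in> W" "b \<in> W" using \<mu>_Field[OF ab] by auto
    have "Dom (D0 D) (sA (c b)) = X" "Dom (D0 D) (tA (c b)) = X"
      using arr_ends[of "c b"] W chain_coconeD[OF c] chainD[OF ch] by auto
    moreover have "sA (c b \<bullet> t a b) = sA (c a)" "tA (c b \<bullet> t a b) = tA (c a)"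
      using chain_coconeD(5)[OF c ab] by auto
    moreover have "sA (c b \<bullet> t a b) = sA (c b) \<circ>\<^sub>0 id0 X" "tA (c b \<bullet> t a b) = tA (c b) \<circ>\<^sub>0 id0 X"
      using W ab chain_coconeD(2-4)[OF c] chainD(6-10)[OF ch] by simp_all
    moreover have "sA (c b) \<in> Arr (D0 D)" "tA (c b) \<in> Arr (D0 D)"
      using W chain_coconeD(2)[OF c] by simp_all
    ultimately show ?thesis by simp
  qed
  then show "sA (c a) = sA (c b)" "tA (c a) = tA (c b)" using \<mu>_total[OF W] by metis+
qed

lemma chain_colimit_exists:
  assumes ch: "chain X A t"
  obtains L l where "chain_colimit X A t L l"
proof -
  let ?E = "(\<lambda>(a, b). ((a, id1 (A a)), (b, t a b))) ` \<mu>"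
  have E: "presentation (D1 D) W A ?E"
    unfolding presentation_def using chainD[OF ch] \<mu>_Field by auto
  have "\<mu> \<subseteq> W \<times> W" using \<mu>_Field by auto
  then have sm: "small \<kappa> ?E" using small_subset small_Times[OF inacc \<mu>_small \<mu>_small] small_image by blast
  obtain a0 where a0: "a0 \<in> W" using \<mu>_nonempty by blast
  obtain L l where L: "presents X W A ?E L l"
  proof (rule presented_cell_exists[OF chainD(1)[OF ch] E \<mu>_small sm a0])
    show "\<And>i. i \<in> W \<Longrightarrow> sO (A i) = X \<and> tO (A i) = X" using chainD[OF ch] by auto
    show "\<And>i \<phi> j \<psi>. ((i, \<phi>), (j, \<psi>)) \<in> ?E \<Longrightarrow> sA \<phi> = id0 X \<and> tA \<phi> = id0 X \<and> sA \<psi> = id0 X \<and> tA \<psi> = id0 X"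
      using chainD[OF ch] \<mu>_Field by auto
  qed
  have sol: "solution (D1 D) W A ?E C c \<longleftrightarrow> chain_cocone A t C c" for C c
  proof -
    have eqns: "(\<forall>i \<phi> j \<psi>. ((i, \<phi>), (j, \<psi>)) \<in> ?E \<longrightarrow> c i \<bullet> \<phi> = c j \<bullet> \<psi>) \<longleftrightarrow>
        (\<forall>a b. (a, b) \<in> \<mu> \<longrightarrow> c a \<bullet> id1 (A a) = c b \<bullet> t a b)" by (fastforce simp: image_iff)
    have "c a \<bullet> id1 (A a) = c a" if "\<forall>a \<in> W. c a \<in> Hom1 (A a) C" "(a, b) \<in> \<mu>" for a b
      using that \<mu>_Field[of a b] by (simp add: Hom_iff)
    then show ?thesis unfolding solution_def chain_cocone_def eqns by metis
  qed
  have "chain_colimit X A t L l"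
    unfolding chain_colimit_def
  proof (intro conjI ch ballI allI impI)
    show "chain_cocone A t L l" "\<And>a. a \<in> W \<Longrightarrow> l a \<in> glob X (A a) L"
      using L sol unfolding presents_def by blast+
  next
    fix C c assume c: "chain_cocone A t C c"
    have "\<forall>a \<in> W. c a \<in> cell (sA (c a0)) (tA (c a0)) (A a) C"
      using chain_coconeD[OF c] chain_cocone_boundary[OF ch c _ a0] by (simp add: cell_iff)
    then show "\<exists>!h. h \<in> Hom1 L C \<and> (\<forall>a \<in> W. h \<bullet> l a = c a)"
      using L c sol unfolding presents_def by blast
  qed
  then show thesis by (rule that)
qed

section \<open>Horizontal composition preserves colimits of chains\<close>

definition fibre :: "('h, 'c, 'o, 'v) ftor \<Rightarrow> 'o \<Rightarrow> ('h, 'c) cat" where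
  "fibre P X = subcat (D1 D) (\<lambda>M. omap P M = X) (\<lambda>\<alpha>. amap P \<alpha> = id0 X)"

lemma fibre_simps [simp]:
  "M \<in> Obj (fibre P X) \<longleftrightarrow> M \<in> Obj1 \<and> omap P M = X"
  "\<alpha> \<in> Arr (fibre P X) \<longleftrightarrow> \<alpha> \<in> Arr1 \<and> amap P \<alpha> = id0 X"
  "Dom (fibre P X) = Dom1" "Cod (fibre P X) = Cod1"
  "Ident (fibre P X) = id1" "\<beta> \<cdot>\<^bsub>fibre P X\<^esub> \<alpha> = \<beta> \<bullet> \<alpha>"
  by (auto simp: fibre_def subcat_def)

lemma fibre_cocone:
  assumes "\<And>a. a \<in> W \<Longrightarrow> omap P (A a) = X"
  shows "is_cocone Wcat (fibre P X) (chain_ftor A t) C c \<longleftrightarrow>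
    chain_cocone A t C c \<and> omap P C = X \<and> (\<forall>a \<in> W. amap P (c a) = id0 X)"
  unfolding is_cocone_def chain_cocone_def by (auto simp: Hom_iff)

text \<open>
  A mediating arrow between objects of the fibre lies in the fibre because its composite with one leg
  does.
\<close>
lemma chain_colimit_in_fibre:
  assumes P: "P \<in> {src D, tgt D}" and L: "chain_colimit X A t L l"
  shows "is_colimit Wcat (fibre P X) (chain_ftor A t) L l"
  unfolding is_colimit_def
proof (intro conjI allI impI)
  have PA: "\<And>a. a \<in> W \<Longrightarrow> omap P (A a) = X" and Pl: "\<And>a. a \<in> W \<Longrightarrow> amap P (l a) = id0 X" and PL: "omap P L = X"
    using P chainD[OF chain_colimitD(1)[OF L]] chain_colimitD(3-6)[OF L] by auto
  have "chain_cocone A t L l" using L by (rule chain_colimitD)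
  then show "is_cocone Wcat (fibre P X) (chain_ftor A t) L l"
    using PL Pl PA by (simp add: fibre_cocone)
next
  fix C c assume "is_cocone Wcat (fibre P X) (chain_ftor A t) C c"
  moreover have "\<And>a. a \<in> W \<Longrightarrow> omap P (A a) = X" and Pl: "\<And>a. a \<in> W \<Longrightarrow> amap P (l a) = id0 X"
      and PL: "omap P L = X" and P: "is_functor (D1 D) (D0 D) P"
    using P chainD[OF chain_colimitD(1)[OF L]] chain_colimitD(3-6)[OF L] src_functor tgt_functor by auto
  ultimately have c: "chain_cocone A t C c \<and> omap P C = X \<and> (\<forall>a \<in> W. amap P (c a) = id0 X)"
    by (simp add: fibre_cocone)
  then have ex1: "\<exists>!h. h \<in> Hom1 L C \<and> (\<forall>a \<in> W. h \<bullet> l a = c a)" by (intro chain_colimitD(7)[OF L]) simp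
  have "amap P h = id0 X" if h: "h \<in> Hom1 L C" "\<forall>a \<in> W. h \<bullet> l a = c a" for h
  proof -
    obtain a where a: "a \<in> W" using \<mu>_nonempty by blast
    note l = chain_coconeD[OF chain_colimitD(2)[OF L]]
    have hA: "h \<in> Arr1" "Dom1 h = L" using h by (auto simp: Hom_iff)
    have "amap P (h \<bullet> l a) = id0 X" using h a c by simp
    then show ?thesis using hA a l is_functorD(5-8)[OF P] Pl PL by simp
  qed
  then have "h \<in> Hom (fibre P X) L C \<and> (\<forall>j \<in> Obj Wcat. h \<cdot>\<^bsub>fibre P X\<^esub> l j = c j) \<longleftrightarrow>
      h \<in> Hom1 L C \<and> (\<forall>a \<in> W. h \<bullet> l a = c a)" for h
    by (auto simp: Hom_iff)
  then show "\<exists>!h. h \<in> Hom (fibre P X) L C \<and> (\<forall>j \<in> Obj Wcat. h \<cdot>\<^bsub>fibre P X\<^esub> l j = c j)"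
    using ex1 by simp
qed

text \<open>
  Some colimit \<open>L'\<close> of the chain in \<open>D\<^sub>1\<close> lies over \<open>X\<close>, and it is a colimit in the fibre as well.  So a
  colimit in the fibre is isomorphic to \<open>L'\<close>, compatibly with the legs, and inherits the stronger
  universal property.
\<close>
lemma chain_colimit_of_fibre:
  assumes P: "P \<in> {src D, tgt D}" and ch: "chain X A t"
    and L: "is_colimit Wcat (fibre P X) (chain_ftor A t) L l"
    and l: "\<And>a. a \<in> W \<Longrightarrow> l a \<in> glob X (A a) L"
  shows "chain_colimit X A t L l"
proof -
  obtain L' l' where L': "chain_colimit X A t L' l'" using chain_colimit_exists[OF ch] .
  have PA: "\<And>a. a \<in> W \<Longrightarrow> omap P (A a) = X" using P chainD[OF ch] by auto
  note F' = chain_colimit_in_fibre[OF P L']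
  have uniq: "\<exists>!h. h \<in> Hom (fibre P X) K C \<and> (\<forall>a \<in> W. h \<bullet> k a = c a)"
    if "is_colimit Wcat (fibre P X) (chain_ftor A t) K k"
      "is_colimit Wcat (fibre P X) (chain_ftor A t) C c" for K k C c
    using that unfolding is_colimit_def by simp
  obtain i where i: "i \<in> Hom (fibre P X) L L'" "\<And>a. a \<in> W \<Longrightarrow> i \<bullet> l a = l' a" using uniq[OF L F'] by blast
  obtain j where j: "j \<in> Hom (fibre P X) L' L" "\<And>a. a \<in> W \<Longrightarrow> j \<bullet> l' a = l a" using uniq[OF F' L] by blast
  have iA [simp]: "i \<in> Arr1" "Dom1 i = L" "Cod1 i = L'" and jA [simp]: "j \<in> Arr1" "Dom1 j = L'" "Cod1 j = L"
    using i j by (auto simp: Hom_iff)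
  have co: "chain_cocone A t L l"
    using L PA unfolding is_colimit_def by (simp add: fibre_cocone)
  note lA [simp] = chain_coconeD(1-4)[OF co] and l'A [simp] = chain_coconeD(1-4)[OF chain_colimitD(2)[OF L']]
  have "j \<bullet> i \<in> Hom (fibre P X) L L" "id1 L \<in> Hom (fibre P X) L L"
  proof -
    have PF: "is_functor (D1 D) (D0 D) P" using P src_functor tgt_functor by auto
    have "omap P L = X" using L PA unfolding is_colimit_def by (simp add: fibre_cocone)
    then show "id1 L \<in> Hom (fibre P X) L L" using is_functorD(4)[OF PF, of L] by (simp add: Hom_iff)
    have "amap P i = id0 X" "amap P j = id0 X" using i j by (simp_all add: Hom_iff)
    then show "j \<bullet> i \<in> Hom (fibre P X) L L"
      using is_functorD(8)[OF PF, of i j] chainD(1)[OF ch] by (simp add: Hom_iff)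
  qed
  moreover have "(j \<bullet> i) \<bullet> l a = l a" "id1 L \<bullet> l a = l a" if "a \<in> W" for a
    using that i(2) j(2) by (simp_all add: D1.assoc_comp)
  ultimately have ji: "j \<bullet> i = id1 L" using uniq[OF L L] by blast
  have "\<exists>!h. h \<in> Hom1 L C \<and> (\<forall>a \<in> W. h \<bullet> l a = c a)" if c: "chain_cocone A t C c" for C c
  proof -
    obtain h where h: "h \<in> Hom1 L' C" "\<And>a. a \<in> W \<Longrightarrow> h \<bullet> l' a = c a"
      using chain_colimitD(7)[OF L' c] by blast
    then have hA [simp]: "h \<in> Arr1" "Dom1 h = L'" "Cod1 h = C" by (auto simp: Hom_iff)
    show ?thesis
    proof (rule ex1I[of _ "h \<bullet> i"], intro conjI ballI)
      show "h \<bullet> i \<in> Hom1 L C" by (simp add: Hom_iff)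
      show "a \<in> W \<Longrightarrow> (h \<bullet> i) \<bullet> l a = c a" for a using h(2) i(2) by (simp add: D1.assoc_comp)
      fix g assume g: "g \<in> Hom1 L C \<and> (\<forall>a \<in> W. g \<bullet> l a = c a)"
      then have gA [simp]: "g \<in> Arr1" "Dom1 g = L" "Cod1 g = C" by (auto simp: Hom_iff)
      have "g \<bullet> j = h"
        by (rule chain_colimit_eqI[OF L']) (use g h(2) j(2) in \<open>simp_all add: D1.assoc_comp\<close>)
      then have "h \<bullet> i = g \<bullet> (j \<bullet> i)" by (auto simp: D1.assoc_comp)
      then show "g = h \<bullet> i" using ji by simp
    qed
  qed
  then show ?thesis
    using ch co l unfolding chain_colimit_def by blast
qed

end

context presentable_dbl
begin

lemma accessible_preserves_chain_colimit:
  assumes G: "accessible_functor \<kappa> \<mu> B C G" and F: "is_functor Wcat B F"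
    and L: "is_colimit Wcat B F L l"
  shows "is_colimit Wcat C (comp_ftor G F) (omap G L) (amap G \<circ> l)"
proof -
  obtain q where q: "relabelling Wcat id (q :: 'u \<times> 'u \<Rightarrow> 'u)"
      "small_filtered_cat \<kappa> \<mu> (relabel id q Wcat)"
    by (rule order_cat_relabelling)
  interpret relabelling Wcat id q by fact
  let ?J = "relabel id q Wcat" and ?F = "relabel_ftor id q Wcat F"
  have "is_colimit ?J B ?F L l" using L by (simp add: colimit_relabel)
  moreover have "is_functor ?J B ?F" using F by (rule functor_relabel)
  ultimately have "is_colimit ?J C (comp_ftor G ?F) (omap G L) (amap G \<circ> l)"
    using G q(2) unfolding accessible_functor_def preserves_colimits_of_shape_def by blast
  then show ?thesis by (simp add: relabel_ftor_comp colimit_relabel)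
qed

lemma src_fibre_eq: "src_fibre D X = fibre (src D) X"
  and tgt_fibre_eq: "tgt_fibre D X = fibre (tgt D) X"
  by (simp_all add: src_fibre_def tgt_fibre_def fibre_def)

lemma chain_functor_fibre:
  assumes "category (fibre P X)" "chain X' A t" "\<And>a. a \<in> W \<Longrightarrow> omap P (A a) = X"
    "\<And>a b. (a, b) \<in> \<mu> \<Longrightarrow> amap P (t a b) = id0 X"
  shows "is_functor Wcat (fibre P X) (chain_ftor A t)"
  unfolding is_functor_def
proof (intro conjI ballI impI assms(1) category_order_cat)
  note t = chainD[OF assms(2)]
  fix a assume a: "a \<in> Obj Wcat"
  then show "omap (chain_ftor A t) a \<in> Obj (fibre P X)" using assms(3) t by simp
  show "amap (chain_ftor A t) (Ident Wcat a) = Ident (fibre P X) (omap (chain_ftor A t) a)"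
    using a t by simp
next
  note t = chainD[OF assms(2)]
  fix f assume f: "f \<in> Arr Wcat"
  obtain a b where ab: "f = (a, b)" by (cases f)
  then show "amap (chain_ftor A t) f \<in>
      Hom (fibre P X) (omap (chain_ftor A t) (Dom Wcat f)) (omap (chain_ftor A t) (Cod Wcat f))"
    using f t assms(4) by (simp add: Hom_iff)
  fix g assume g: "g \<in> Arr Wcat" "Dom Wcat g = Cod Wcat f"
  then obtain c where "g = (b, c)" using ab by (cases g) auto
  then show "amap (chain_ftor A t) (g \<cdot>\<^bsub>order_cat \<mu>\<^esub> f) =
      amap (chain_ftor A t) g \<cdot>\<^bsub>fibre P X\<^esub> amap (chain_ftor A t) f"
    using f g ab t by simp
qed

lemma chain_star:
  assumes A: "chain X A t" and B: "chain X B r"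
  shows "chain X (\<lambda>a. A a \<odot> B a) (\<lambda>a b. t a b \<star> r a b)"
  using chainD[OF A] chainD[OF B] \<mu>_Field unfolding chain_def
  by (simp add: cell_iff interchange)

lemma const_chain: "M \<in> Obj1 \<Longrightarrow> sO M = X \<Longrightarrow> tO M = X \<Longrightarrow> chain X (\<lambda>a. M) (\<lambda>a b. id1 M)"
  unfolding chain_def by (auto simp: cell_iff)

text \<open>
  Accessibility applies in the fibre of source or target over \<open>X\<close>; the comparison of colimits there and
  in \<open>D\<^sub>1\<close> transfers its conclusion to all cocones.
\<close>
lemma accessible_chain_colimit:
  assumes P: "P \<in> {src D, tgt D}" and L: "chain_colimit X A t L l"
    and G: "accessible_functor \<kappa> \<mu> (fibre P X) (fibre P X) G"
    and ch': "chain X (\<lambda>a. omap G (A a)) (\<lambda>a b. amap G (t a b))"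
    and l: "\<And>a. a \<in> W \<Longrightarrow> amap G (l a) \<in> glob X (omap G (A a)) (omap G L)"
  shows "chain_colimit X (\<lambda>a. omap G (A a)) (\<lambda>a b. amap G (t a b)) (omap G L) (\<lambda>a. amap G (l a))"
proof -
  note ch = chain_colimitD(1)[OF L]
  have F: "is_functor Wcat (fibre P X) (chain_ftor A t)"
    by (rule chain_functor_fibre[OF _ ch])
      (use P G chainD[OF ch] in \<open>auto simp: accessible_functor_def accessible_cat_def\<close>)
  from accessible_preserves_chain_colimit[OF G F chain_colimit_in_fibre[OF P L]]
  have "is_colimit Wcat (fibre P X) (chain_ftor (\<lambda>a. omap G (A a)) (\<lambda>a b. amap G (t a b)))
      (omap G L) (\<lambda>a. amap G (l a))"
    by (simp add: comp_ftor_def chain_ftor_def o_def case_prod_unfold)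
  then show ?thesis using chain_colimit_of_fibre[OF P ch'] l by blast
qed

lemma right_tensor_chain_colimit:
  assumes L: "chain_colimit X A t L l" and M: "M \<in> Obj1" "sO M = X" "tO M = X"
  shows "chain_colimit X (\<lambda>a. A a \<odot> M) (\<lambda>a b. t a b \<star> id1 M) (L \<odot> M) (\<lambda>a. l a \<star> id1 M)"
proof -
  note l = chain_coconeD[OF chain_colimitD(2)[OF L]] chain_colimitD(3-6)[OF L]
  have "accessible_functor \<kappa> \<mu> (fibre (src D) X) (fibre (src D) X) (right_tensor D M)"
    using right_accessible[OF M(1)] M by (simp add: src_fibre_eq)
  from accessible_chain_colimit[OF _ L this, unfolded right_tensor_def, simplified]
  show ?thesis using chain_star[OF chain_colimitD(1)[OF L] const_chain[OF M]] l M by (simp add: cell_iff)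
qed

lemma left_tensor_chain_colimit:
  assumes L: "chain_colimit X A t L l" and M: "M \<in> Obj1" "sO M = X" "tO M = X"
  shows "chain_colimit X (\<lambda>a. M \<odot> A a) (\<lambda>a b. id1 M \<star> t a b) (M \<odot> L) (\<lambda>a. id1 M \<star> l a)"
proof -
  note l = chain_coconeD[OF chain_colimitD(2)[OF L]] chain_colimitD(3-6)[OF L]
  have "accessible_functor \<kappa> \<mu> (fibre (tgt D) X) (fibre (tgt D) X) (left_tensor D M)"
    using left_accessible[OF M(1)] M by (simp add: tgt_fibre_eq)
  from accessible_chain_colimit[OF _ L this, unfolded left_tensor_def, simplified]
  show ?thesis using chain_star[OF const_chain[OF M] chain_colimitD(1)[OF L]] l M by (simp add: cell_iff)
qed

text \<open>
  \<open>L \<odot> K\<close> is the colimit of the \<open>A a \<odot> B b\<close> over two indices, by preservation in each variable separately.  As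
  any two indices have an upper bound, a cocone on the diagonal determines one on all pairs: \<open>d a b\<close>
  below is its value at \<open>(a, b)\<close>, and \<open>e a\<close> combines the values with first index \<open>a\<close>.
\<close>
lemma diagonal_chain_colimit:
  assumes L: "chain_colimit X A t L l" and K: "chain_colimit X B r K k"
  shows "chain_colimit X (\<lambda>a. A a \<odot> B a) (\<lambda>a b. t a b \<star> r a b) (L \<odot> K) (\<lambda>a. l a \<star> k a)"
proof -
  note t [simp] = chainD(1-10)[OF chain_colimitD(1)[OF L]]
  note r [simp] = chainD(2-10)[OF chain_colimitD(1)[OF K]]
  note l [simp] = chain_coconeD(1-4)[OF chain_colimitD(2)[OF L]] chain_colimitD(3-6)[OF L]
  note k [simp] = chain_coconeD(1-4)[OF chain_colimitD(2)[OF K]] chain_colimitD(3-6)[OF K]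
  note tt = chainD(11)[OF chain_colimitD(1)[OF L]] and rr = chainD(11)[OF chain_colimitD(1)[OF K]]
  note lt = chain_coconeD(5)[OF chain_colimitD(2)[OF L]] and kr = chain_coconeD(5)[OF chain_colimitD(2)[OF K]]
  have ch: "chain X (\<lambda>a. A a \<odot> B a) (\<lambda>a b. t a b \<star> r a b)"
    by (rule chain_star) (use L K in \<open>auto dest: chain_colimitD\<close>)
  have co: "chain_cocone (\<lambda>a. A a \<odot> B a) (\<lambda>a b. t a b \<star> r a b) (L \<odot> K) (\<lambda>a. l a \<star> k a)"
    unfolding chain_cocone_def using \<mu>_Field by (auto simp: Hom_iff interchange lt kr)
  have KR: "chain_colimit X (\<lambda>a. A a \<odot> K) (\<lambda>a b. t a b \<star> id1 K) (L \<odot> K) (\<lambda>a. l a \<star> id1 K)"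
    by (rule right_tensor_chain_colimit[OF L]) simp_all
  have AL: "chain_colimit X (\<lambda>b. A a \<odot> B b) (\<lambda>b b'. id1 (A a) \<star> r b b') (A a \<odot> K) (\<lambda>b. id1 (A a) \<star> k b)"
    if "a \<in> W" for a
    by (rule left_tensor_chain_colimit[OF K]) (use that in simp_all)
  have "\<exists>!h. h \<in> Hom1 (L \<odot> K) C \<and> (\<forall>a \<in> W. h \<bullet> (l a \<star> k a) = c a)"
    if c: "chain_cocone (\<lambda>a. A a \<odot> B a) (\<lambda>a b. t a b \<star> r a b) C c" for C c
  proof -
    note cc [simp] = chain_coconeD(1-4)[OF c]
    have ct: "c b \<bullet> (t a b \<star> r a b) = c a" if "(a, b) \<in> \<mu>" for a b using chain_coconeD(5)[OF c that] .
    define mx where "mx a b = (if (a, b) \<in> \<mu> then b else a)" for a b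
    have mx: "(a, mx a b) \<in> \<mu>" "(b, mx a b) \<in> \<mu>" if "a \<in> W" "b \<in> W" for a b
      using that \<mu>_total[of a b] \<mu>_refl[of a] \<mu>_refl[of b] by (auto simp: mx_def)
    define d where "d a b = c (mx a b) \<bullet> (t a (mx a b) \<star> r b (mx a b))" for a b
    have d_ub: "d a b = c n \<bullet> (t a n \<star> r b n)" if "(a, n) \<in> \<mu>" "(b, n) \<in> \<mu>" for a b n
    proof -
      have W: "a \<in> W" "b \<in> W" "n \<in> W" using that \<mu>_Field by blast+
      let ?m = "mx a b"
      note m = mx[OF W(1,2)]
      have mn: "(?m, n) \<in> \<mu>" using that by (auto simp: mx_def)
      have mW: "?m \<in> W" using mn \<mu>_Field by blast
      have "d a b = (c n \<bullet> (t ?m n \<star> r ?m n)) \<bullet> (t a ?m \<star> r b ?m)"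
        using ct[OF mn] by (simp add: d_def)
      also have "\<dots> = c n \<bullet> ((t ?m n \<star> r ?m n) \<bullet> (t a ?m \<star> r b ?m))"
        using W mW m mn by (intro D1.assoc_comp) simp_all
      also have "\<dots> = c n \<bullet> (t a n \<star> r b n)"
        using W mW m mn tt[OF m(1) mn] rr[OF m(2) mn] by (simp add: interchange)
      finally show ?thesis .
    qed
    have d_Arr: "d a b \<in> Arr1" "Dom1 (d a b) = A a \<odot> B b" "Cod1 (d a b) = C"
      if "a \<in> W" "b \<in> W" for a b
      using mx[OF that] that \<mu>_Field[OF mx(1)[OF that]] by (simp_all add: d_def)
    have "\<exists>!e. e \<in> Hom1 (A a \<odot> K) C \<and> (\<forall>b \<in> W. e \<bullet> (id1 (A a) \<star> k b) = d a b)" if a: "a \<in> W" for a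
    proof (rule chain_colimitD(7)[OF AL[OF a]])
      show "chain_cocone (\<lambda>b. A a \<odot> B b) (\<lambda>b b'. id1 (A a) \<star> r b b') C (d a)"
        unfolding chain_cocone_def
      proof (intro conjI ballI allI impI)
        show "C \<in> Obj1" by simp
        show "b \<in> W \<Longrightarrow> d a b \<in> Hom1 (A a \<odot> B b) C" for b using d_Arr[OF a] by (simp add: Hom_iff)
        fix b b' assume bb: "(b, b') \<in> \<mu>"
        then have W: "b \<in> W" "b' \<in> W" using \<mu>_Field by blast+
        obtain n where n: "(a, n) \<in> \<mu>" "(b', n) \<in> \<mu>" using \<mu>_ub a W by blast
        then have bn: "(b, n) \<in> \<mu>" "n \<in> W" using bb \<mu>_trans \<mu>_Field by blast+
        have "d a b' \<bullet> (id1 (A a) \<star> r b b') = c n \<bullet> ((t a n \<star> r b' n) \<bullet> (id1 (A a) \<star> r b b'))"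
          using d_ub[OF n] a W n bn bb by (simp add: D1.assoc_comp)
        also have "\<dots> = c n \<bullet> (t a n \<star> r b n)"
          using a W n bn bb rr[OF bb n(2)] by (simp add: interchange)
        finally show "d a b' \<bullet> (id1 (A a) \<star> r b b') = d a b" using d_ub[OF n(1) bn(1)] by simp
      qed
    qed
    then obtain e where e: "\<And>a. a \<in> W \<Longrightarrow> e a \<in> Hom1 (A a \<odot> K) C"
      and ed: "\<And>a b. a \<in> W \<Longrightarrow> b \<in> W \<Longrightarrow> e a \<bullet> (id1 (A a) \<star> k b) = d a b" by metis
    have eA [simp]: "e a \<in> Arr1" "Dom1 (e a) = A a \<odot> K" "Cod1 (e a) = C" if "a \<in> W" for a
      using e[OF that] by (auto simp: Hom_iff)
    have e_uniq: "g = e a" if "a \<in> W" "g \<in> Arr1" "Dom1 g = A a \<odot> K" "Cod1 g = C"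
        "\<And>b. b \<in> W \<Longrightarrow> g \<bullet> (id1 (A a) \<star> k b) = d a b" for g a
      by (rule chain_colimit_eqI[OF AL[OF that(1)]]) (use that ed in simp_all)
    have "chain_cocone (\<lambda>a. A a \<odot> K) (\<lambda>a b. t a b \<star> id1 K) C e"
      unfolding chain_cocone_def
    proof (intro conjI ballI allI impI)
      show "C \<in> Obj1" by simp
      show "a \<in> W \<Longrightarrow> e a \<in> Hom1 (A a \<odot> K) C" for a by (rule e)
      fix a a' assume aa: "(a, a') \<in> \<mu>"
      then have W: "a \<in> W" "a' \<in> W" using \<mu>_Field by blast+
      show "e a' \<bullet> (t a a' \<star> id1 K) = e a"
      proof (rule e_uniq[OF W(1)])
        fix b assume b: "b \<in> W"
        obtain n where n: "(a', n) \<in> \<mu>" "(b, n) \<in> \<mu>" using \<mu>_ub W b by blast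
        then have an: "(a, n) \<in> \<mu>" "n \<in> W" using aa \<mu>_trans \<mu>_Field by blast+
        have "(e a' \<bullet> (t a a' \<star> id1 K)) \<bullet> (id1 (A a) \<star> k b) = e a' \<bullet> ((t a a' \<star> id1 K) \<bullet> (id1 (A a) \<star> k b))"
          using W b aa by (intro D1.assoc_comp) simp_all
        also have "\<dots> = e a' \<bullet> ((id1 (A a') \<star> k b) \<bullet> (t a a' \<star> id1 (B b)))"
          using W b aa by (simp add: interchange)
        also have "\<dots> = d a' b \<bullet> (t a a' \<star> id1 (B b))"
          using W b aa ed[OF W(2) b] by (subst D1.assoc_comp[symmetric]) simp_all
        also have "\<dots> = c n \<bullet> ((t a' n \<star> r b n) \<bullet> (t a a' \<star> id1 (B b)))"
          unfolding d_ub[OF n] using W b aa n an by (intro D1.assoc_comp) simp_all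
        also have "\<dots> = d a b"
          using W b aa n an tt[OF aa n(1)] d_ub[OF an(1) n(2)] by (simp add: interchange)
        finally show "(e a' \<bullet> (t a a' \<star> id1 K)) \<bullet> (id1 (A a) \<star> k b) = d a b" .
      qed (use W aa in simp_all)
    qed
    from chain_colimitD(7)[OF KR this]
    obtain h where h: "h \<in> Hom1 (L \<odot> K) C" "\<And>a. a \<in> W \<Longrightarrow> h \<bullet> (l a \<star> id1 K) = e a" by blast
    have he: "g \<bullet> (l a \<star> k b) = (g \<bullet> (l a \<star> id1 K)) \<bullet> (id1 (A a) \<star> k b)"
      if "a \<in> W" "b \<in> W" "g \<in> Hom1 (L \<odot> K) C" for a b g
      using that by (simp add: Hom_iff D1.assoc_comp interchange)
    show ?thesis
    proof (rule ex1I[of _ h], intro conjI ballI)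
      show "h \<in> Hom1 (L \<odot> K) C" by (rule h)
      fix a assume a: "a \<in> W"
      have "h \<bullet> (l a \<star> k a) = d a a" using he[OF a a h(1)] h(2)[OF a] ed[OF a a] by simp
      also have "\<dots> = c a" using d_ub[OF \<mu>_refl[OF a] \<mu>_refl[OF a]] a ct[OF \<mu>_refl[OF a]] by simp
      finally show "h \<bullet> (l a \<star> k a) = c a" .
    next
      fix g assume g: "g \<in> Hom1 (L \<odot> K) C \<and> (\<forall>a \<in> W. g \<bullet> (l a \<star> k a) = c a)"
      then have gA: "g \<in> Arr1" "Dom1 g = L \<odot> K" "Cod1 g = C" by (auto simp: Hom_iff)
      have hA: "h \<in> Arr1" "Dom1 h = L \<odot> K" "Cod1 h = C" using h by (auto simp: Hom_iff)
      have "g \<bullet> (l a \<star> id1 K) = e a" if a: "a \<in> W" for a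
      proof (rule e_uniq[OF a])
        fix b assume b: "b \<in> W"
        obtain n where n: "(a, n) \<in> \<mu>" "(b, n) \<in> \<mu>" using \<mu>_ub a b by blast
        then have nW: "n \<in> W" using \<mu>_Field by blast
        have "(g \<bullet> (l a \<star> id1 K)) \<bullet> (id1 (A a) \<star> k b) = g \<bullet> ((l n \<star> k n) \<bullet> (t a n \<star> r b n))"
          using a b n nW gA he[OF a b] g by (simp add: interchange lt[OF n(1)] kr[OF n(2)])
        also have "\<dots> = (g \<bullet> (l n \<star> k n)) \<bullet> (t a n \<star> r b n)"
          using a b n nW gA by (intro D1.assoc_comp[symmetric]) simp_all
        also have "\<dots> = d a b" using g nW d_ub[OF n] by simp
        finally show "(g \<bullet> (l a \<star> id1 K)) \<bullet> (id1 (A a) \<star> k b) = d a b" .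
      qed (use a gA in simp_all)
      then show "g = h"
        using gA hA h(2) by - (rule chain_colimit_eqI[OF KR], simp_all)
    qed
  qed
  moreover have "\<forall>a \<in> W. l a \<star> k a \<in> glob X (A a \<odot> B a) (L \<odot> K)"
    by (simp add: cell_iff)
  ultimately show ?thesis
    unfolding chain_colimit_def by (intro conjI ch co allI impI)
qed

end

section \<open>The transfinite construction of the free monad\<close>

text \<open>
  The generators of a stage: the unit \<open>1\<^sub>X\<close>, the given endo-1-cell, the previous stages, and the products
  \<open>T b \<odot> T b\<close> of previous stages.
\<close>
datatype 'x gen = Unit | Gen | Prev 'x | Prod 'x

context presentable_dbl
begin

definition below :: "'u \<Rightarrow> 'u set" where
  "below a = {b. (b, a) \<in> \<mu> - Id}"

definition gens :: "'u \<Rightarrow> 'u gen set" where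
  "gens a = {Unit, Gen} \<union> Prev ` below a \<union> Prod ` below a"

definition gobj :: "'o \<Rightarrow> 'h \<Rightarrow> ('u \<Rightarrow> 'h \<times> ('u gen \<Rightarrow> 'c)) \<Rightarrow> 'u gen \<Rightarrow> 'h" where
  "gobj X M S i = (case i of Unit \<Rightarrow> uO X | Gen \<Rightarrow> M | Prev b \<Rightarrow> fst (S b) | Prod b \<Rightarrow> fst (S b) \<odot> fst (S b))"

text \<open>
  A stage \<open>S c\<close> consists of its object and its legs.  In terms of the final monad, the first two
  families of equations say that the unit and the inclusion of \<open>M\<close> are compatible with the transitions.
  The next two are the unit laws, with the unit taken in an earlier stage \<open>b\<close>.  For \<open>a < b < c\<close> there
  follow functoriality of the transitions, naturality of the products, the condition that the product
  of elements of stage \<open>a\<close> formed in stage \<open>b\<close> is the one formed in stage \<open>c\<close>, and associativity for three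
  factors from stage \<open>a\<close>, whose pairwise products are available in stage \<open>b\<close>.
\<close>
definition eqns :: "'o \<Rightarrow> 'h \<Rightarrow> ('u \<Rightarrow> 'h \<times> ('u gen \<Rightarrow> 'c)) \<Rightarrow> 'u \<Rightarrow> ('u gen, 'c) eqn set" where
  "eqns X M S c = (let A = (\<lambda>b. fst (S b)); l = (\<lambda>b. snd (S b)); B = below c; P = {(a, b). b \<in> below c
      \<and> a \<in> below b} in
     (\<lambda>b. ((Unit, id1 (uO X)), (Prev b, l b Unit))) ` B \<union>
     (\<lambda>b. ((Gen, id1 M), (Prev b, l b Gen))) ` B \<union>
     (\<lambda>b. ((Prev b, lunit D (A b)), (Prod b, l b Unit \<star> id1 (A b)))) ` B \<union>
     (\<lambda>b. ((Prev b, runit D (A b)), (Prod b, id1 (A b) \<star> l b Unit))) ` B \<union>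
     (\<lambda>(a, b). ((Prev a, id1 (A a)), (Prev b, l b (Prev a)))) ` P \<union>
     (\<lambda>(a, b). ((Prod a, id1 (A a \<odot> A a)), (Prod b, l b (Prev a) \<star> l b (Prev a)))) ` P \<union>
     (\<lambda>(a, b). ((Prod a, id1 (A a \<odot> A a)), (Prev b, l b (Prod a)))) ` P \<union>
     (\<lambda>(a, b). ((Prod b, l b (Prod a) \<star> l b (Prev a)),
        (Prod b, (l b (Prev a) \<star> l b (Prod a)) \<bullet> assoc D (A a) (A a) (A a)))) ` P)"

lemma below_iff: "b \<in> below a \<longleftrightarrow> (b, a) \<in> \<mu> \<and> b \<noteq> a"
  by (auto simp: below_def)

lemma below_W: "b \<in> below a \<Longrightarrow> a \<in> W" "b \<in> below a \<Longrightarrow> b \<in> W"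
  using \<mu>_Field[of b a] by (auto simp: below_iff)

lemma below_trans: "a \<in> below b \<Longrightarrow> b \<in> below c \<Longrightarrow> a \<in> below c"
  using \<mu>_trans[of a b c] \<mu>_antisym[of a b] by (auto simp: below_iff)

lemma gobj_simps [simp]:
  "gobj X M S Unit = uO X" "gobj X M S Gen = M" "gobj X M S (Prev b) = fst (S b)"
  "gobj X M S (Prod b) = fst (S b) \<odot> fst (S b)"
  by (simp_all add: gobj_def)

lemma gens_iff: "(\<forall>i \<in> gens a. Q i) \<longleftrightarrow> Q Unit \<and> Q Gen \<and> (\<forall>b \<in> below a. Q (Prev b)) \<and> (\<forall>b \<in> below a. Q (Prod b))"
  unfolding gens_def by auto

lemma eqns_iff:
  "(\<forall>i \<phi> j \<psi>. ((i, \<phi>), (j, \<psi>)) \<in> eqns X M S c \<longrightarrow> Q i \<phi> j \<psi>) \<longleftrightarrow>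
     (\<forall>b \<in> below c. Q Unit (id1 (uO X)) (Prev b) (snd (S b) Unit) \<and>
        Q Gen (id1 M) (Prev b) (snd (S b) Gen) \<and>
        Q (Prev b) (lunit D (fst (S b))) (Prod b) (snd (S b) Unit \<star> id1 (fst (S b))) \<and>
        Q (Prev b) (runit D (fst (S b))) (Prod b) (id1 (fst (S b)) \<star> snd (S b) Unit) \<and>
        (\<forall>a \<in> below b. Q (Prev a) (id1 (fst (S a))) (Prev b) (snd (S b) (Prev a)) \<and>
           Q (Prod a) (id1 (fst (S a) \<odot> fst (S a))) (Prod b) (snd (S b) (Prev a) \<star> snd (S b) (Prev a)) \<and>
           Q (Prod a) (id1 (fst (S a) \<odot> fst (S a))) (Prev b) (snd (S b) (Prod a)) \<and>
           Q (Prod b) (snd (S b) (Prod a) \<star> snd (S b) (Prev a))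
             (Prod b) ((snd (S b) (Prev a) \<star> snd (S b) (Prod a)) \<bullet> assoc D (fst (S a)) (fst (S a)) (fst
                 (S a)))))"
  (is "?L \<longleftrightarrow> ?R")
proof -
  have *: "?L \<longleftrightarrow> (\<forall>e \<in> eqns X M S c. Q (fst (fst e)) (snd (fst e)) (fst (snd e)) (snd (snd e)))"
    by auto
  have P: "(\<forall>p \<in> {(a, b). b \<in> below c \<and> a \<in> below b}. R p) \<longleftrightarrow> (\<forall>b \<in> below c. \<forall>a \<in> below b. R (a, b))" for R
    by auto
  show ?thesis
    unfolding * unfolding eqns_def Let_def ball_Un Set.ball_simps(9) P by
        (simp add: ball_conj_distrib conj_assoc)
qed

text \<open>
  A stage depends on the earlier ones only, as the recursion over \<open>\<mu>\<close> requires.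
\<close>
lemma stage_cong:
  assumes "\<And>b. b \<in> below a \<Longrightarrow> S b = S' b"
  shows "presents X (gens a) (gobj X M S) (eqns X M S a) L l \<longleftrightarrow>
    presents X (gens a) (gobj X M S') (eqns X M S' a) L l"
proof -
  have E: "eqns X M S a = eqns X M S' a"
  proof -
    have "b \<in> below a \<Longrightarrow> c \<in> below b \<Longrightarrow> S c = S' c" for b c using assms below_trans by blast
    then show ?thesis using assms unfolding eqns_def Let_def
      by (intro arg_cong2[where f = "(\<union>)"] image_cong) auto
  qed
  have A: "gobj X M S i = gobj X M S' i" if "i \<in> gens a" for i
    using that assms unfolding gens_def by auto
  have sol: "solution (D1 D) (gens a) (gobj X M S) E C m \<longleftrightarrow> solution (D1 D) (gens a) (gobj X M S') E C m"
      for E C m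
    using A unfolding solution_def by simp
  have cl: "(\<forall>i \<in> gens a. m i \<in> cell f g (gobj X M S i) C) \<longleftrightarrow> (\<forall>i \<in> gens a. m i \<in> cell f g
      (gobj X M S' i) C)" for m f g C
    using A by simp
  show ?thesis unfolding presents_def E sol cl ..
qed

lemma small_below: "small \<kappa> (below a)"
  by (rule small_subset[OF \<mu>_small]) (auto dest: below_W)

lemma small_gens: "small \<kappa> (gens a)"
  unfolding gens_def by (intro small_Un[OF inacc] small_image small_below small_finite[OF inacc]) simp

lemma small_eqns: "small \<kappa> (eqns X M S a)"
proof -
  have "{(c, b). b \<in> below a \<and> c \<in> below b} \<subseteq> W \<times> W" using below_W by auto
  then have "small \<kappa> {(c, b). b \<in> below a \<and> c \<in> below b}"
    using small_subset[OF small_Times[OF inacc \<mu>_small \<mu>_small]] by blast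
  then show ?thesis
    unfolding eqns_def Let_def by (intro small_Un[OF inacc] small_image small_below)
qed

lemma stage_legs:
  assumes S: "presents X (gens b) (gobj X M S) (eqns X M S b) (fst (S b)) (snd (S b))"
    and X: "X \<in> Obj (D0 D)"
  shows "fst (S b) \<in> Obj1" "sO (fst (S b)) = X" "tO (fst (S b)) = X"
    and "snd (S b) Unit \<in> glob X (uO X) (fst (S b))"
    and "snd (S b) Gen \<in> glob X M (fst (S b))"
    and "a \<in> below b \<Longrightarrow> snd (S b) (Prev a) \<in> glob X (fst (S a)) (fst (S b))"
    and "a \<in> below b \<Longrightarrow> snd (S b) (Prod a) \<in> glob X (fst (S a) \<odot> fst (S a)) (fst (S b))"
proof -
  have "\<forall>i \<in> gens b. snd (S b) i \<in> glob X (gobj X M S i) (fst (S b))"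
    using S unfolding presents_def by blast
  then show u: "snd (S b) Unit \<in> glob X (uO X) (fst (S b))"
    and "snd (S b) Gen \<in> glob X M (fst (S b))"
    and "a \<in> below b \<Longrightarrow> snd (S b) (Prev a) \<in> glob X (fst (S a)) (fst (S b))"
    and "a \<in> below b \<Longrightarrow> snd (S b) (Prod a) \<in> glob X (fst (S a) \<odot> fst (S a)) (fst (S b))"
    unfolding gens_iff by simp_all
  show "fst (S b) \<in> Obj1" using S unfolding presents_def by blast
  show "sO (fst (S b)) = X" "tO (fst (S b)) = X"
    using u arr_ends[of "snd (S b) Unit"] X by (auto simp: cell_iff)
qed

lemma stages_exist:
  assumes X: "X \<in> Obj (D0 D)" and M: "M \<in> Obj1" "sO M = X" "tO M = X"
  shows "\<exists>S. \<forall>a \<in> W. presents X (gens a) (gobj X M S) (eqns X M S a) (fst (S a)) (snd (S a))"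
proof -
  define P where "P S a r \<longleftrightarrow> (a \<in> W \<longrightarrow> presents X (gens a) (gobj X M S) (eqns X M S a) (fst r) (snd r))"
    for S a and r :: "'h \<times> ('u gen \<Rightarrow> 'c)"
  have "\<exists>S. \<forall>a. P S a (S a)"
  proof (rule dependent_wf_choice[OF \<mu>_wf])
    show "P S a r = P S' a r" if "\<And>b. (b, a) \<in> \<mu> - Id \<Longrightarrow> S b = S' b" for S S' a r
      unfolding P_def using stage_cong[of a S S'] that by (simp add: below_def)
  next
    fix c S assume IH: "\<And>b. (b, c) \<in> \<mu> - Id \<Longrightarrow> P S b (S b)"
    have st: "presents X (gens b) (gobj X M S) (eqns X M S b) (fst (S b)) (snd (S b))" if "b \<in> below c" for b
      using IH[of b] that below_W[OF that] by (simp add: P_def below_def)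
    note legs = stage_legs[OF st X]
    note [simp] = legs[unfolded cell_iff] X M below_trans[of _ _ c]
    have pres: "presentation (D1 D) (gens c) (gobj X M S) (eqns X M S c)"
      unfolding presentation_def eqns_iff gens_iff by (auto simp: gens_def)
    have bd: "\<forall>i \<in> gens c. sO (gobj X M S i) = X \<and> tO (gobj X M S i) = X"
      unfolding gens_iff by simp
    have gl: "\<forall>i \<phi> j \<psi>. ((i, \<phi>), (j, \<psi>)) \<in> eqns X M S c \<longrightarrow> sA \<phi> = id0 X \<and> tA \<phi> = id0 X \<and> sA \<psi> = id0 X
        \<and> tA \<psi> = id0 X"
      unfolding eqns_iff by auto
    have un: "Unit \<in> gens c" by (simp add: gens_def)
    obtain L l where "presents X (gens c) (gobj X M S) (eqns X M S c) L l"
      by (rule presented_cell_exists[OF X pres small_gens small_eqns un]) (use bd gl in blast)+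
    then show "\<exists>r. P S c r" unfolding P_def by (intro exI[of _ "(L, l)"]) simp
  qed
  then show ?thesis unfolding P_def by blast
qed

end

section \<open>Monads evaluated on generalized elements\<close>
locale monad_at = double_category D for D :: "('o, 'v, 'h, 'c) dblcat" (structure) +
  fixes N :: "('h, 'c) mnd"
  assumes monad: "is_monad D N"
begin

abbreviation "B \<equiv> carr N"
abbreviation "Y \<equiv> sO B"
abbreviation "sq \<beta> \<equiv> mult N \<bullet> (\<beta> \<star> \<beta>)"

lemma monad_simps [simp]:
  "B \<in> Obj1" "tO B = Y" "Y \<in> Obj (D0 D)"
  "mult N \<in> Arr1" "Dom1 (mult N) = B \<odot> B" "Cod1 (mult N) = B"
  "sA (mult N) = id0 Y" "tA (mult N) = id0 Y"
  "unit N \<in> Arr1" "Dom1 (unit N) = uO Y" "Cod1 (unit N) = B"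
  "sA (unit N) = id0 Y" "tA (unit N) = id0 Y"
proof -
  show B: "B \<in> Obj1" "tO B = Y" and m: "mult N \<in> Arr1" "Dom1 (mult N) = B \<odot> B" "Cod1 (mult N) = B"
    and u: "unit N \<in> Arr1" "Dom1 (unit N) = uO Y" "Cod1 (unit N) = B"
    using monad by (auto simp: is_monad_def Let_def End_cat_def subcat_def Hom_iff)
  then show Y: "Y \<in> Obj (D0 D)" by simp
  have g: "globular D (mult N)" "globular D (unit N)" using monad by (auto simp: is_monad_def Let_def)
  show "sA (mult N) = id0 Y" "tA (mult N) = id0 Y"
    by (rule globular_ends[OF g(1)]; use B m in simp)+
  show "sA (unit N) = id0 Y" "tA (unit N) = id0 Y"
    by (rule globular_ends[OF g(2)]; use u Y in simp)+
qed

lemma monad_laws: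
  "mult N \<bullet> (mult N \<star> id1 B) = mult N \<bullet> (id1 B \<star> mult N) \<bullet> assoc D B B B"
  "mult N \<bullet> (unit N \<star> id1 B) = lunit D B"
  "mult N \<bullet> (id1 B \<star> unit N) = runit D B"
  using monad by (auto simp: is_monad_def Let_def)

text \<open>
  The monad laws are used for 2-cells \<open>\<beta>\<close> over \<open>f\<close> into the carrier, such as the legs of a cocone; naturality
  of the structural isomorphisms turns the laws into equations between composites with \<open>\<beta>\<close>.
\<close>
lemma mult_unit_left:
  assumes "\<beta> \<in> cell f f A B" 
  shows "mult N \<bullet> ((unit N \<bullet> uA f) \<star> \<beta>) = \<beta> \<bullet> lunit D A"
proof -
  have b [simp]: "\<beta> \<in> Arr1" "Dom1 \<beta> = A" "Cod1 \<beta> = B" "sA \<beta> = f" "tA \<beta> = f"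
    using assms by (auto simp: cell_iff)
  have f [simp]: "f \<in> Arr (D0 D)" "Cod (D0 D) f = Y"
    using is_functorD(5)[OF src_functor b(1)] arr_ends[OF b(1)] by auto
  have "(unit N \<bullet> uA f) \<star> \<beta> = (unit N \<star> id1 B) \<bullet> (uA f \<star> \<beta>)"
    by (subst interchange) simp_all
  then have "mult N \<bullet> ((unit N \<bullet> uA f) \<star> \<beta>) = (mult N \<bullet> (unit N \<star> id1 B)) \<bullet> (uA f \<star> \<beta>)"
    by (simp add: D1.assoc_comp)
  then show ?thesis using lunit_natural[OF b(1)] by (simp add: monad_laws)
qed

lemma mult_unit_right:
  assumes "\<beta> \<in> cell f f A B" 
  shows "mult N \<bullet> (\<beta> \<star> (unit N \<bullet> uA f)) = \<beta> \<bullet> runit D A"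
proof -
  have b [simp]: "\<beta> \<in> Arr1" "Dom1 \<beta> = A" "Cod1 \<beta> = B" "sA \<beta> = f" "tA \<beta> = f"
    using assms by (auto simp: cell_iff)
  have f [simp]: "f \<in> Arr (D0 D)" "Cod (D0 D) f = Y"
    using is_functorD(5)[OF src_functor b(1)] arr_ends[OF b(1)] by auto
  have "\<beta> \<star> (unit N \<bullet> uA f) = (id1 B \<star> unit N) \<bullet> (\<beta> \<star> uA f)"
    by (subst interchange) simp_all
  then have "mult N \<bullet> (\<beta> \<star> (unit N \<bullet> uA f)) = (mult N \<bullet> (id1 B \<star> unit N)) \<bullet> (\<beta> \<star> uA f)"
    by (simp add: D1.assoc_comp)
  then show ?thesis using runit_natural[OF b(1)] by (simp add: monad_laws)
qed

lemma mult_assoc: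
  assumes "\<beta> \<in> cell f f A B"
  shows "mult N \<bullet> (sq \<beta> \<star> \<beta>) = mult N \<bullet> (\<beta> \<star> sq \<beta>) \<bullet> assoc D A A A"
proof -
  have b [simp]: "\<beta> \<in> Arr1" "Dom1 \<beta> = A" "Cod1 \<beta> = B" "sA \<beta> = f" "tA \<beta> = f"
    using assms by (auto simp: cell_iff)
  have f [simp]: "f \<in> Arr (D0 D)" "Cod (D0 D) f = Y"
    using is_functorD(5)[OF src_functor b(1)] arr_ends[OF b(1)] by auto
  have A [simp]: "A \<in> Obj1" "sO A = Dom (D0 D) f" "tO A = Dom (D0 D) f"
    using arr_ends[OF b(1)] D1.dom_Obj[OF b(1)] by auto
  have "sq \<beta> \<star> \<beta> = (mult N \<star> id1 B) \<bullet> ((\<beta> \<star> \<beta>) \<star> \<beta>)"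
    by (subst interchange) simp_all
  then have "mult N \<bullet> (sq \<beta> \<star> \<beta>) = (mult N \<bullet> (mult N \<star> id1 B)) \<bullet> ((\<beta> \<star> \<beta>) \<star> \<beta>)"
    by (simp add: D1.assoc_comp)
  also have "\<dots> = mult N \<bullet> ((id1 B \<star> mult N) \<bullet> (assoc D B B B \<bullet> ((\<beta> \<star> \<beta>) \<star> \<beta>)))"
    by (simp add: monad_laws(1) D1.assoc_comp)
  also have "assoc D B B B \<bullet> ((\<beta> \<star> \<beta>) \<star> \<beta>) = (\<beta> \<star> (\<beta> \<star> \<beta>)) \<bullet> assoc D A A A"
    using assoc_natural[of \<beta> \<beta> \<beta>] by (simp add: composable2_def)
  also have "(id1 B \<star> mult N) \<bullet> ((\<beta> \<star> (\<beta> \<star> \<beta>)) \<bullet> assoc D A A A) = ((id1 B \<star> mult N) \<bullet> (\<beta> \<star>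
      (\<beta> \<star> \<beta>))) \<bullet> assoc D A A A"
    by (simp add: D1.assoc_comp)
  also have "(id1 B \<star> mult N) \<bullet> (\<beta> \<star> (\<beta> \<star> \<beta>)) = \<beta> \<star> sq \<beta>"
    by (simp add: interchange)
  finally show ?thesis by (simp add: D1.assoc_comp)
qed

end

section \<open>The free monad as the colimit of the stages\<close>
locale free_monad_stages = presentable_dbl D \<kappa> \<mu>
  for D :: "('o, 'v, 'h, 'c) dblcat" (structure) and \<kappa> \<mu> :: "'u rel" +
  fixes X :: 'o and M :: 'h and S :: "'u \<Rightarrow> 'h \<times> ('u gen \<Rightarrow> 'c)"
  assumes X [simp]: "X \<in> Obj (D0 D)" and M [simp]: "M \<in> Obj1" "sO M = X" "tO M = X"
    and stage: "a \<in> W \<Longrightarrow> presents X (gens a) (gobj X M S) (eqns X M S a) (fst (S a)) (snd (S a))"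
begin

text \<open>
  Object, unit, inclusion of \<open>M\<close>, transitions and products of the stages.  The stages only provide
  transitions between different indices, to which the identities are added.
\<close>
definition "ob a = fst (S a)"
definition "un a = snd (S a) Unit"
definition "gn a = snd (S a) Gen"
definition "tr a b = (if a = b then id1 (ob a) else snd (S b) (Prev a))"
definition "pr a b = snd (S b) (Prod a)"

lemma tr_below: "a \<in> below b \<Longrightarrow> snd (S b) (Prev a) = tr a b"
  by (auto simp: tr_def below_iff)

lemma stage_simps [simp]:
  assumes "a \<in> W"
  shows "ob a \<in> Obj1" "sO (ob a) = X" "tO (ob a) = X"
    "un a \<in> Arr1" "Dom1 (un a) = uO X" "Cod1 (un a) = ob a" "sA (un a) = id0 X" "tA (un a) = id0 X"
    "gn a \<in> Arr1" "Dom1 (gn a) = M" "Cod1 (gn a) = ob a" "sA (gn a) = id0 X" "tA (gn a) = id0 X"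
  using stage_legs(1-5)[OF stage[OF assms] X] by (auto simp: ob_def un_def gn_def cell_iff)

lemma below_simps [simp]:
  assumes "a \<in> below b"
  shows "tr a b \<in> Arr1" "Dom1 (tr a b) = ob a" "Cod1 (tr a b) = ob b" "sA (tr a b) = id0 X" "tA (tr a b)
      = id0 X"
    "pr a b \<in> Arr1" "Dom1 (pr a b) = ob a \<odot> ob a" "Cod1 (pr a b) = ob b" "sA (pr a b) = id0 X" "tA
        (pr a b) = id0 X"
  using stage_legs(6,7)[OF stage[OF below_W(1)[OF assms]] X assms] tr_below[OF assms]
  by (auto simp: ob_def pr_def cell_iff)

lemma stage_eqns:
  assumes "b \<in> below c"
  shows "un c = tr b c \<bullet> un b" "gn c = tr b c \<bullet> gn b"
    "pr b c \<bullet> (un b \<star> id1 (ob b)) = tr b c \<bullet> lunit D (ob b)"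
    "pr b c \<bullet> (id1 (ob b) \<star> un b) = tr b c \<bullet> runit D (ob b)"
    and "a \<in> below b \<Longrightarrow> tr a c = tr b c \<bullet> tr a b"
    and "a \<in> below b \<Longrightarrow> pr a c = pr b c \<bullet> (tr a b \<star> tr a b)"
    and "a \<in> below b \<Longrightarrow> pr a c = tr b c \<bullet> pr a b"
    and "a \<in> below b \<Longrightarrow> pr b c \<bullet> (pr a b \<star> tr a b) = pr b c \<bullet> ((tr a b \<star> pr a b) \<bullet> assoc D (ob a) (ob a) (ob a))"
proof -
  have W [simp]: "b \<in> W" "c \<in> W" using below_W assms by auto
  have aW: "a \<in> W" "a \<in> below c" if "a \<in> below b" for a using below_W that below_trans assms by blast+
  have "solution (D1 D) (gens c) (gobj X M S) (eqns X M S c) (fst (S c)) (snd (S c))"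
    using stage[OF W(2)] unfolding presents_def by blast
  then have "\<forall>i \<phi> j \<psi>. ((i, \<phi>), (j, \<psi>)) \<in> eqns X M S c \<longrightarrow> snd (S c) i \<bullet> \<phi> = snd (S c) j \<bullet> \<psi>"
    unfolding solution_def by blast
  note E = this[unfolded eqns_iff, rule_format, OF assms]
  have E1: "un c \<bullet> id1 (uO X) = tr b c \<bullet> un b" "gn c \<bullet> id1 M = tr b c \<bullet> gn b"
    "tr b c \<bullet> lunit D (ob b) = pr b c \<bullet> (un b \<star> id1 (ob b))"
    "tr b c \<bullet> runit D (ob b) = pr b c \<bullet> (id1 (ob b) \<star> un b)"
    using E tr_below[OF assms] by (simp_all add: un_def gn_def pr_def ob_def)
  then show "un c = tr b c \<bullet> un b" "gn c = tr b c \<bullet> gn b"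
    "pr b c \<bullet> (un b \<star> id1 (ob b)) = tr b c \<bullet> lunit D (ob b)"
    "pr b c \<bullet> (id1 (ob b) \<star> un b) = tr b c \<bullet> runit D (ob b)" by simp_all
  assume a: "a \<in> below b"
  have "tr a c \<bullet> id1 (ob a) = tr b c \<bullet> tr a b" "pr a c \<bullet> id1 (ob a \<odot> ob a) = pr b c \<bullet> (tr a b \<star> tr a b)"
    "pr a c \<bullet> id1 (ob a \<odot> ob a) = tr b c \<bullet> pr a b"
    "pr b c \<bullet> (pr a b \<star> tr a b) = pr b c \<bullet> ((tr a b \<star> pr a b) \<bullet> assoc D (ob a) (ob a) (ob a))"
    using E[THEN conjunct2, THEN conjunct2, THEN conjunct2, THEN conjunct2, THEN bspec, OF a]
    unfolding tr_below[OF assms] tr_below[OF a] tr_below[OF aW(2)[OF a]] pr_def ob_def by blast+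
  then show "tr a c = tr b c \<bullet> tr a b" "pr a c = pr b c \<bullet> (tr a b \<star> tr a b)"
    "pr a c = tr b c \<bullet> pr a b"
    "pr b c \<bullet> (pr a b \<star> tr a b) = pr b c \<bullet> ((tr a b \<star> pr a b) \<bullet> assoc D (ob a) (ob a) (ob a))"
    using a aW[OF a] by simp_all
qed

text \<open>
  The legs of a stage are jointly epic: composing them with \<open>h\<close> gives a solution of the equations of
  the stage, through which both \<open>h\<close> and \<open>h'\<close> factor.
\<close>
lemma stage_eqI:
  assumes c: "c \<in> W" and h: "h \<in> Arr1" "Dom1 h = ob c" "h' \<in> Arr1" "Dom1 h' = ob c"
      "Cod1 h = Cod1 h'"
    and eq: "h \<bullet> un c = h' \<bullet> un c" "h \<bullet> gn c = h' \<bullet> gn c"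
      "\<And>b. b \<in> below c \<Longrightarrow> h \<bullet> tr b c = h' \<bullet> tr b c" "\<And>b. b \<in> below c \<Longrightarrow> h \<bullet> pr b c = h' \<bullet> pr b c"
  shows "h = h'"
proof -
  let ?l = "snd (S c)"
  have P: "presents X (gens c) (gobj X M S) (eqns X M S c) (ob c) ?l" using stage[OF c] by (simp add: ob_def)
  have lc: "\<forall>i \<in> gens c. ?l i \<in> glob X (gobj X M S i) (ob c)"
    and sol: "solution (D1 D) (gens c) (gobj X M S) (eqns X M S c) (ob c) ?l"
    using P unfolding presents_def by blast+
  have hX: "Dom (D0 D) (sA h) = X" "Dom (D0 D) (tA h) = X" using arr_ends[OF h(1)] h(2) c by simp_all
  have hl: "\<forall>i \<in> gens c. h \<bullet> ?l i \<in> cell (sA h) (tA h) (gobj X M S i) (Cod1 h)"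
    using lc h hX by (auto simp: cell_iff)
  have "solution (D1 D) (gens c) (gobj X M S) (eqns X M S c) (Cod1 h) (\<lambda>i. h \<bullet> ?l i)"
    unfolding solution_def
  proof (intro conjI)
    show "Cod1 h \<in> Obj1" using h by simp
    show "\<forall>i \<in> gens c. h \<bullet> ?l i \<in> Hom1 (gobj X M S i) (Cod1 h)" using hl by (simp add: cell_def)
    have "h \<bullet> ?l i \<bullet> \<phi> = h \<bullet> ?l j \<bullet> \<psi>" if e: "((i, \<phi>), (j, \<psi>)) \<in> eqns X M S c"
        and ij: "i \<in> gens c" "j \<in> gens c" "\<phi> \<in> Arr1" "\<psi> \<in> Arr1" "Cod1 \<phi> = gobj X M S i" "Cod1 \<psi> = gobj X M S j"
      for i \<phi> j \<psi>
    proof -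
      have "?l i \<bullet> \<phi> = ?l j \<bullet> \<psi>" using sol e unfolding solution_def by blast
      then show ?thesis using lc[rule_format, OF ij(1)] lc[rule_format, OF ij(2)] ij h
        by (simp add: D1.assoc_comp cell_iff)
    qed
    moreover have "\<forall>i \<phi> j \<psi>. ((i, \<phi>), (j, \<psi>)) \<in> eqns X M S c \<longrightarrow> i \<in> gens c \<and> j \<in> gens c \<and> \<phi> \<in> Arr1 \<and> \<psi> \<in> Arr1 \<and>
        Cod1 \<phi> = gobj X M S i \<and> Cod1 \<psi> = gobj X M S j"
    proof -
      have "b \<in> below c \<Longrightarrow> a \<in> below b \<Longrightarrow> a \<in> below c" for a b by (rule below_trans)
      moreover have bW: "b \<in> below c \<Longrightarrow> b \<in> W" for b using below_W by blast
      moreover have aW: "b \<in> below c \<Longrightarrow> a \<in> below b \<Longrightarrow> a \<in> W" for a b using below_W by blast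
      ultimately show ?thesis
        unfolding eqns_iff
        by (auto simp: gens_def tr_below ob_def[symmetric] un_def[symmetric] gn_def[symmetric] pr_def[symmetric])
    qed
    ultimately show "\<forall>i \<phi> j \<psi>. ((i, \<phi>), (j, \<psi>)) \<in> eqns X M S c \<longrightarrow> h \<bullet> ?l i \<bullet> \<phi> = h \<bullet> ?l j \<bullet> \<psi>" by blast
  qed
  then have "\<exists>!k. k \<in> Hom1 (ob c) (Cod1 h) \<and> (\<forall>i \<in> gens c. k \<bullet> ?l i = h \<bullet> ?l i)"
    using P hl unfolding presents_def by blast
  moreover have "\<forall>i \<in> gens c. h' \<bullet> ?l i = h \<bullet> ?l i"
    unfolding gens_iff using eq tr_below by (simp add: un_def gn_def pr_def)
  moreover have "h \<in> Hom1 (ob c) (Cod1 h)" "h' \<in> Hom1 (ob c) (Cod1 h)"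
    using h by (simp_all add: Hom_iff)
  ultimately show ?thesis by metis
qed

lemma chain_stages: "chain X ob tr"
  unfolding chain_def
proof (intro conjI ballI allI impI)
  fix a assume "a \<in> W"
  then show "ob a \<in> Obj1" "sO (ob a) = X" "tO (ob a) = X" "tr a a = id1 (ob a)" by (simp_all add: tr_def)
next
  fix a b assume ab: "(a, b) \<in> \<mu>"
  then have "a \<in> W" using \<mu>_Field by blast
  then show "tr a b \<in> glob X (ob a) (ob b)"
    using ab below_simps[of a b] by (cases "a = b") (auto simp: cell_iff tr_def below_iff)
next
  fix a b c assume abc: "(a, b) \<in> \<mu> \<and> (b, c) \<in> \<mu>"
  then have W: "a \<in> W" "b \<in> W" "c \<in> W" using \<mu>_Field by blast+
  consider "a = b" | "b = c" | "a \<in> below b" "b \<in> below c" using abc by (auto simp: below_iff)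
  then show "tr b c \<bullet> tr a b = tr a c"
  proof cases
    case 1
    have "tr b c \<bullet> id1 (ob b) = tr b c"
      using W below_simps[of b c] abc by (cases "b = c") (auto simp: tr_def below_iff)
    then show ?thesis using 1 by (simp add: tr_def)
  next
    case 2
    have "id1 (ob b) \<bullet> tr a b = tr a b"
      using W below_simps[of a b] abc by (cases "a = b") (auto simp: tr_def below_iff)
    then show ?thesis using 2 by (simp add: tr_def)
  next
    case 3
    then show ?thesis using stage_eqns(5)[of b c a] by simp
  qed
qed simp

definition "colim = (SOME p. chain_colimit X ob tr (fst p) (snd p))"
definition "T = fst colim"
definition "inc = snd colim"

lemma colim: "chain_colimit X ob tr T inc"
proof -
  obtain L l where "chain_colimit X ob tr L l" using chain_colimit_exists[OF chain_stages] by blast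
  then have "\<exists>p. chain_colimit X ob tr (fst p) (snd p)" by (intro exI[of _ "(L, l)"]) simp
  then show ?thesis unfolding T_def inc_def colim_def by (rule someI_ex)
qed

lemma T_simps [simp]: "T \<in> Obj1" "sO T = X" "tO T = X"
  using chain_coconeD(1)[OF chain_colimitD(2)[OF colim]] chain_colimitD(5,6)[OF colim] by auto

lemma inc_simps [simp]:
  assumes "a \<in> W"
  shows "inc a \<in> Arr1" "Dom1 (inc a) = ob a" "Cod1 (inc a) = T" "sA (inc a) = id0 X" "tA (inc a) = id0 X"
  using chain_coconeD(2-4)[OF chain_colimitD(2)[OF colim] assms] chain_colimitD(3,4)[OF colim assms] by auto

lemma inc_tr: "a \<in> below b \<Longrightarrow> inc b \<bullet> tr a b = inc a"
  using chain_coconeD(5)[OF chain_colimitD(2)[OF colim]] by (simp add: below_iff)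

lemma colim_TT: "chain_colimit X (\<lambda>a. ob a \<odot> ob a) (\<lambda>a b. tr a b \<star> tr a b) (T \<odot> T) (\<lambda>a. inc a \<star> inc a)"
  by (rule diagonal_chain_colimit[OF colim colim])

lemma colim_TTT: "chain_colimit X (\<lambda>a. ob a \<odot> ob a \<odot> ob a) (\<lambda>a b. (tr a b \<star> tr a b) \<star> tr a b)
    (T \<odot> T \<odot> T) (\<lambda>a. (inc a \<star> inc a) \<star> inc a)"
  by (rule diagonal_chain_colimit[OF colim_TT colim])

lemma above: "a \<in> W \<Longrightarrow> \<exists>b. b \<in> W \<and> a \<in> below b"
  using \<mu>_succ[of a] \<mu>_Field by (auto simp: below_iff)

text \<open>
  The product of two elements of stage \<open>a\<close> is formed in a later stage, and it does not matter in which.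
\<close>
definition "p a = inc (SOME b. a \<in> below b) \<bullet> pr a (SOME b. a \<in> below b)"

lemma p_eq:
  assumes a: "a \<in> below b"
  shows "p a = inc b \<bullet> pr a b"
proof -
  have mono: "inc b \<bullet> pr a b = inc c \<bullet> pr a c" if "a \<in> below b" "b \<in> below c" for b c
  proof -
    have W: "b \<in> W" "c \<in> W" using that below_W by blast+
    have "inc b \<bullet> pr a b = (inc c \<bullet> tr b c) \<bullet> pr a b" using that inc_tr by simp
    also have "\<dots> = inc c \<bullet> (tr b c \<bullet> pr a b)" using that W by (intro D1.assoc_comp) simp_all
    finally show ?thesis using that stage_eqns(7)[of b c a] by simp
  qed
  define c where "c = (SOME b. a \<in> below b)"
  have c: "a \<in> below c" unfolding c_def using a by (rule someI)
  have "b = c \<or> b \<in> below c \<or> c \<in> below b"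
    using \<mu>_total[of b c] below_W[OF a] below_W[OF c] by (auto simp: below_iff)
  then show ?thesis using mono[of b c] mono[of c b] a c by (auto simp: p_def c_def[symmetric])
qed

lemma p_simps [simp]:
  assumes "a \<in> W"
  shows "p a \<in> Arr1" "Dom1 (p a) = ob a \<odot> ob a" "Cod1 (p a) = T" "sA (p a) = id0 X" "tA (p a) = id0 X"
proof -
  obtain b where "b \<in> W" "a \<in> below b" using above[OF assms] by blast
  then show "p a \<in> Arr1" "Dom1 (p a) = ob a \<odot> ob a" "Cod1 (p a) = T" "sA (p a) = id0 X" "tA (p a) = id0 X"
    using p_eq by simp_all
qed

lemma p_cocone: "chain_cocone (\<lambda>a. ob a \<odot> ob a) (\<lambda>a b. tr a b \<star> tr a b) T p"
  unfolding chain_cocone_def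
proof (intro conjI ballI allI impI)
  show "a \<in> W \<Longrightarrow> p a \<in> Hom1 (ob a \<odot> ob a) T" for a by (simp add: Hom_iff)
  fix a b assume ab: "(a, b) \<in> \<mu>"
  then have W: "a \<in> W" "b \<in> W" using \<mu>_Field by blast+
  show "p b \<bullet> (tr a b \<star> tr a b) = p a"
  proof (cases "a = b")
    case True
    then show ?thesis using W by (simp add: tr_def)
  next
    case False
    then have ab: "a \<in> below b" using ab by (simp add: below_iff)
    obtain c where c: "c \<in> W" "b \<in> below c" using above[OF W(2)] by blast
    have "p b \<bullet> (tr a b \<star> tr a b) = inc c \<bullet> (pr b c \<bullet> (tr a b \<star> tr a b))"
      unfolding p_eq[OF c(2)] using W ab c by (intro D1.assoc_comp) simp_all
    then show ?thesis using stage_eqns(6)[OF c(2) ab] p_eq[OF below_trans[OF ab c(2)]] by simp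
  qed
qed simp

definition "mu = (THE h. h \<in> Hom1 (T \<odot> T) T \<and> (\<forall>a \<in> W. h \<bullet> (inc a \<star> inc a) = p a))"
definition "eta = inc (SOME a. a \<in> W) \<bullet> un (SOME a. a \<in> W)"
definition "gen = inc (SOME a. a \<in> W) \<bullet> gn (SOME a. a \<in> W)"
definition "free = \<lparr>carr = T, mult = mu, unit = eta\<rparr>"

lemma mu: "mu \<in> Hom1 (T \<odot> T) T" "a \<in> W \<Longrightarrow> mu \<bullet> (inc a \<star> inc a) = p a"
  using theI'[OF chain_colimitD(7)[OF colim_TT p_cocone]] unfolding mu_def by blast+

lemma some_W: "(SOME a. a \<in> W) \<in> W"
  using \<mu>_nonempty by (rule someI_ex)

lemma mu_simps [simp]:
  "mu \<in> Arr1" "Dom1 mu = T \<odot> T" "Cod1 mu = T" "sA mu = id0 X" "tA mu = id0 X"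
proof -
  show m: "mu \<in> Arr1" "Dom1 mu = T \<odot> T" "Cod1 mu = T" using mu by (auto simp: Hom_iff)
  have e: "Dom (D0 D) (sA mu) = X" "Dom (D0 D) (tA mu) = X" using arr_ends[OF m(1)] m by simp_all
  have "sA (mu \<bullet> (inc (SOME a. a \<in> W) \<star> inc (SOME a. a \<in> W))) = id0 X"
    "tA (mu \<bullet> (inc (SOME a. a \<in> W) \<star> inc (SOME a. a \<in> W))) = id0 X"
    using mu(2)[OF some_W] some_W by simp_all
  then show "sA mu = id0 X" "tA mu = id0 X" using m e some_W by simp_all
qed

lemma eta: "a \<in> W \<Longrightarrow> eta = inc a \<bullet> un a" and gen: "a \<in> W \<Longrightarrow> gen = inc a \<bullet> gn a"
proof -
  have mono: "inc a \<bullet> un a = inc b \<bullet> un b \<and> inc a \<bullet> gn a = inc b \<bullet> gn b" if ab: "a \<in> below b" for a b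
  proof -
    have W: "a \<in> W" "b \<in> W" using ab below_W by blast+
    have "(inc b \<bullet> tr a b) \<bullet> un a = inc b \<bullet> (tr a b \<bullet> un a)" "(inc b \<bullet> tr a b) \<bullet> gn a = inc b \<bullet> (tr a b \<bullet> gn a)"
      using ab W by (intro D1.assoc_comp; simp)+
    then show ?thesis using inc_tr[OF ab] stage_eqns(1,2)[OF ab] by simp
  qed
  have "a = b \<or> a \<in> below b \<or> b \<in> below a" if "a \<in> W" "b \<in> W" for a b
    using \<mu>_total[OF that] by (auto simp: below_iff)
  then show "a \<in> W \<Longrightarrow> eta = inc a \<bullet> un a" "a \<in> W \<Longrightarrow> gen = inc a \<bullet> gn a"
    unfolding eta_def gen_def using mono some_W by metis+
qed

lemma eta_simps [simp]:
  "eta \<in> Arr1" "Dom1 eta = uO X" "Cod1 eta = T" "sA eta = id0 X" "tA eta = id0 X"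
  "gen \<in> Arr1" "Dom1 gen = M" "Cod1 gen = T" "sA gen = id0 X" "tA gen = id0 X"
  using some_W by (simp_all add: eta_def gen_def)

lemma mu_pair:
  assumes "a \<in> W" "\<alpha> \<in> Arr1" "\<beta> \<in> Arr1" "Cod1 \<alpha> = ob a" "Cod1 \<beta> = ob a" "sA \<alpha> = tA \<beta>"
  shows "mu \<bullet> ((inc a \<bullet> \<alpha>) \<star> (inc a \<bullet> \<beta>)) = p a \<bullet> (\<alpha> \<star> \<beta>)"
proof -
  have "(inc a \<bullet> \<alpha>) \<star> (inc a \<bullet> \<beta>) = (inc a \<star> inc a) \<bullet> (\<alpha> \<star> \<beta>)"
    using assms by (simp add: interchange)
  then have "mu \<bullet> ((inc a \<bullet> \<alpha>) \<star> (inc a \<bullet> \<beta>)) = (mu \<bullet> (inc a \<star> inc a)) \<bullet> (\<alpha> \<star> \<beta>)"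
    using assms by (simp add: D1.assoc_comp)
  then show ?thesis using mu(2)[OF assms(1)] by simp
qed

lemma mu_unit_left: "mu \<bullet> (eta \<star> id1 T) = lunit D T"
proof (rule chain_colimit_eqI[OF left_tensor_chain_colimit[OF colim, of "uO X"]])
  fix a assume a: "a \<in> W"
  obtain b where b: "b \<in> W" "a \<in> below b" using above[OF a] by blast
  have "(mu \<bullet> (eta \<star> id1 T)) \<bullet> (id1 (uO X) \<star> inc a) = mu \<bullet> ((eta \<star> id1 T) \<bullet> (id1 (uO X) \<star> inc a))"
    using a by (intro D1.assoc_comp) simp_all
  also have "(eta \<star> id1 T) \<bullet> (id1 (uO X) \<star> inc a) = (inc a \<bullet> un a) \<star> (inc a \<bullet> id1 (ob a))"
    using a eta[OF a] by (simp add: interchange)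
  also have "mu \<bullet> \<dots> = p a \<bullet> (un a \<star> id1 (ob a))"
    using a by (intro mu_pair) simp_all
  also have "\<dots> = inc b \<bullet> (pr a b \<bullet> (un a \<star> id1 (ob a)))"
    unfolding p_eq[OF b(2)] using a b by (intro D1.assoc_comp) simp_all
  also have "\<dots> = (inc b \<bullet> tr a b) \<bullet> lunit D (ob a)"
    using a b stage_eqns(3)[OF b(2)] by (simp add: D1.assoc_comp)
  also have "\<dots> = lunit D T \<bullet> (id1 (uO X) \<star> inc a)"
    using a lunit_natural[of "inc a"] inc_tr[OF b(2)] by simp
  finally show "(mu \<bullet> (eta \<star> id1 T)) \<bullet> (id1 (uO X) \<star> inc a) = lunit D T \<bullet> (id1 (uO X) \<star> inc a)" .
qed simp_all

lemma mu_unit_right: "mu \<bullet> (id1 T \<star> eta) = runit D T"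
proof (rule chain_colimit_eqI[OF right_tensor_chain_colimit[OF colim, of "uO X"]])
  fix a assume a: "a \<in> W"
  obtain b where b: "b \<in> W" "a \<in> below b" using above[OF a] by blast
  have "(mu \<bullet> (id1 T \<star> eta)) \<bullet> (inc a \<star> id1 (uO X)) = mu \<bullet> ((id1 T \<star> eta) \<bullet> (inc a \<star> id1 (uO X)))"
    using a by (intro D1.assoc_comp) simp_all
  also have "(id1 T \<star> eta) \<bullet> (inc a \<star> id1 (uO X)) = (inc a \<bullet> id1 (ob a)) \<star> (inc a \<bullet> un a)"
    using a eta[OF a] by (simp add: interchange)
  also have "mu \<bullet> \<dots> = p a \<bullet> (id1 (ob a) \<star> un a)"
    using a by (intro mu_pair) simp_all
  also have "\<dots> = inc b \<bullet> (pr a b \<bullet> (id1 (ob a) \<star> un a))"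
    unfolding p_eq[OF b(2)] using a b by (intro D1.assoc_comp) simp_all
  also have "\<dots> = (inc b \<bullet> tr a b) \<bullet> runit D (ob a)"
    using a b stage_eqns(4)[OF b(2)] by (simp add: D1.assoc_comp)
  also have "\<dots> = runit D T \<bullet> (inc a \<star> id1 (uO X))"
    using a runit_natural[of "inc a"] inc_tr[OF b(2)] by simp
  finally show "(mu \<bullet> (id1 T \<star> eta)) \<bullet> (inc a \<star> id1 (uO X)) = runit D T \<bullet> (inc a \<star> id1 (uO X))" .
qed simp_all

text \<open>
  On elements of stage \<open>a\<close>, both sides are formed in a stage \<open>c\<close> above some stage \<open>b\<close> above \<open>a\<close>, where their
  equality is one of the defining equations.
\<close>
lemma mu_assoc: "mu \<bullet> (mu \<star> id1 T) = mu \<bullet> (id1 T \<star> mu) \<bullet> assoc D T T T"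
proof (rule chain_colimit_eqI[OF colim_TTT])
  fix a assume a [simp]: "a \<in> W"
  obtain b where b [simp]: "b \<in> W" "a \<in> below b" using above[OF a] by blast
  obtain c where c [simp]: "c \<in> W" "b \<in> below c" using above[OF b(1)] by blast
  have "(mu \<bullet> (mu \<star> id1 T)) \<bullet> ((inc a \<star> inc a) \<star> inc a) = mu \<bullet> ((mu \<star> id1 T) \<bullet> ((inc a \<star> inc a) \<star> inc a))"
    by (intro D1.assoc_comp) simp_all
  also have "(mu \<star> id1 T) \<bullet> ((inc a \<star> inc a) \<star> inc a) = (inc b \<bullet> pr a b) \<star> (inc b \<bullet> tr a b)"
    using mu(2)[OF a] p_eq[OF b(2)] inc_tr[OF b(2)] by (simp add: interchange)
  also have "mu \<bullet> \<dots> = p b \<bullet> (pr a b \<star> tr a b)"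
    by (intro mu_pair) simp_all
  also have "\<dots> = inc c \<bullet> (pr b c \<bullet> (pr a b \<star> tr a b))"
    unfolding p_eq[OF c(2)] by (intro D1.assoc_comp) simp_all
  also have "\<dots> = inc c \<bullet> (pr b c \<bullet> ((tr a b \<star> pr a b) \<bullet> assoc D (ob a) (ob a) (ob a)))"
    using stage_eqns(8)[OF c(2) b(2)] by simp
  also have "\<dots> = (p b \<bullet> (tr a b \<star> pr a b)) \<bullet> assoc D (ob a) (ob a) (ob a)"
    unfolding p_eq[OF c(2)] by (simp add: D1.assoc_comp)
  also have "p b \<bullet> (tr a b \<star> pr a b) = mu \<bullet> ((inc b \<bullet> tr a b) \<star> (inc b \<bullet> pr a b))"
    by (intro mu_pair[symmetric]) simp_all
  also have "(inc b \<bullet> tr a b) \<star> (inc b \<bullet> pr a b) = (id1 T \<star> mu) \<bullet> (inc a \<star> (inc a \<star> inc a))"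
    using mu(2)[OF a] p_eq[OF b(2)] inc_tr[OF b(2)] by (simp add: interchange)
  also have "(mu \<bullet> ((id1 T \<star> mu) \<bullet> (inc a \<star> (inc a \<star> inc a)))) \<bullet> assoc D (ob a) (ob a) (ob a) =
      mu \<bullet> ((id1 T \<star> mu) \<bullet> ((inc a \<star> (inc a \<star> inc a)) \<bullet> assoc D (ob a) (ob a) (ob a)))"
    by (simp add: D1.assoc_comp)
  also have "(inc a \<star> (inc a \<star> inc a)) \<bullet> assoc D (ob a) (ob a) (ob a) = assoc D T T T \<bullet>
      ((inc a \<star> inc a) \<star> inc a)"
    using assoc_natural[of "inc a" "inc a" "inc a"] by (simp add: composable2_def)
  also have "mu \<bullet> ((id1 T \<star> mu) \<bullet> \<dots>) = (mu \<bullet> (id1 T \<star> mu) \<bullet> assoc D T T T) \<bullet> ((inc a \<star> inc a) \<star> inc a)"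
    by (simp add: D1.assoc_comp)
  finally show "(mu \<bullet> (mu \<star> id1 T)) \<bullet> ((inc a \<star> inc a) \<star> inc a) =
      (mu \<bullet> (id1 T \<star> mu) \<bullet> assoc D T T T) \<bullet> ((inc a \<star> inc a) \<star> inc a)" .
qed simp_all

lemma free_monad: "is_monad D free"
proof -
  have "globular D mu" "globular D eta" unfolding globular_def by (auto intro!: bexI[of _ X])
  then show ?thesis
    unfolding is_monad_def Let_def free_def
    using mu_assoc mu_unit_left mu_unit_right
    by (simp add: End_cat_def subcat_def Hom_iff)
qed

end

section \<open>The universal property of the free monad\<close>
locale free_monad_extension = free_monad_stages D \<kappa> \<mu> X M S + monad_at D N
  for D :: "('o, 'v, 'h, 'c) dblcat" (structure) and \<kappa> \<mu> :: "'u rel"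
    and X :: 'o and M :: 'h and S :: "'u \<Rightarrow> 'h \<times> ('u gen \<Rightarrow> 'c)" and N :: "('h, 'c) mnd" +
  fixes f :: 'v and h :: 'c
  assumes h_cell: "h \<in> cell f f M B"
begin

lemma h_simps [simp]:
  "h \<in> Arr1" "Dom1 h = M" "Cod1 h = B" "sA h = f" "tA h = f"
  "f \<in> Arr (D0 D)" "Dom (D0 D) f = X" "Cod (D0 D) f = Y"
proof -
  show h: "h \<in> Arr1" "Dom1 h = M" "Cod1 h = B" "sA h = f" "tA h = f"
    using h_cell by (auto simp: cell_iff)
  show "f \<in> Arr (D0 D)" "Dom (D0 D) f = X" "Cod (D0 D) f = Y"
    using is_functorD(5)[OF src_functor h(1)] arr_ends[OF h(1)] h by auto
qed

text \<open>
  The values that multiplicativity forces on the generators of a stage if \<open>\<beta>\<close> is the extension of \<open>h\<close>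
  to the earlier stages.
\<close>
definition legs :: "('u \<Rightarrow> 'c) \<Rightarrow> 'u gen \<Rightarrow> 'c" where
  "legs \<beta> i = (case i of Unit \<Rightarrow> unit N \<bullet> uA f | Gen \<Rightarrow> h | Prev b \<Rightarrow> \<beta> b | Prod b \<Rightarrow> sq (\<beta> b))"

lemma legs_simps [simp]:
  "legs \<beta> Unit = unit N \<bullet> uA f" "legs \<beta> Gen = h" "legs \<beta> (Prev b) = \<beta> b"
  "legs \<beta> (Prod b) = sq (\<beta> b)"
  by (simp_all add: legs_def)

definition extends :: "('u \<Rightarrow> 'c) \<Rightarrow> 'u \<Rightarrow> 'c \<Rightarrow> bool" where
  "extends \<beta> a r \<longleftrightarrow> r \<in> cell f f (ob a) B \<and> r \<bullet> un a = unit N \<bullet> uA f \<and> r \<bullet> gn a = h \<and>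
     (\<forall>b \<in> below a. r \<bullet> tr b a = \<beta> b \<and> r \<bullet> pr b a = sq (\<beta> b))"

text \<open>
  The values forced on the generators satisfy the equations of the stage, because \<open>\<beta>\<close> satisfies its
  equations at earlier stages and because of the laws of the monad \<open>N\<close>.
\<close>
lemma extends_exists:
  assumes c: "c \<in> W" and IH: "\<And>b. b \<in> below c \<Longrightarrow> extends \<beta> b (\<beta> b)"
  shows "\<exists>r. extends \<beta> c r"
proof -
  have \<beta> [simp]: "\<beta> b \<in> Arr1" "Dom1 (\<beta> b) = ob b" "Cod1 (\<beta> b) = B" "sA (\<beta> b) = f" "tA (\<beta> b) = f"
    if "b \<in> below c" for b
    using IH[OF that] by (auto simp: extends_def cell_iff)
  have \<beta>_cell: "\<beta> b \<in> cell f f (ob b) B" if "b \<in> below c" for b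
    using IH[OF that] by (simp add: extends_def)
  have \<beta>_un: "\<beta> b \<bullet> un b = unit N \<bullet> uA f" and \<beta>_gn: "\<beta> b \<bullet> gn b = h" if "b \<in> below c" for b
    using IH[OF that] by (auto simp: extends_def)
  have \<beta>_tr: "\<beta> b \<bullet> tr a b = \<beta> a" and \<beta>_pr: "\<beta> b \<bullet> pr a b = sq (\<beta> a)"
    if "b \<in> below c" "a \<in> below b" for a b
    using IH[OF that(1)] that(2) by (auto simp: extends_def)
  have W [simp]: "b \<in> W" if "b \<in> below c" for b using below_W that by blast
  have mult_pair: "sq (\<beta> b) \<bullet> (\<phi> \<star> \<psi>) = mult N \<bullet> ((\<beta> b \<bullet> \<phi>) \<star> (\<beta> b \<bullet> \<psi>))"
    if "b \<in> below c" "\<phi> \<in> Arr1" "\<psi> \<in> Arr1" "Cod1 \<phi> = ob b" "Cod1 \<psi> = ob b" "sA \<phi> = tA \<psi>" for b \<phi> \<psi>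
    using that by (simp add: D1.assoc_comp interchange)
  have step: "(unit N \<bullet> uA f) \<bullet> id1 (uO X) = \<beta> b \<bullet> un b \<and> h \<bullet> id1 M = \<beta> b \<bullet> gn b \<and>
      \<beta> b \<bullet> lunit D (ob b) = sq (\<beta> b) \<bullet> (un b \<star> id1 (ob b)) \<and>
      \<beta> b \<bullet> runit D (ob b) = sq (\<beta> b) \<bullet> (id1 (ob b) \<star> un b)" if b: "b \<in> below c" for b
  proof (intro conjI)
    show "(unit N \<bullet> uA f) \<bullet> id1 (uO X) = \<beta> b \<bullet> un b" "h \<bullet> id1 M = \<beta> b \<bullet> gn b"
      using \<beta>_un[OF b] \<beta>_gn[OF b] by simp_all
    have "sq (\<beta> b) \<bullet> (un b \<star> id1 (ob b)) = mult N \<bullet> ((unit N \<bullet> uA f) \<star> \<beta> b)"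
      using b \<beta>_un[OF b] by (subst mult_pair) simp_all
    then show "\<beta> b \<bullet> lunit D (ob b) = sq (\<beta> b) \<bullet> (un b \<star> id1 (ob b))"
      using mult_unit_left[OF \<beta>_cell[OF b]] by simp
    have "sq (\<beta> b) \<bullet> (id1 (ob b) \<star> un b) = mult N \<bullet> (\<beta> b \<star> (unit N \<bullet> uA f))"
      using b \<beta>_un[OF b] by (subst mult_pair) simp_all
    then show "\<beta> b \<bullet> runit D (ob b) = sq (\<beta> b) \<bullet> (id1 (ob b) \<star> un b)"
      using mult_unit_right[OF \<beta>_cell[OF b]] by simp
  qed
  have step2: "\<beta> a \<bullet> id1 (ob a) = \<beta> b \<bullet> tr a b \<and>
      sq (\<beta> a) \<bullet> id1 (ob a \<odot> ob a) = sq (\<beta> b) \<bullet> (tr a b \<star> tr a b) \<and>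
      sq (\<beta> a) \<bullet> id1 (ob a \<odot> ob a) = \<beta> b \<bullet> pr a b \<and>
      sq (\<beta> b) \<bullet> (pr a b \<star> tr a b) =
      sq (\<beta> b) \<bullet> ((tr a b \<star> pr a b) \<bullet> assoc D (ob a) (ob a) (ob a))"
    if b: "b \<in> below c" and a: "a \<in> below b" for a b
  proof (intro conjI)
    have ac [simp]: "a \<in> below c" using below_trans a b by blast
    show "\<beta> a \<bullet> id1 (ob a) = \<beta> b \<bullet> tr a b" using \<beta>_tr[OF b a] by simp
    show "sq (\<beta> a) \<bullet> id1 (ob a \<odot> ob a) = sq (\<beta> b) \<bullet> (tr a b \<star> tr a b)"
      using a b \<beta>_tr[OF b a] by (subst mult_pair) simp_all
    show "sq (\<beta> a) \<bullet> id1 (ob a \<odot> ob a) = \<beta> b \<bullet> pr a b"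
      using \<beta>_pr[OF b a] by simp
    have "sq (\<beta> b) \<bullet> (pr a b \<star> tr a b) = mult N \<bullet> (sq (\<beta> a) \<star> \<beta> a)"
      using a b \<beta>_tr[OF b a] \<beta>_pr[OF b a] by (subst mult_pair) simp_all
    also have "\<dots> = mult N \<bullet> (\<beta> a \<star> sq (\<beta> a)) \<bullet> assoc D (ob a) (ob a) (ob a)"
      by (rule mult_assoc[OF \<beta>_cell[OF ac]])
    also have "mult N \<bullet> (\<beta> a \<star> sq (\<beta> a)) = sq (\<beta> b) \<bullet> (tr a b \<star> pr a b)"
      using a b \<beta>_tr[OF b a] \<beta>_pr[OF b a] by (subst mult_pair) simp_all
    finally show "sq (\<beta> b) \<bullet> (pr a b \<star> tr a b) =
        sq (\<beta> b) \<bullet> ((tr a b \<star> pr a b) \<bullet> assoc D (ob a) (ob a) (ob a))"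
      using a b by (simp add: D1.assoc_comp)
  qed
  have lc: "\<forall>i \<in> gens c. legs \<beta> i \<in> cell f f (gobj X M S i) B"
    unfolding gens_iff by (simp add: cell_iff ob_def[symmetric])
  have "solution (D1 D) (gens c) (gobj X M S) (eqns X M S c) B (legs \<beta>)"
    unfolding solution_def
  proof (intro conjI)
    show "B \<in> Obj1" by simp
    show "\<forall>i \<in> gens c. legs \<beta> i \<in> Hom1 (gobj X M S i) B" using lc by (simp add: cell_def)
    show "\<forall>i \<phi> j \<psi>. ((i, \<phi>), (j, \<psi>)) \<in> eqns X M S c \<longrightarrow> legs \<beta> i \<bullet> \<phi> = legs \<beta> j \<bullet> \<psi>"
      unfolding eqns_iff legs_simps ob_def[symmetric] un_def[symmetric] gn_def[symmetric] pr_def[symmetric]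
      using step step2 by (intro ballI conjI; (simp only: tr_below)?; blast)
  qed
  then obtain r where r: "r \<in> Hom1 (ob c) B" "\<forall>i \<in> gens c. r \<bullet> snd (S c) i = legs \<beta> i"
    using stage[OF c] lc unfolding presents_def ob_def by blast
  have rl: "r \<bullet> un c = unit N \<bullet> uA f" "r \<bullet> gn c = h" "\<forall>b \<in> below c. r \<bullet> tr b c = \<beta> b \<and> r \<bullet> pr b c = sq (\<beta> b)"
    using r(2) unfolding gens_iff by (simp_all add: un_def gn_def pr_def tr_below)
  have rA: "r \<in> Arr1" "Dom1 r = ob c" "Cod1 r = B" using r by (auto simp: Hom_iff)
  have "Dom (D0 D) (sA r) = X" "Dom (D0 D) (tA r) = X" using arr_ends[OF rA(1)] rA c by simp_all
  then have "sA (r \<bullet> gn c) = sA r" "tA (r \<bullet> gn c) = tA r" using rA c by simp_all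
  then have "r \<in> cell f f (ob c) B" using rA rl by (simp add: cell_iff)
  with rl show ?thesis unfolding extends_def by blast
qed

lemma extension_family_exists: "\<exists>\<beta>. \<forall>a \<in> W. extends \<beta> a (\<beta> a)"
proof -
  define P where "P \<beta> a r \<longleftrightarrow> (a \<in> W \<longrightarrow> extends \<beta> a r)" for \<beta> a r
  have "\<exists>\<beta>. \<forall>a. P \<beta> a (\<beta> a)"
  proof (rule dependent_wf_choice[OF \<mu>_wf])
    show "P \<beta> a r = P \<beta>' a r" if "\<And>b. (b, a) \<in> \<mu> - Id \<Longrightarrow> \<beta> b = \<beta>' b" for \<beta> \<beta>' a r
      using that by (simp add: P_def extends_def below_def)
    show "\<exists>r. P \<beta> a r" if "\<And>b. (b, a) \<in> \<mu> - Id \<Longrightarrow> P \<beta> b (\<beta> b)" for a \<beta>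
      using extends_exists[of a \<beta>] that below_W unfolding P_def below_def by blast
  qed
  then show ?thesis unfolding P_def by blast
qed

lemma extension_exists: "\<exists>g. is_monad_morphism D free g N \<and> g \<bullet> gen = h"
proof -
  obtain \<beta> where \<beta>: "\<And>a. a \<in> W \<Longrightarrow> extends \<beta> a (\<beta> a)" using extension_family_exists by blast
  have \<beta>A [simp]: "\<beta> a \<in> Arr1" "Dom1 (\<beta> a) = ob a" "Cod1 (\<beta> a) = B" "sA (\<beta> a) = f" "tA (\<beta> a) = f"
    if "a \<in> W" for a using \<beta>[OF that] by (auto simp: extends_def cell_iff)
  have "chain_cocone ob tr B \<beta>"
    unfolding chain_cocone_def
  proof (intro conjI ballI allI impI)
    show "a \<in> W \<Longrightarrow> \<beta> a \<in> Hom1 (ob a) B" for a by (simp add: Hom_iff)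
    fix a b assume ab: "(a, b) \<in> \<mu>"
    then have "a \<in> W" "b \<in> W" using \<mu>_Field by blast+
    then show "\<beta> b \<bullet> tr a b = \<beta> a"
      using \<beta>[of b] ab by (cases "a = b") (auto simp: tr_def extends_def below_iff)
  qed simp
  then obtain g where g: "g \<in> Hom1 T B" "\<And>a. a \<in> W \<Longrightarrow> g \<bullet> inc a = \<beta> a"
    using chain_colimitD(7)[OF colim] by blast
  have gA [simp]: "g \<in> Arr1" "Dom1 g = T" "Cod1 g = B" using g by (auto simp: Hom_iff)
  obtain a0 where a0: "a0 \<in> W" using \<mu>_nonempty by blast
  have "Dom (D0 D) (sA g) = X" "Dom (D0 D) (tA g) = X"
    by (rule arr_ends(1,3)[OF gA(1), unfolded gA(2) T_simps, symmetric])+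
  then have "sA (g \<bullet> inc a0) = sA g" "tA (g \<bullet> inc a0) = tA g" using a0 by simp_all
  then have gb [simp]: "sA g = f" "tA g = f" using g(2)[OF a0] a0 by simp_all
  have "mult N \<bullet> (g \<star> g) = g \<bullet> mu"
  proof (rule chain_colimit_eqI[OF colim_TT])
    fix a assume a: "a \<in> W"
    obtain b where b: "b \<in> W" "a \<in> below b" using above[OF a] by blast
    have "(mult N \<bullet> (g \<star> g)) \<bullet> (inc a \<star> inc a) = sq (\<beta> a)"
      using a g(2)[OF a] by (simp add: D1.assoc_comp interchange)
    also have "\<dots> = (g \<bullet> inc b) \<bullet> pr a b"
      using \<beta>[OF b(1)] b(2) g(2)[OF b(1)] by (simp add: extends_def)
    also have "\<dots> = g \<bullet> p a"
      unfolding p_eq[OF b(2)] using a b by (intro D1.assoc_comp) simp_all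
    also have "\<dots> = (g \<bullet> mu) \<bullet> (inc a \<star> inc a)"
      using a mu(2)[OF a] by (simp add: D1.assoc_comp)
    finally show "(mult N \<bullet> (g \<star> g)) \<bullet> (inc a \<star> inc a) = (g \<bullet> mu) \<bullet> (inc a \<star> inc a)" .
  qed simp_all
  moreover have "g \<bullet> eta = unit N \<bullet> uA (sA g)"
  proof -
    have "g \<bullet> eta = (g \<bullet> inc a0) \<bullet> un a0" unfolding eta[OF a0] using a0 by (simp add: D1.assoc_comp)
    then show ?thesis using g(2)[OF a0] \<beta>[OF a0] by (simp add: extends_def)
  qed
  moreover have "g \<bullet> gen = h"
  proof -
    have "g \<bullet> gen = (g \<bullet> inc a0) \<bullet> gn a0" unfolding gen[OF a0] using a0 by (simp add: D1.assoc_comp)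
    then show ?thesis using g(2)[OF a0] \<beta>[OF a0] by (simp add: extends_def)
  qed
  ultimately show ?thesis
    unfolding is_monad_morphism_def using free_monad monad
    by (intro exI[of _ g]) (simp add: free_def End_cat_def subcat_def Hom_iff)
qed

text \<open>
  Every monad morphism that restricts to \<open>h\<close> takes the forced values; uniqueness follows from this by
  induction over the stages.
\<close>
lemma extension_extends:
  assumes m: "is_monad_morphism D free g N" and gh: "g \<bullet> gen = h"
  shows "g \<in> Arr1" "Dom1 g = T" "Cod1 g = B" "sA g = f" "tA g = f"
    and "a \<in> W \<Longrightarrow> extends (\<lambda>a. g \<bullet> inc a) a (g \<bullet> inc a)"
proof -
  show gA: "g \<in> Arr1" "Dom1 g = T" "Cod1 g = B"
    using m by (auto simp: is_monad_morphism_def End_cat_def subcat_def Hom_iff free_def)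
  have gm: "mult N \<bullet> (g \<star> g) = g \<bullet> mu" and gu: "g \<bullet> eta = unit N \<bullet> uA (sA g)"
    using m by (auto simp: is_monad_morphism_def free_def)
  note [simp] = gA
  have "Dom (D0 D) (sA g) = X" "Dom (D0 D) (tA g) = X"
    by (rule arr_ends(1,3)[OF gA(1), unfolded gA(2) T_simps, symmetric])+
  then have "sA (g \<bullet> gen) = sA g" "tA (g \<bullet> gen) = tA g" by simp_all
  then show gb [simp]: "sA g = f" "tA g = f" using gh by simp_all
  assume a: "a \<in> W"
  have "(g \<bullet> inc a) \<bullet> un a = unit N \<bullet> uA f"
    using a eta[OF a] gu by (simp add: D1.assoc_comp)
  moreover have "(g \<bullet> inc a) \<bullet> gn a = h"
    using a gen[OF a] gh by (simp add: D1.assoc_comp)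
  moreover have "(g \<bullet> inc a) \<bullet> tr b a = g \<bullet> inc b \<and> (g \<bullet> inc a) \<bullet> pr b a = mult N \<bullet> ((g \<bullet> inc b) \<star> (g \<bullet> inc b))"
    if b: "b \<in> below a" for b
  proof
    have bW: "b \<in> W" using below_W b by blast
    show "(g \<bullet> inc a) \<bullet> tr b a = g \<bullet> inc b" using a b inc_tr[OF b] by (simp add: D1.assoc_comp)
    have "(g \<bullet> inc a) \<bullet> pr b a = g \<bullet> (mu \<bullet> (inc b \<star> inc b))"
      using a b p_eq[OF b] mu(2)[OF bW] by (simp add: D1.assoc_comp)
    also have "\<dots> = (g \<bullet> mu) \<bullet> (inc b \<star> inc b)"
      using bW by (intro D1.assoc_comp[symmetric]) simp_all
    also have "\<dots> = mult N \<bullet> ((g \<star> g) \<bullet> (inc b \<star> inc b))"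
      unfolding gm[symmetric] using bW by (intro D1.assoc_comp) simp_all
    finally show "(g \<bullet> inc a) \<bullet> pr b a = mult N \<bullet> ((g \<bullet> inc b) \<star> (g \<bullet> inc b))"
      using bW by (simp add: interchange)
  qed
  moreover have "g \<bullet> inc a \<in> cell f f (ob a) B" using a by (simp add: cell_iff)
  ultimately show "extends (\<lambda>a. g \<bullet> inc a) a (g \<bullet> inc a)" unfolding extends_def by blast
qed

lemma extension_unique:
  assumes g: "is_monad_morphism D free g N" "g \<bullet> gen = h" and g': "is_monad_morphism D free g' N" "g' \<bullet> gen = h"
  shows "g = g'"
proof -
  note G = extension_extends[OF g] and G' = extension_extends[OF g']
  have "a \<in> W \<longrightarrow> g \<bullet> inc a = g' \<bullet> inc a" for a
  proof (induction a rule: wf_induct_rule[OF \<mu>_wf])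
    case (1 c)
    show ?case
    proof
      assume c: "c \<in> W"
      have eq: "g \<bullet> inc b = g' \<bullet> inc b" if "b \<in> below c" for b
        using 1[of b] that below_W[OF that] by (simp add: below_def)
      have e: "extends (\<lambda>a. g \<bullet> inc a) c (g \<bullet> inc c)" "extends (\<lambda>a. g' \<bullet> inc a) c (g' \<bullet> inc c)"
        using G(6) G'(6) c by blast+
      show "g \<bullet> inc c = g' \<bullet> inc c"
        by (rule stage_eqI[OF c]) (use e eq in \<open>auto simp: extends_def cell_iff\<close>)
    qed
  qed
  then show ?thesis
    using G G' by - (rule chain_colimit_eqI[OF colim], simp_all)
qed

end

section \<open>The forgetful functor and its left adjoint\<close>
context double_category
begin

lemma End_simps [simp]:
  "A \<in> Obj (End_cat D) \<longleftrightarrow> A \<in> Obj1 \<and> sO A = tO A"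
  "\<alpha> \<in> Arr (End_cat D) \<longleftrightarrow> \<alpha> \<in> Arr1 \<and> sA \<alpha> = tA \<alpha>"
  "Dom (End_cat D) = Dom1" "Cod (End_cat D) = Cod1" "Ident (End_cat D) = id1"
  "\<beta> \<cdot>\<^bsub>End_cat D\<^esub> \<alpha> = \<beta> \<bullet> \<alpha>"
  by (auto simp: End_cat_def subcat_def)

lemma category_End: "category (End_cat D)"
proof
  fix f assume f: "f \<in> Arr (End_cat D)"
  then show "Dom (End_cat D) f \<in> Obj (End_cat D)" "Cod (End_cat D) f \<in> Obj (End_cat D)" by simp_all
qed (auto simp: Hom_iff D1.assoc_comp)

lemma Mnd_simps [simp]:
  "N \<in> Obj (Mnd_cat D) \<longleftrightarrow> is_monad D N" "(N, \<alpha>, N') \<in> Arr (Mnd_cat D) \<longleftrightarrow> is_monad_morphism D N \<alpha> N'"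
  "Dom (Mnd_cat D) (N, \<alpha>, N') = N" "Cod (Mnd_cat D) (N, \<alpha>, N') = N'"
  "Ident (Mnd_cat D) N = (N, id1 (carr N), N)"
  "(N1, \<beta>, N2) \<cdot>\<^bsub>Mnd_cat D\<^esub> (N, \<alpha>, N') = (N, \<beta> \<bullet> \<alpha>, N2)"
  by (auto simp: Mnd_cat_def)

lemma monad_morphismD:
  assumes "is_monad_morphism D N \<alpha> N'"
  shows "is_monad D N" "is_monad D N'" "\<alpha> \<in> Arr1" "Dom1 \<alpha> = carr N" "Cod1 \<alpha> = carr N'" "tA \<alpha> = sA \<alpha>"
    "mult N' \<bullet> (\<alpha> \<star> \<alpha>) = \<alpha> \<bullet> mult N" "\<alpha> \<bullet> unit N = unit N' \<bullet> uA (sA \<alpha>)"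
  using assms by (auto simp: is_monad_morphism_def Hom_iff)

lemma monad_morphism_id:
  assumes "is_monad D N"
  shows "is_monad_morphism D N (id1 (carr N)) N"
proof -
  interpret monad_at D N by unfold_locales fact
  show ?thesis using assms unfolding is_monad_morphism_def by (simp add: Hom_iff)
qed

lemma monad_morphism_comp:
  assumes \<alpha>: "is_monad_morphism D N \<alpha> N'" and \<beta>: "is_monad_morphism D N' \<beta> N''"
  shows "is_monad_morphism D N (\<beta> \<bullet> \<alpha>) N''"
proof -
  interpret N: monad_at D N by unfold_locales (rule monad_morphismD[OF \<alpha>])
  interpret N': monad_at D N' by unfold_locales (rule monad_morphismD[OF \<beta>])
  interpret N'': monad_at D N'' by unfold_locales (rule monad_morphismD[OF \<beta>])
  note [simp] = monad_morphismD(3-6)[OF \<alpha>] monad_morphismD(3-6)[OF \<beta>]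
  note a = monad_morphismD(7,8)[OF \<alpha>] and b = monad_morphismD(7,8)[OF \<beta>]
  have ends [simp]: "Dom (D0 D) (sA \<alpha>) = N.Y" "Cod (D0 D) (sA \<alpha>) = N'.Y"
    "Dom (D0 D) (sA \<beta>) = N'.Y" "Cod (D0 D) (sA \<beta>) = N''.Y"
    using arr_ends(1,2)[of \<alpha>] arr_ends(1,2)[of \<beta>] by simp_all
  have "mult N'' \<bullet> ((\<beta> \<bullet> \<alpha>) \<star> (\<beta> \<bullet> \<alpha>)) = (mult N'' \<bullet> (\<beta> \<star> \<beta>)) \<bullet> (\<alpha> \<star> \<alpha>)"
    by (simp add: D1.assoc_comp interchange)
  also have "\<dots> = \<beta> \<bullet> (mult N' \<bullet> (\<alpha> \<star> \<alpha>))" unfolding b(1) by (simp add: D1.assoc_comp)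
  also have "\<dots> = (\<beta> \<bullet> \<alpha>) \<bullet> mult N" unfolding a(1) by (simp add: D1.assoc_comp)
  finally have m: "mult N'' \<bullet> ((\<beta> \<bullet> \<alpha>) \<star> (\<beta> \<bullet> \<alpha>)) = (\<beta> \<bullet> \<alpha>) \<bullet> mult N" .
  have "(\<beta> \<bullet> \<alpha>) \<bullet> unit N = \<beta> \<bullet> (\<alpha> \<bullet> unit N)" by (simp add: D1.assoc_comp)
  also have "\<dots> = (\<beta> \<bullet> unit N') \<bullet> uA (sA \<alpha>)" unfolding a(2) by (simp add: D1.assoc_comp)
  also have "\<dots> = unit N'' \<bullet> uA (sA (\<beta> \<bullet> \<alpha>))" unfolding b(2) by (simp add: D1.assoc_comp)
  finally have u: "(\<beta> \<bullet> \<alpha>) \<bullet> unit N = unit N'' \<bullet> uA (sA (\<beta> \<bullet> \<alpha>))" .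
  show ?thesis
    using m u monad_morphismD(1)[OF \<alpha>] monad_morphismD(2)[OF \<beta>] unfolding is_monad_morphism_def
    by (simp add: Hom_iff)
qed

lemma Mnd_Hom: "g \<in> Hom (Mnd_cat D) N N' \<longleftrightarrow> (\<exists>\<alpha>. g = (N, \<alpha>, N') \<and> is_monad_morphism D N \<alpha> N')"
  by (cases g) (auto simp: Hom_iff)

lemma category_Mnd: "category (Mnd_cat D)"
proof
  fix f assume "f \<in> Arr (Mnd_cat D)"
  then obtain N \<alpha> N' where f: "f = (N, \<alpha>, N')" "is_monad_morphism D N \<alpha> N'" by (cases f) auto
  show "Dom (Mnd_cat D) f \<in> Obj (Mnd_cat D)" "Cod (Mnd_cat D) f \<in> Obj (Mnd_cat D)"
    using monad_morphismD(1,2)[OF f(2)] f(1) by simp_all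
next
  show "N \<in> Obj (Mnd_cat D) \<Longrightarrow> Ident (Mnd_cat D) N \<in> Hom (Mnd_cat D) N N" for N
    by (simp add: Hom_iff monad_morphism_id)
next
  fix N N' f assume "f \<in> Hom (Mnd_cat D) N N'"
  then obtain \<alpha> where f: "f = (N, \<alpha>, N')" "is_monad_morphism D N \<alpha> N'" by (auto simp: Mnd_Hom)
  show "Ident (Mnd_cat D) N' \<cdot>\<^bsub>Mnd_cat D\<^esub> f = f" "f \<cdot>\<^bsub>Mnd_cat D\<^esub> Ident (Mnd_cat D) N = f"
    using monad_morphismD(3-5)[OF f(2)] f(1) by simp_all
  fix P g assume "g \<in> Hom (Mnd_cat D) N' P"
  then obtain \<beta> where g: "g = (N', \<beta>, P)" "is_monad_morphism D N' \<beta> P" by (auto simp: Mnd_Hom)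
  show "g \<cdot>\<^bsub>Mnd_cat D\<^esub> f \<in> Hom (Mnd_cat D) N P"
    using f g monad_morphism_comp[OF f(2) g(2)] by (simp add: Mnd_Hom)
  fix P' h assume "h \<in> Hom (Mnd_cat D) P P'"
  then obtain \<gamma> where h: "h = (P, \<gamma>, P')" "is_monad_morphism D P \<gamma> P'" by (auto simp: Mnd_Hom)
  show "h \<cdot>\<^bsub>Mnd_cat D\<^esub> g \<cdot>\<^bsub>Mnd_cat D\<^esub> f = h \<cdot>\<^bsub>Mnd_cat D\<^esub> (g \<cdot>\<^bsub>Mnd_cat D\<^esub> f)"
    using f g h monad_morphismD(3-5)[OF f(2)] monad_morphismD(3-5)[OF g(2)] monad_morphismD(3-5)[OF h(2)]
    by (simp add: D1.assoc_comp)
qed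

lemma forget_simps [simp]: "omap forget N = carr N" "amap forget (N, \<alpha>, N') = \<alpha>"
  by (simp_all add: forget_def)

lemma forget_functor: "is_functor (Mnd_cat D) (End_cat D) forget"
  unfolding is_functor_def
proof (intro conjI ballI impI category_Mnd category_End)
  fix N assume "N \<in> Obj (Mnd_cat D)"
  then show "omap forget N \<in> Obj (End_cat D)" "amap forget (Ident (Mnd_cat D) N) = Ident (End_cat D)
      (omap forget N)"
    by (simp_all add: is_monad_def Let_def)
next
  fix f assume "f \<in> Arr (Mnd_cat D)"
  then obtain N \<alpha> N' where f: "f = (N, \<alpha>, N')" "is_monad_morphism D N \<alpha> N'" by (cases f) auto
  then show "amap forget f \<in> Hom (End_cat D) (omap forget (Dom (Mnd_cat D) f)) (omap forget (Cod
      (Mnd_cat D) f))"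
    by (simp add: is_monad_morphism_def)
  fix g assume "g \<in> Arr (Mnd_cat D)" "Dom (Mnd_cat D) g = Cod (Mnd_cat D) f"
  then show "amap forget (g \<cdot>\<^bsub>Mnd_cat D\<^esub> f) = amap forget g \<cdot>\<^bsub>End_cat D\<^esub> amap forget f"
    using f by (cases g) simp
qed

end

lemma (in presentable_dbl) free_monad_exists:
  assumes M: "M \<in> Obj (End_cat D)"
  shows "\<exists>F \<eta>. universal_arrow (Mnd_cat D) (End_cat D) forget M F \<eta>"
proof -
  define X where "X = sO M"
  have M1: "M \<in> Obj1" "sO M = tO M" using M by simp_all
  have M': "X \<in> Obj (D0 D)" "M \<in> Obj1" "sO M = X" "tO M = X"
    using M1 by (simp_all add: X_def)
  obtain S where S: "\<forall>a \<in> W. presents X (gens a) (gobj X M S) (eqns X M S a) (fst (S a)) (snd (S a))"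
    using stages_exist[OF M'] by blast
  interpret free_monad_stages D \<kappa> \<mu> X M S
    using M' S by unfold_locales auto
  have "\<exists>!g. g \<in> Hom (Mnd_cat D) free N \<and> amap forget g \<cdot>\<^bsub>End_cat D\<^esub> gen = h"
    if N: "is_monad D N" and h: "h \<in> Hom (End_cat D) M (carr N)" for N h
  proof -
    obtain f where "h \<in> cell f f M (carr N)" using h by (auto simp: cell_iff Hom_iff)
    with N interpret free_monad_extension D \<kappa> \<mu> X M S N f h by unfold_locales
    obtain \<alpha> where \<alpha>: "is_monad_morphism D free \<alpha> N" "\<alpha> \<bullet> gen = h" using extension_exists by blast
    show ?thesis
    proof (rule ex1I[of _ "(free, \<alpha>, N)"])
      show "(free, \<alpha>, N) \<in> Hom (Mnd_cat D) free N \<and> amap forget (free, \<alpha>, N) \<cdot>\<^bsub>End_cat D\<^esub> gen = h"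
        using \<alpha> by (simp add: Mnd_Hom)
      fix g assume g: "g \<in> Hom (Mnd_cat D) free N \<and> amap forget g \<cdot>\<^bsub>End_cat D\<^esub> gen = h"
      then obtain \<beta> where "g = (free, \<beta>, N)" "is_monad_morphism D free \<beta> N" unfolding Mnd_Hom by blast
      moreover from this have "\<beta> \<bullet> gen = h" using g by simp
      ultimately show "g = (free, \<alpha>, N)" using extension_unique[of \<beta> \<alpha>] \<alpha> by blast
    qed
  qed
  moreover have "gen \<in> Hom (End_cat D) M (carr free)" by (simp add: Hom_iff free_def)
  ultimately have "universal_arrow (Mnd_cat D) (End_cat D) forget M free gen"
    using free_monad unfolding universal_arrow_def by simp
  then show ?thesis by blast
qed

theorem proposition3p2:
  fixes \<kappa> :: "'u rel" and D :: "('o, 'v, 'h, 'c) dblcat"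
  assumes "inaccessible \<kappa>"
    and "locally_presentable_dbl \<kappa> D"
  shows "has_left_adjoint (Mnd_cat D) (End_cat D) forget"
proof -
  obtain \<theta> where D: "locally_presentable_dbl_at \<kappa> \<theta> D"
    using assms(2) by (auto simp: locally_presentable_dbl_def)
  then obtain \<mu> where \<mu>: "small_regular \<kappa> \<mu>" "\<forall>M \<in> Obj (D1 D).
        accessible_functor \<kappa> \<mu> (src_fibre D (omap (tgt D) M)) (src_fibre D (omap (src D) M))
            (right_tensor D M) \<and>
        accessible_functor \<kappa> \<mu> (tgt_fibre D (omap (src D) M)) (tgt_fibre D (omap (tgt D) M)) (left_tensor D M)"
    unfolding locally_presentable_dbl_at_def by blast
  interpret double_category D using D by (simp add: locally_presentable_dbl_at_def)
  interpret presentable_dbl D \<kappa> \<mu>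
    using D \<mu> assms(1) by unfold_locales (auto simp: locally_presentable_dbl_at_def locally_presentable_cat_def)
  show ?thesis
    using forget_functor free_monad_exists by (rule left_adjoint_of_universal_arrows)
qed

end
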